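(* Let $\Lambda$ be the path algebra of the linear quiver $1\to2\to\cdots\to n$. Any support tilting set for $\Lambda$ can be arranged into a signed exceptional sequence, i.e. there is a complete exceptional sequence $E_*=(E_1,\dots,E_n)$ with signs $\varepsilon_1,\dots,\varepsilon_n$ such that $(\varepsilon_1E_1,\dots,\varepsilon_nE_n)$ is a signed exceptional sequence whose terms are exactly the elements of the support tilting set. Furthermore, writing $$\Delta E_*=(E_n',\dots,E_1')$$ (so the $k$-th object from the right is $E_k'$), there are signs $\varepsilon_1',\dots,\varepsilon_n'$ such that $(\varepsilon_n'E_n',\dots,\varepsilon_1'E_1')$ is a signed exceptional sequence and $$\varepsilon_k\,\varepsilon_j'\,\chi_\Lambda(E_k,E_j')=\delta_{kj}\quad\text{for all }k,j\in\{1,\dots,n\},$$ where $\delta_{kj}$ is the Kronecker delta. In addition, the signed exceptional sequence $(\varepsilon_n'E_n',\dots,\varepsilon_1'E_1')$ corresponds, under the bijection between signed exceptional sequences and ordered support tilting sets, to the ordered support tilting set $(\varepsilon_nE_n,\dots,\varepsilon_1E_1)$.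
   Context: Let $K$ be a field, $Q: 1\to 2\to\cdots\to n$, $\Lambda=KQ$; modules are finite-dimensional representations of $Q$ over $K$, $P_k$ is the indecomposable projective with simple top at $k$, and $\mathrm{Ext}=\mathrm{Ext}^1_\Lambda$. Put $\chi_\Lambda(X,Y)=\dim\mathrm{Hom}_\Lambda(X,Y)-\dim\mathrm{Ext}_\Lambda(X,Y)$. For a module $Z$, $Z^\perp$ is the full subcategory of modules $Y$ with $\mathrm{Hom}(Z,Y)=0=\mathrm{Ext}(Z,Y)$. A complete exceptional sequence is a sequence $(E_1,\dots,E_n)$ of rigid indecomposable modules (up to isomorphism) with $\mathrm{Hom}(E_j,E_i)=0=\mathrm{Ext}(E_j,E_i)$ for $i<j$. $E_i$ is relatively projective if it is a projective object of $(E_{i+1}\oplus\cdots\oplus E_n)^\perp$. For a module $E$ and sign $\varepsilon\in\{+1,-1\}$, $\varepsilon E$ means $E$ if $\varepsilon=+1$ and the shifted object $E[1]$ if $\varepsilon=-1$; the dimension vector of $E[1]$ is $-\underline{\dim}\,E$. A signed exceptional sequence is a complete exceptional sequence $(E_1,\dots,E_n)$ together with signs $\varepsilon_i\in\{\pm1\}$ such that $\varepsilon_i=-1$ implies that $E_i$ is relatively projective; it is written $(\varepsilon_1E_1,\dots,\varepsilon_nE_n)$. A support tilting set is a set of $n$ nonisomorphic objects $T_1,\dots,T_n$ of the bounded derived category $\mathcal D^b$ of $\Lambda$, each either an indecomposable module or a shifted indecomposable projective module $P_k[1]$, such that $\mathrm{Hom}_{\mathcal D^b}(T_i,T_j[1])=0$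 for all $i,j$; equivalently, $\mathrm{Ext}_\Lambda(M,M')=0$ for all modules $M,M'$ in the set and $\mathrm{Hom}_\Lambda(P_k,M)=0$ for all $P_k[1]$ and modules $M$ in the set. An ordered support tilting set is a support tilting set with a total ordering of its elements. The known bijection (Igusa–Todorov) sends an ordered support tilting set $(T_1,\dots,T_n)$ to the unique signed exceptional sequence $(X_1,\dots,X_n)$ such that for each $i$ the underlying module of $X_i$ lies in $\bigl(\bigoplus_{j>i}|T_j|\bigr)^\perp$, where $|T_j|$ is the underlying module of $T_j$, and $\underline{\dim}\,X_i-\underline{\dim}\,T_i$ is an integer linear combination of the $\underline{\dim}\,T_j$, $j>i$. The braid group $B_n$ acts on complete exceptional sequences by $\sigma_i(E_* )=(E_1,\dots,E_{i-1},E_i',E_i,E_{i+2},\dots,E_n)$, where $E_i'$ is the unique module making this a complete exceptional sequence. Products act as compositions (rightmost factor first). The Garside element is $\Delta=\delta_{n-1}\cdots\delta_2\delta_1$ with $\delta_k=\sigma_1\sigma_2\cdots\sigma_k$. *)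

theory Defs
  imports Complex_Main "HOL-Library.Function_Algebras"
begin

section \<open>Vector spaces\<close>

text \<open>
  Finite-dimensional vector spaces over \<open>'k\<close> are realised as finite-dimensional subspaces of the
  space of all sequences \<open>nat \<Rightarrow> 'k\<close>; every finite-dimensional vector space is isomorphic to
  such a subspace. A linear map between subspaces is represented by the function extended by
  \<open>0\<close> outside its domain, so that linear maps are equal iff the functions are.
\<close>

type_synonym 'k kvec = "nat \<Rightarrow> 'k"

definition vscale :: "'k::field \<Rightarrow> 'k kvec \<Rightarrow> 'k kvec"
  where "vscale c v = (\<lambda>m. c * v m)"

interpretation kvec: vector_space vscale
  by unfold_locales (auto simp: vscale_def fun_eq_iff algebra_simps)

definition fin_dim :: "'k::field kvec set \<Rightarrow> bool"
  where "fin_dim V \<longleftrightarrow> (\<exists>B. finite B \<and> V \<subseteq> kvec.span B)"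

definition lin_maps :: "'k::field kvec set \<Rightarrow> 'k kvec set \<Rightarrow> ('k kvec \<Rightarrow> 'k kvec) set" where
  "lin_maps V W = {f. (\<forall>v\<in>V. f v \<in> W) \<and>
     (\<forall>u\<in>V. \<forall>v\<in>V. f (u + v) = f u + f v) \<and>
     (\<forall>c. \<forall>v\<in>V. f (vscale c v) = vscale c (f v)) \<and>
     (\<forall>v. v \<notin> V \<longrightarrow> f v = 0)}"

section \<open>Representations of the quiver \<open>1 \<rightarrow> 2 \<rightarrow> \<dots> \<rightarrow> n\<close>\<close>

text \<open>The field \<open>arrow M i\<close> is the map along the arrow from \<open>i\<close> to \<open>i + 1\<close>. Values
  at indices that are not vertices (resp. arrows) are ignored.\<close>

record 'k rep =
  vspace :: "nat \<Rightarrow> 'k kvec set"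
  arrow :: "nat \<Rightarrow> 'k kvec \<Rightarrow> 'k kvec"

definition is_rep :: "nat \<Rightarrow> 'k::field rep \<Rightarrow> bool" where
  "is_rep n M \<longleftrightarrow>
     (\<forall>i\<in>{1..n}. kvec.subspace (vspace M i) \<and> fin_dim (vspace M i)) \<and>
     (\<forall>i\<in>{1..<n}. arrow M i \<in> lin_maps (vspace M i) (vspace M (i + 1)))"

definition is_zero_rep :: "nat \<Rightarrow> 'k::field rep \<Rightarrow> bool"
  where "is_zero_rep n M \<longleftrightarrow> (\<forall>i\<in>{1..n}. vspace M i = {0})"

text \<open>Families of linear maps, indexed by vertices and extended by \<open>0\<close>, form a vector space.\<close>

type_synonym 'k fam = "nat \<Rightarrow> 'k kvec \<Rightarrow> 'k kvec"

definition fscale :: "'k::field \<Rightarrow> 'k fam \<Rightarrow> 'k fam"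
  where "fscale c f = (\<lambda>i v. vscale c (f i v))"

interpretation fam: vector_space fscale
  by unfold_locales (auto simp: fscale_def vscale_def fun_eq_iff algebra_simps)

definition Hom :: "nat \<Rightarrow> 'k::field rep \<Rightarrow> 'k rep \<Rightarrow> 'k fam set" where
  "Hom n M N = {f. (\<forall>i\<in>{1..n}. f i \<in> lin_maps (vspace M i) (vspace N i)) \<and>
     (\<forall>i. i \<notin> {1..n} \<longrightarrow> f i = 0) \<and>
     (\<forall>i\<in>{1..<n}. \<forall>v\<in>vspace M i. f (i + 1) (arrow M i v) = arrow N i (f i v))}"

definition comp_hom :: "'k fam \<Rightarrow> 'k fam \<Rightarrow> 'k fam"
  where "comp_hom g f = (\<lambda>i v. g i (f i v))"

definition id_hom :: "nat \<Rightarrow> 'k::field rep \<Rightarrow> 'k fam"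
  where "id_hom n M = (\<lambda>i v. if i \<in> {1..n} \<and> v \<in> vspace M i then v else 0)"

definition iso_rep :: "nat \<Rightarrow> 'k::field rep \<Rightarrow> 'k rep \<Rightarrow> bool" where
  "iso_rep n M N \<longleftrightarrow> (\<exists>f\<in>Hom n M N. \<exists>g\<in>Hom n N M.
     comp_hom g f = id_hom n M \<and> comp_hom f g = id_hom n N)"

text \<open>
  Applying \<open>Hom(-, N)\<close> to the standard projective resolution of \<open>M\<close> over the path algebra gives
  the two-term complex
  \<open>\<Oplus>\<^sub>i Hom\<^sub>K(M\<^sub>i, N\<^sub>i) \<rightarrow> \<Oplus>\<^sub>i Hom\<^sub>K(M\<^sub>i, N\<^sub>i\<^sub>+\<^sub>1)\<close>,
  whose cohomology is \<open>Ext\<^sup>*(M, N)\<close>: the kernel is \<open>Hom n M N\<close> and the cokernel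
  is \<open>Ext\<^sup>1(M, N)\<close>. In terms of extensions, a family \<open>h\<close> in the target is the extension
  \<open>N \<oplus> M\<close> of \<open>M\<close> by \<open>N\<close> with arrows \<open>(y, x) \<mapsto> (N\<^sub>i y + h\<^sub>i x, M\<^sub>i x)\<close>, and two of
  these are equivalent iff they differ by an element of the image.
\<close>

definition vertex_maps :: "nat \<Rightarrow> 'k::field rep \<Rightarrow> 'k rep \<Rightarrow> 'k fam set" where
  "vertex_maps n M N = {g. (\<forall>i\<in>{1..n}. g i \<in> lin_maps (vspace M i) (vspace N i)) \<and>
     (\<forall>i. i \<notin> {1..n} \<longrightarrow> g i = 0)}"

definition arrow_maps :: "nat \<Rightarrow> 'k::field rep \<Rightarrow> 'k rep \<Rightarrow> 'k fam set" where
  "arrow_maps n M N = {h. (\<forall>i\<in>{1..<n}. h i \<in> lin_maps (vspace M i) (vspace N (i + 1))) \<and>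
     (\<forall>i. i \<notin> {1..<n} \<longrightarrow> h i = 0)}"

definition coboundary :: "nat \<Rightarrow> 'k::field rep \<Rightarrow> 'k rep \<Rightarrow> 'k fam \<Rightarrow> 'k fam" where
  "coboundary n M N g =
     (\<lambda>i v. if i \<in> {1..<n} then arrow N i (g i v) - g (i + 1) (arrow M i v) else 0)"

definition dim_Hom :: "nat \<Rightarrow> 'k::field rep \<Rightarrow> 'k rep \<Rightarrow> int"
  where "dim_Hom n M N = int (fam.dim (Hom n M N))"

definition dim_Ext :: "nat \<Rightarrow> 'k::field rep \<Rightarrow> 'k rep \<Rightarrow> int" where
  "dim_Ext n M N = int (fam.dim (arrow_maps n M N))
     - int (fam.dim (coboundary n M N ` vertex_maps n M N))"

definition euler_form :: "nat \<Rightarrow> 'k::field rep \<Rightarrow> 'k rep \<Rightarrow> int"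
  where "euler_form n M N = dim_Hom n M N - dim_Ext n M N"

text \<open>\<open>Ext_vanishes n k M N\<close> says that \<open>Ext\<^sup>k(M, N) = 0\<close>, for \<open>k\<close> an integer. It holds for all
  \<open>k \<notin> {0, 1}\<close>, the complex above being concentrated in these two degrees.\<close>

definition Ext_vanishes :: "nat \<Rightarrow> int \<Rightarrow> 'k::field rep \<Rightarrow> 'k rep \<Rightarrow> bool" where
  "Ext_vanishes n k M N \<longleftrightarrow>
     (k = 0 \<longrightarrow> Hom n M N = {0}) \<and>
     (k = 1 \<longrightarrow> arrow_maps n M N \<subseteq> coboundary n M N ` vertex_maps n M N)"

section \<open>Direct sums, indecomposable and projective modules\<close>

definition evens :: "'k kvec \<Rightarrow> 'k kvec" where "evens w = (\<lambda>m. w (2 * m))"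
definition odds :: "'k kvec \<Rightarrow> 'k kvec" where "odds w = (\<lambda>m. w (2 * m + 1))"

definition pair_vec :: "'k kvec \<Rightarrow> 'k kvec \<Rightarrow> 'k kvec"
  where "pair_vec u v = (\<lambda>m. if even m then u (m div 2) else v (m div 2))"

text \<open>The direct sum of two subspaces is realised by interleaving coordinates.\<close>

definition dsum :: "'k::field rep \<Rightarrow> 'k rep \<Rightarrow> 'k rep" where
  "dsum M N = (let V = (\<lambda>i. {w. evens w \<in> vspace M i \<and> odds w \<in> vspace N i}) in
     \<lparr>vspace = V,
      arrow = (\<lambda>i w. if w \<in> V i
                     then pair_vec (arrow M i (evens w)) (arrow N i (odds w)) else 0)\<rparr>)"

definition zero_rep :: "'k::field rep"
  where "zero_rep = \<lparr>vspace = (\<lambda>_. {0}), arrow = (\<lambda>_ _. 0)\<rparr>"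

definition dsum_list :: "'k::field rep list \<Rightarrow> 'k rep"
  where "dsum_list Ms = foldr dsum Ms zero_rep"

definition indecomposable :: "nat \<Rightarrow> 'k::field rep \<Rightarrow> bool" where
  "indecomposable n M \<longleftrightarrow> is_rep n M \<and> \<not> is_zero_rep n M \<and>
     (\<forall>A B. is_rep n A \<and> is_rep n B \<and> iso_rep n M (dsum A B) \<longrightarrow>
        is_zero_rep n A \<or> is_zero_rep n B)"

definition rigid :: "nat \<Rightarrow> 'k::field rep \<Rightarrow> bool"
  where "rigid n M \<longleftrightarrow> Ext_vanishes n 1 M M"

text \<open>The space of \<open>P\<^sub>k\<close> at \<open>j\<close> has as basis the paths from \<open>k\<close> to \<open>j\<close>: there is one if
  \<open>k \<le> j\<close> and none otherwise. The one-dimensional space is the 0th coordinate line.\<close>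

definition proj_rep :: "nat \<Rightarrow> 'k::field rep" where
  "proj_rep k = (let V = (\<lambda>j. if k \<le> j then {v. \<forall>m>0. v m = 0} else {0}) in
     \<lparr>vspace = V, arrow = (\<lambda>j v. if v \<in> V j then v else 0)\<rparr>)"

definition perp :: "nat \<Rightarrow> 'k::field rep \<Rightarrow> 'k rep set" where
  "perp n Z = {Y. is_rep n Y \<and> Ext_vanishes n 0 Z Y \<and> Ext_vanishes n 1 Z Y}"

text \<open>Epimorphisms and projective objects of the full subcategory with object class \<open>C\<close>.\<close>

definition epi_in :: "nat \<Rightarrow> 'k::field rep set \<Rightarrow> 'k rep \<Rightarrow> 'k rep \<Rightarrow> 'k fam \<Rightarrow> bool" where
  "epi_in n C Y Z g \<longleftrightarrow> Y \<in> C \<and> Z \<in> C \<and> g \<in> Hom n Y Z \<and>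
     (\<forall>W\<in>C. \<forall>h\<in>Hom n Z W. \<forall>h'\<in>Hom n Z W. comp_hom h g = comp_hom h' g \<longrightarrow> h = h')"

definition projective_in :: "nat \<Rightarrow> 'k::field rep set \<Rightarrow> 'k rep \<Rightarrow> bool" where
  "projective_in n C P \<longleftrightarrow> P \<in> C \<and>
     (\<forall>Y Z g. epi_in n C Y Z g \<longrightarrow>
        (\<forall>f\<in>Hom n P Z. \<exists>h\<in>Hom n P Y. comp_hom g h = f))"

section \<open>Exceptional sequences and the braid group action\<close>

text \<open>Sequences of length \<open>n\<close> are functions on \<open>nat\<close> of which only the values at \<open>1, \<dots>, n\<close>
  matter.\<close>

definition complete_exceptional :: "nat \<Rightarrow> (nat \<Rightarrow> 'k::field rep) \<Rightarrow> bool" where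
  "complete_exceptional n E \<longleftrightarrow>
     (\<forall>i\<in>{1..n}. indecomposable n (E i) \<and> rigid n (E i)) \<and>
     (\<forall>i\<in>{1..n}. \<forall>j\<in>{1..n}. i < j \<longrightarrow>
        Ext_vanishes n 0 (E j) (E i) \<and> Ext_vanishes n 1 (E j) (E i))"

definition relatively_projective :: "nat \<Rightarrow> (nat \<Rightarrow> 'k::field rep) \<Rightarrow> nat \<Rightarrow> bool" where
  "relatively_projective n E i \<longleftrightarrow>
     projective_in n (perp n (dsum_list (map E [i + 1..<n + 1]))) (E i)"

text \<open>The new module is unique up to isomorphism; \<open>braid n i\<close> picks a representative.\<close>

definition braid :: "nat \<Rightarrow> nat \<Rightarrow> (nat \<Rightarrow> 'k::field rep) \<Rightarrow> (nat \<Rightarrow> 'k rep)" where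
  "braid n i E =
     (let X = (SOME X. complete_exceptional n (E(i := X, i + 1 := E i)))
      in E(i := X, i + 1 := E i))"

definition braid_delta :: "nat \<Rightarrow> nat \<Rightarrow> (nat \<Rightarrow> 'k::field rep) \<Rightarrow> (nat \<Rightarrow> 'k rep)"
  where "braid_delta n k E = foldr (braid n) [1..<k + 1] E"

definition garside :: "nat \<Rightarrow> (nat \<Rightarrow> 'k::field rep) \<Rightarrow> (nat \<Rightarrow> 'k rep)"
  where "garside n E = foldr (braid_delta n) (rev [1..<n]) E"

section \<open>Signed objects and support tilting sets\<close>

text \<open>The pair \<open>(1, M)\<close> is the module \<open>M\<close> and \<open>(- 1, M)\<close> is the shifted object \<open>M[1]\<close> of
  the bounded derived category.\<close>

type_synonym 'k obj = "int \<times> 'k rep"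

definition shift_of :: "'k obj \<Rightarrow> int"
  where "shift_of T = (if fst T = 1 then 0 else 1)"

definition iso_obj :: "nat \<Rightarrow> 'k::field obj \<Rightarrow> 'k obj \<Rightarrow> bool"
  where "iso_obj n T U \<longleftrightarrow> fst T = fst U \<and> iso_rep n (snd T) (snd U)"

text \<open>\<open>Hom(T, U[d]) = 0\<close> in the derived category, where
  \<open>Hom(M[a], N[b]) = Ext\<^sup>b\<^sup>-\<^sup>a(M, N)\<close> for modules \<open>M\<close> and \<open>N\<close>.\<close>

definition derived_Hom_vanishes :: "nat \<Rightarrow> 'k::field obj \<Rightarrow> 'k obj \<Rightarrow> int \<Rightarrow> bool" where
  "derived_Hom_vanishes n T U d \<longleftrightarrow>
     Ext_vanishes n (shift_of U + d - shift_of T) (snd T) (snd U)"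

definition signed_exceptional :: "nat \<Rightarrow> (nat \<Rightarrow> 'k::field obj) \<Rightarrow> bool" where
  "signed_exceptional n X \<longleftrightarrow> complete_exceptional n (\<lambda>i. snd (X i)) \<and>
     (\<forall>i\<in>{1..n}. fst (X i) \<in> {1, - 1} \<and>
        (fst (X i) = - 1 \<longrightarrow> relatively_projective n (\<lambda>i. snd (X i)) i))"

definition support_tilting :: "nat \<Rightarrow> 'k::field obj set \<Rightarrow> bool" where
  "support_tilting n S \<longleftrightarrow> finite S \<and> card S = n \<and>
     (\<forall>(e, M)\<in>S. (e = 1 \<and> indecomposable n M) \<or>
        (e = - 1 \<and> is_rep n M \<and> (\<exists>k\<in>{1..n}. iso_rep n M (proj_rep k)))) \<and>
     (\<forall>T\<in>S. \<forall>U\<in>S. T \<noteq> U \<longrightarrow> \<not> iso_obj n T U) \<and>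
     (\<forall>T\<in>S. \<forall>U\<in>S. derived_Hom_vanishes n T U 1)"

definition ordered_support_tilting :: "nat \<Rightarrow> (nat \<Rightarrow> 'k::field obj) \<Rightarrow> bool" where
  "ordered_support_tilting n T \<longleftrightarrow> inj_on T {1..n} \<and> support_tilting n (T ` {1..n})"

definition dim_vec :: "'k::field obj \<Rightarrow> nat \<Rightarrow> int"
  where "dim_vec T v = fst T * int (kvec.dim (vspace (snd T) v))"

text \<open>The graph of the Igusa--Todorov bijection from ordered support tilting sets (first argument)
  to signed exceptional sequences, both up to isomorphism.\<close>

definition igusa_todorov :: "nat \<Rightarrow> (nat \<Rightarrow> 'k::field obj) \<Rightarrow> (nat \<Rightarrow> 'k obj) \<Rightarrow> bool" where
  "igusa_todorov n T X \<longleftrightarrow> ordered_support_tilting n T \<and> signed_exceptional n X \<and>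
     (\<forall>i\<in>{1..n}.
        snd (X i) \<in> perp n (dsum_list (map (\<lambda>j. snd (T j)) [i + 1..<n + 1])) \<and>
        (\<exists>c :: nat \<Rightarrow> int. \<forall>v\<in>{1..n}.
           dim_vec (X i) v - dim_vec (T i) v = (\<Sum>j\<in>{i + 1..n}. c j * dim_vec (T j) v)))"

end

(*
  Indecomposable representations of the linear quiver are the interval modules; write (x, y) for the
  one with support {x, ..., y - 1}, 1 <= x < y <= n + 1. With Y_{n+1} = 0, the space Hom((x, y), Y) is
  the kernel and Ext((x, y), Y) the cokernel of Y_x -> Y_y. So (x, y)^perp consists of the Y for which
  this map is bijective, the Euler form is chi((x, y), Y) = dim Y_x - dim Y_y, and for two interval
  modules Hom and Ext vanish together as soon as chi vanishes. Exceptional sequences thus become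
  unitriangular families of intervals, and mutation replaces B by the interval +-(B - chi(A, B) A).

  Applying delta_1, ..., delta_(m-1) turns (E_1, ..., E_n) into (E'_m, ..., E'_1, E_(m+1), ..., E_n).
  As all these sequences are exceptional, hence integral bases of the Grothendieck group, E_k is
  orthogonal to E'_j for k <> j, the number s = chi(E_k, E'_k) is 1 or -1, and E'_k - s E_k is an integral
  combination of the E_j (and of the E'_j) with j < k. Hence eps'_k = eps_k s has the required properties,
  and for eps'_k = -1 the last relation exhibits Hom(E'_k, -) as an exact functor on the category
  perpendicular to the E'_j with j < k.
*)
theory Submission
  imports Defs
begin

section \<open>Exceptional sequences of intervals\<close>

text \<open>Intervals act as edges of a graph on the vertices \<open>1, ..., n + 1\<close>. Pairing
  the edge \<open>(x, y)\<close> with any integer function \<open>w\<close> gives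
  \<open>w x - w y\<close>, so indicator functions of connected components can be paired as well as
  dimension vectors. On the module side an edge is a map \<open>Y_x -> Y_y\<close>, bijective for
  \<open>Y\<close> in the perpendicular category, and paths of edges give bijections natural in
  \<open>Y\<close>. The integral relation for \<open>E'_k\<close> thereby becomes an actual path
  along the edges of the \<open>E'_j\<close>, \<open>j < k\<close>: from \<open>b' k\<close> to
  \<open>b k\<close> if \<open>s = 1\<close>, and to \<open>a k\<close> if \<open>s = - 1\<close>.
  Negative signs are the obstacle, since epimorphisms are meant inside the perpendicular category
  and first have to be shown surjective. With \<open>(u, v) = (a' k, b' k)\<close>,
  \<open>Hom(E'_k, Y)\<close> is the kernel of \<open>Y_u -> Y_v\<close>. If
  \<open>eps_k = - 1\<close> and \<open>s = 1\<close>, the path ends at \<open>n + 1\<close>, so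
  \<open>Y_v = 0\<close>. If \<open>s = - 1\<close>, it ends at \<open>a k < u\<close>, and the
  bijection from \<open>Y_(a k)\<close> to \<open>Y_v\<close> factors through \<open>Y_u\<close>,
  which splits \<open>Y_u -> Y_v\<close> naturally. Either way the kernel is exact in
  \<open>Y\<close>.\<close>

definition interval :: "nat \<Rightarrow> nat \<Rightarrow> nat \<Rightarrow> bool"
  where "interval n x y \<longleftrightarrow> 1 \<le> x \<and> x < y \<and> y \<le> n + 1"

definition ind :: "nat \<Rightarrow> nat \<Rightarrow> nat \<Rightarrow> int"
  where "ind z w p = (if z \<le> p \<and> p < w then 1 else 0)"

text \<open>The left side is the Euler form of the linear quiver in terms of dimension vectors; over
  an interval it telescopes. In this shape linearity in the first argument is visible, which the
  difference of end values hides.\<close>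

lemma ind_pairing:
  fixes w :: "nat \<Rightarrow> int"
  assumes "interval n x y"
  shows "(\<Sum>p\<in>{1..n}. ind x y p * (w p - w (Suc p))) = w x - w y"
proof -
  have "(\<Sum>p\<in>{1..n}. ind x y p * (w p - w (Suc p))) = (\<Sum>p\<in>{x..<y}. w p - w (Suc p))"
    using assms by (intro sum.mono_neutral_cong_right) (auto simp: interval_def ind_def)
  also have "\<dots> = w x - w y"
    using sum_Suc_diff'[of x y "\<lambda>p. - w p"] assms by (simp add: interval_def)
  finally show ?thesis .
qed

text \<open>Transfers linear relations between dimension vectors to differences along edges. The
  function \<open>w\<close> is arbitrary: it is a dimension vector in one use and the indicator of a
  connected component in another.\<close>

lemma pairing_sum:
  fixes w :: "nat \<Rightarrow> int"
  assumes I: "interval n x y" "\<And>j. j \<in> J \<Longrightarrow> interval n (a j) (b j)"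
    and e: "\<And>p. p \<in> {1..n} \<Longrightarrow> ind x y p = (\<Sum>j\<in>J. c j * ind (a j) (b j) p)"
  shows "w x - w y = (\<Sum>j\<in>J. c j * (w (a j) - w (b j)))"
proof -
  have "w x - w y = (\<Sum>p\<in>{1..n}. (\<Sum>j\<in>J. c j * ind (a j) (b j) p) * (w p - w (Suc p)))"
    using ind_pairing[OF I(1), of w] e by simp
  also have "\<dots> = (\<Sum>p\<in>{1..n}. \<Sum>j\<in>J. c j * (ind (a j) (b j) p * (w p - w (Suc p))))"
    by (simp add: sum_distrib_right mult.assoc)
  also have "\<dots> = (\<Sum>j\<in>J. \<Sum>p\<in>{1..n}. c j * (ind (a j) (b j) p * (w p - w (Suc p))))"
    by (rule sum.swap)
  also have "\<dots> = (\<Sum>j\<in>J. c j * (w (a j) - w (b j)))"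
    by (intro sum.cong refl) (simp only: sum_distrib_left[symmetric] ind_pairing[OF I(2)])
  finally show ?thesis .
qed

text \<open>For a module with dimension vector \<open>w\<close>, extended by \<open>w (n + 1) = 0\<close>, the Euler form with the
  interval module \<open>{x..<y}\<close> in the first argument is \<open>w x - w y\<close>.\<close>

definition exc_seq :: "nat \<Rightarrow> (nat \<Rightarrow> nat) \<Rightarrow> (nat \<Rightarrow> nat) \<Rightarrow> bool" where
  "exc_seq n a b \<longleftrightarrow> (\<forall>i\<in>{1..n}. interval n (a i) (b i)) \<and>
     (\<forall>i\<in>{1..n}. \<forall>j\<in>{1..n}. i < j \<longrightarrow> ind (a i) (b i) (a j) = ind (a i) (b i) (b j))"

lemma exc_seq_interval: "exc_seq n a b \<Longrightarrow> i \<in> {1..n} \<Longrightarrow> interval n (a i) (b i)"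
  and exc_seq_orth: "exc_seq n a b \<Longrightarrow> i \<in> {1..n} \<Longrightarrow> j \<in> {1..n} \<Longrightarrow> i < j \<Longrightarrow>
    ind (a i) (b i) (a j) = ind (a i) (b i) (b j)"
  by (auto simp: exc_seq_def)

lemma ind_ends: "interval n x y \<Longrightarrow> ind x y x = 1" "ind x y y = 0"
  "interval n x y \<Longrightarrow> ind x y (Suc n) = 0"
  by (auto simp: ind_def interval_def)

text \<open>Otherwise \<open>w\<close> together with the dimension vectors of the sequence would be \<open>n + 1\<close> linearly
  independent vectors in dimension \<open>n\<close>.\<close>

lemma exc_seq_nondegenerate:
  fixes w :: "nat \<Rightarrow> int"
  assumes E: "exc_seq n a b" and w0: "w (n + 1) = 0"
    and w: "\<And>k. k \<in> {1..n} \<Longrightarrow> w (a k) = w (b k)" and p: "p \<in> {1..n}"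
  shows "w p = 0"
proof (rule ccontr)
  assume wp: "w p \<noteq> 0"
  \<comment> \<open>Rational coefficients supply a field for the dimension count. Slot 0 holds
    \<open>w\<close>: every \<open>L m\<close> kills it, just as \<open>L m\<close> kills the
    members of the sequence before \<open>m\<close>.\<close>
  define e :: "nat \<Rightarrow> rat kvec" where "e = (\<lambda>k q. if q \<in> {1..n} then
      of_int (if k = 0 then w q else ind (a k) (b k) q) else 0)"
  define L :: "nat \<Rightarrow> rat kvec \<Rightarrow> rat" where "L = (\<lambda>k v. v (a k) - v (b k))"
  have val: "e k q = of_int (if k = 0 then w q else ind (a k) (b k) q)"
    if "k \<in> {0..n}" "q \<in> {1..n+1}" for k q
    using that w0 ind_ends(3)[OF exc_seq_interval[OF E, of k]]
    by (cases "q = n + 1") (auto simp: e_def)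
  have ab: "a k \<in> {1..n+1}" "b k \<in> {1..n+1}" if "k \<in> {1..n}" for k
    using exc_seq_interval[OF E that] by (auto simp: interval_def)
  have L0: "L m (e k) = 0" if "m \<in> {1..n}" "k < m" for m k
    using that val[of k] ab[of m] w[of m] exc_seq_orth[OF E, of k m] by (simp add: L_def)
  have L1: "L m (e m) = 1" if "m \<in> {1..n}" for m
    using that val[of m] ab[of m] ind_ends(1)[OF exc_seq_interval[OF E that]] by (simp add: L_def ind_ends(2))
  have L_sum: "L m (\<Sum>k\<in>A. vscale (c k) (e k)) = (\<Sum>k\<in>A. c k * L m (e k))" if "finite A" for m c A
    using that by (induction A rule: finite_induct) (auto simp: L_def vscale_def algebra_simps)
  have indep: "\<forall>k\<in>{0..n}. c k = 0" if s: "(\<Sum>k\<in>{0..n}. vscale (c k) (e k)) = 0" for c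
  proof -
    \<comment> \<open>Descending in \<open>m\<close>: \<open>L m\<close> kills the terms below
      \<open>m\<close>, and the coefficients above \<open>m\<close> already vanish, so
      \<open>L m\<close> isolates \<open>c m\<close>.\<close>
    have *: "c m = 0" if "m \<in> {1..n}" for m
      using that
    proof (induction "n - m" arbitrary: m rule: less_induct)
      case less
      have "0 = L m (\<Sum>k\<in>{0..n}. vscale (c k) (e k))" by (simp add: s) (simp add: L_def)
      also have "\<dots> = (\<Sum>k\<in>{0..n}. c k * L m (e k))" by (simp add: L_sum)
      also have "\<dots> = (\<Sum>k\<in>{m}. c k * L m (e k))"
      proof (rule sum.mono_neutral_right)
        show "\<forall>i\<in>{0..n} - {m}. c i * L m (e i) = 0"
        proof
          fix i assume i: "i \<in> {0..n} - {m}"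
          show "c i * L m (e i) = 0"
          proof (cases "i < m")
            case True then show ?thesis using L0[of m i] less.prems by simp
          next
            case False
            then have "n - i < n - m" "i \<in> {1..n}" using i less.prems by auto
            then show ?thesis using less.hyps by simp
          qed
        qed
      qed (use less.prems in auto)
      finally show ?case using L1[OF less.prems] by simp
    qed
    then have "(\<Sum>k\<in>{0..n}. vscale (c k) (e k)) = (\<Sum>k\<in>{0}. vscale (c k) (e k))"
      by (intro sum.mono_neutral_right) auto
    then have "vscale (c 0) (e 0) = 0" using s by simp
    moreover have "e 0 \<noteq> 0"
    proof
      assume "e 0 = 0"
      then have "e 0 p = 0" by simp
      then show False using wp p by (simp add: e_def)
    qed
    ultimately have "c 0 = 0" by simp
    then show ?thesis using * by (metis atLeastAtMost_iff less_one linorder_not_le)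
  qed
  have inj: "inj_on e {0..n}"
  proof (rule inj_onI)
    have "e k \<noteq> e m" if "k \<in> {0..n}" "m \<in> {0..n}" "k < m" for k m
      using L0[of m k] L1[of m] that by auto
    then show "k = m" if "k \<in> {0..n}" "m \<in> {0..n}" "e k = e m" for k m
      using that by (metis linorder_neqE_nat)
  qed
  define \<delta> :: "nat \<Rightarrow> rat kvec" where "\<delta> = (\<lambda>i q. if i = q then 1 else 0)"
  define T where "T = \<delta> ` {1..n}"
  have "kvec.independent (e ` {0..n})"
  proof (rule kvec.independent_if_scalars_zero)
    fix f x assume f: "(\<Sum>x\<in>e ` {0..n}. vscale (f x) x) = 0" and x: "x \<in> e ` {0..n}"
    then have "(\<Sum>k\<in>{0..n}. vscale (f (e k)) (e k)) = 0" by (simp add: sum.reindex[OF inj])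
    then show "f x = 0" using indep[of "\<lambda>k. f (e k)"] x by auto
  qed simp
  moreover have "e ` {0..n} \<subseteq> kvec.span T"
  proof
    fix x assume "x \<in> e ` {0..n}"
    then obtain k where k: "x = e k" by blast
    have "x = (\<Sum>i\<in>{1..n}. vscale (x i) (\<delta> i))"
    proof
      fix q
      have "(\<Sum>i\<in>A. vscale (x i) (\<delta> i)) q = (\<Sum>i\<in>A. if i = q then x i else 0)"
        if "finite A" for A
        using that by (induction A rule: finite_induct) (auto simp: vscale_def \<delta>_def)
      then have "(\<Sum>i\<in>{1..n}. vscale (x i) (\<delta> i)) q = (if q \<in> {1..n} then x q else 0)"
        by (simp add: sum.delta)
      moreover have "x q = 0" if "q \<notin> {1..n}" unfolding k e_def using that by (rule if_not_P)
      ultimately show "x q = (\<Sum>i\<in>{1..n}. vscale (x i) (\<delta> i)) q" by presburger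
    qed
    also have "\<dots> \<in> kvec.span T"
      by (intro kvec.span_sum kvec.span_scale kvec.span_base) (auto simp: T_def)
    finally show "x \<in> kvec.span T" .
  qed
  moreover have "finite T" by (simp add: T_def)
  ultimately have "card (e ` {0..n}) \<le> card T"
    using kvec.independent_span_bound by blast
  also have "card T \<le> n" unfolding T_def using card_image_le[of "{1..n}"] by simp
  finally show False using card_image[OF inj] by simp
qed

text \<open>Gram-Schmidt for a unitriangular form: subtracting a multiple of the interval at
  \<open>Suc k\<close> equalises the values of \<open>v\<close> at the two ends of that edge. The
  diagonal entries are 1, so no division occurs and the coefficients stay integral. The base case is
  \<open>exc_seq_nondegenerate\<close>.\<close>

lemma exc_seq_int_span:
  fixes v :: "nat \<Rightarrow> int"
  assumes E: "exc_seq n a b" and "k \<le> n" and "v (n + 1) = 0"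
    and "\<And>j. j \<in> {k<..n} \<Longrightarrow> v (a j) = v (b j)"
  shows "\<exists>c. \<forall>p\<in>{1..n}. v p = (\<Sum>i\<in>{1..k}. c i * ind (a i) (b i) p)"
  using assms(2-)
proof (induction k arbitrary: v)
  case 0
  then have "v p = 0" if "p \<in> {1..n}" for p
    using exc_seq_nondegenerate[OF E, of v p] that by simp
  then show ?case by simp
next
  case (Suc k)
  let ?x = "a (Suc k)" and ?y = "b (Suc k)"
  have k: "Suc k \<in> {1..n}" using Suc.prems by simp
  note I = exc_seq_interval[OF E k]
  define d where "d = v ?x - v ?y"
  define v' where "v' p = v p - d * ind ?x ?y p" for p
  have "v' (a j) = v' (b j)" if "j \<in> {k<..n}" for j
  proof (cases "j = Suc k")
    case True
    then show ?thesis using ind_ends(1)[OF I] by (simp add: v'_def d_def ind_ends(2))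
  next
    case False
    then have "ind ?x ?y (a j) = ind ?x ?y (b j)"
      using exc_seq_orth[OF E k, of j] that by simp
    then show ?thesis using Suc.prems(3)[of j] that False by (simp add: v'_def)
  qed
  moreover have "v' (n + 1) = 0" using Suc.prems ind_ends(3)[OF I] by (simp add: v'_def)
  ultimately obtain c where c: "\<forall>p\<in>{1..n}. v' p = (\<Sum>i\<in>{1..k}. c i * ind (a i) (b i) p)"
    using Suc.IH[of v'] Suc.prems(1) by auto
  define c' where "c' = c(Suc k := d)"
  have "v p = (\<Sum>i\<in>{1..Suc k}. c' i * ind (a i) (b i) p)" if "p \<in> {1..n}" for p
  proof -
    have "(\<Sum>i\<in>{1..k}. c' i * ind (a i) (b i) p) = (\<Sum>i\<in>{1..k}. c i * ind (a i) (b i) p)"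
      by (intro sum.cong) (auto simp: c'_def)
    then show ?thesis using c that by (simp add: c'_def v'_def algebra_simps)
  qed
  then show ?case by blast
qed

text \<open>The new interval is \<open>\<plusminus>(B - \<chi>(A, B) A)\<close>, where \<open>A\<close> and \<open>B\<close> are the
  intervals at \<open>i\<close> and \<open>i + 1\<close>.\<close>

lemma exc_seq_mutation:
  assumes E: "exc_seq n a b" and i: "i \<in> {1..<n}"
  shows "\<exists>x y. exc_seq n (a(i := x, i + 1 := a i)) (b(i := y, i + 1 := b i))"
proof -
  let ?x = "a i" and ?y = "b i" and ?z = "a (i + 1)" and ?w = "b (i + 1)"
  have i1: "i \<in> {1..n}" "i + 1 \<in> {1..n}" using i by auto
  have IA: "interval n ?x ?y" and IB: "interval n ?z ?w" and o: "ind ?x ?y ?z = ind ?x ?y ?w"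
    using exc_seq_interval[OF E i1(1)] exc_seq_interval[OF E i1(2)] exc_seq_orth[OF E i1] by auto
  let ?P = "\<lambda>x y s c. interval n x y \<and> ind x y ?x = ind x y ?y \<and>
      (\<forall>p. ind x y p = s * (ind ?z ?w p - c * ind ?x ?y p)) \<and>
      (\<forall>v :: nat \<Rightarrow> int. v x - v y = s * ((v ?z - v ?w) - c * (v ?x - v ?y)))"
  have "\<exists>x y s c. ?P x y s c"
  proof -
    have h: "1 \<le> ?x" "?x < ?y" "?y \<le> n + 1" "1 \<le> ?z" "?z < ?w" "?w \<le> n + 1"
      using IA IB by (auto simp: interval_def)
    \<comment> \<open>Apart from \<open>\<chi>(A, B) = 0\<close>, orthogonality leaves three
      positions: \<open>A\<close> maps onto \<open>B\<close> with kernel \<open>(?w, ?y)\<close>,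
      \<open>A\<close> embeds into \<open>B\<close> with cokernel \<open>(?z, ?x)\<close>, or
      \<open>(?x, ?w)\<close> is a nonsplit extension of \<open>A\<close> by \<open>B\<close>.
      Kernel, cokernel and middle term are the new intervals.\<close>
    have "ind ?z ?w ?x = ind ?z ?w ?y \<or> ?z = ?x \<and> ?w < ?y \<or> ?z < ?x \<and> ?x < ?w \<and> ?w = ?y \<or> ?z = ?y"
      using h o by (auto simp: ind_def split: if_splits)
    then consider "ind ?z ?w ?x = ind ?z ?w ?y" | "?z = ?x" "?w < ?y" | "?z < ?x" "?x < ?w" "?w = ?y" | "?z = ?y"
      by blast
    then show ?thesis
    proof cases
      case 1
      then have "?P ?z ?w 1 0" using IB by simp
      then show ?thesis by blast
    next
      case 2
      then have "?P ?w ?y (-1) 1" using h by (auto simp: interval_def ind_def)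
      then show ?thesis by blast
    next
      case 3
      then have "?P ?z ?x 1 1" using h by (auto simp: interval_def ind_def)
      then show ?thesis by blast
    next
      case 4
      then have "?P ?x ?w 1 (-1)" using h by (auto simp: interval_def ind_def)
      then show ?thesis by blast
    qed
  qed
  then obtain x y s c where I: "interval n x y" and A: "ind x y ?x = ind x y ?y"
    and d: "\<And>p. ind x y p = s * (ind ?z ?w p - c * ind ?x ?y p)"
    and l: "\<And>v :: nat \<Rightarrow> int. v x - v y = s * ((v ?z - v ?w) - c * (v ?x - v ?y))"
    by blast
  have "exc_seq n (a(i := x, i + 1 := a i)) (b(i := y, i + 1 := b i))" (is "exc_seq n ?a ?b")
    unfolding exc_seq_def
  proof (intro conjI ballI impI)
    show "interval n (?a j) (?b j)" if "j \<in> {1..n}" for j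
      using that I IA exc_seq_interval[OF E that] by auto
    fix j k assume j: "j \<in> {1..n}" and k: "k \<in> {1..n}" and jk: "j < k"
    \<comment> \<open>\<open>d\<close> describes the new interval as a dimension vector,
      \<open>l\<close> as a functional on vertex functions. Against terms outside the places
      \<open>i\<close> and \<open>i + 1\<close>, \<open>d\<close> serves when the new interval
      stands in front and \<open>l\<close> when it stands behind.\<close>
    consider "j = i" "k = i + 1" | "j = i" "k > i + 1" | "j = i + 1" "k > i + 1" | "j < i" "k = i"
      | "j < i" "k = i + 1" | "j \<noteq> i" "j \<noteq> i + 1" "k \<noteq> i" "k \<noteq> i + 1"
      using jk by linarith
    then show "ind (?a j) (?b j) (?a k) = ind (?a j) (?b j) (?b k)"
    proof cases
      case 1 then show ?thesis using A by simp
    next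
      case 2
      then show ?thesis
        using exc_seq_orth[OF E i1(1) k] exc_seq_orth[OF E i1(2) k] by (simp add: d)
    next
      case 3 then show ?thesis using exc_seq_orth[OF E i1(1) k] by simp
    next
      case 4
      then show ?thesis
        using l[of "ind (a j) (b j)"] exc_seq_orth[OF E j i1(1)] exc_seq_orth[OF E j i1(2)] by simp
    next
      case 5 then show ?thesis using exc_seq_orth[OF E j i1(1)] by simp
    next
      case 6 then show ?thesis using exc_seq_orth[OF E j k jk] by simp
    qed
  qed
  then show ?thesis by blast
qed

text \<open>\<open>(a, b)\<close> describes an exceptional sequence and \<open>(a', b')\<close>, read from right to left, its image
  under the Garside element. The interpolating sequences are the images under
  \<open>\<delta>\<^sub>m\<^sub>-\<^sub>1 \<cdots> \<delta>\<^sub>1\<close>.\<close>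

definition dual_seq where
  "dual_seq n a b a' b' \<longleftrightarrow> (\<forall>m\<le>n. exc_seq n (\<lambda>i. if i \<le> m then a' (m + 1 - i) else a i)
     (\<lambda>i. if i \<le> m then b' (m + 1 - i) else b i))"

lemma dual_seq_base:
  assumes "dual_seq n a b a' b'"
  shows "exc_seq n a b"
proof -
  have "exc_seq n (\<lambda>i. if i \<le> 0 then a' (0 + 1 - i) else a i) (\<lambda>i. if i \<le> 0 then b' (0 + 1 - i) else b i)"
    using assms unfolding dual_seq_def by blast
  then show ?thesis by (simp add: exc_seq_def)
qed

lemma dual_seq_reverse:
  assumes "dual_seq n a b a' b'"
  shows "exc_seq n (\<lambda>i. a' (n + 1 - i)) (\<lambda>i. b' (n + 1 - i))"
proof -
  have "exc_seq n (\<lambda>i. if i \<le> n then a' (n + 1 - i) else a i) (\<lambda>i. if i \<le> n then b' (n + 1 - i) else b i)"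
    using assms unfolding dual_seq_def by blast
  then show ?thesis by (simp add: exc_seq_def)
qed

lemma dual_seq_interval:
  assumes D: "dual_seq n a b a' b'" and j: "j \<in> {1..n}"
  shows "interval n (a' j) (b' j)"
proof -
  have "n + 1 - j \<in> {1..n}" "n + 1 - (n + 1 - j) = j" using j by auto
  then show ?thesis using exc_seq_interval[OF dual_seq_reverse[OF D], of "n + 1 - j"] by metis
qed

text \<open>Read off from the interpolating sequence with \<open>m = j\<close>: there
  \<open>E'_j\<close> has just reached the first place, while \<open>E_k\<close> still stands
  untouched at place \<open>k\<close>.\<close>

lemma dual_seq_later:
  assumes D: "dual_seq n a b a' b'" and j: "j \<in> {1..n}" and k: "k \<in> {1..n}" and jk: "j < k"
  shows "ind (a' j) (b' j) (a k) = ind (a' j) (b' j) (b k)"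
proof -
  have "exc_seq n (\<lambda>i. if i \<le> j then a' (j + 1 - i) else a i) (\<lambda>i. if i \<le> j then b' (j + 1 - i) else b i)"
    using D j unfolding dual_seq_def by auto
  from exc_seq_orth[OF this, of 1 k] show ?thesis using j k jk by auto
qed

lemma dual_seq_orth:
  assumes D: "dual_seq n a b a' b'" and j: "j \<in> {1..n}" and k: "k \<in> {1..n}" and jk: "j < k"
  shows "ind (a' k) (b' k) (a' j) = ind (a' k) (b' k) (b' j)"
proof -
  have "n + 1 - j \<in> {1..n}" "n + 1 - k \<in> {1..n}" "n + 1 - k < n + 1 - j"
    and e: "n + 1 - (n + 1 - j) = j" "n + 1 - (n + 1 - k) = k"
    using j k jk by auto
  then show ?thesis
    using exc_seq_orth[OF dual_seq_reverse[OF D], of "n + 1 - k" "n + 1 - j"] by (simp only: e)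
qed

text \<open>No interpolating sequence contains both \<open>E'_j\<close> and \<open>E_k\<close> when
  \<open>k < j\<close>. But the original sequence and the one with \<open>m = k\<close> share their
  tail after place \<open>k\<close>, to which \<open>E_k\<close> is orthogonal. So
  \<open>E_k\<close> is a combination of \<open>E'_1, ..., E'_k\<close>, and these are orthogonal to
  \<open>E'_j\<close>.\<close>

lemma dual_seq_earlier:
  assumes D: "dual_seq n a b a' b'" and j: "j \<in> {1..n}" and k: "k \<in> {1..n}" and kj: "k < j"
  shows "ind (a' j) (b' j) (a k) = ind (a' j) (b' j) (b k)"
proof -
  let ?a = "\<lambda>i. if i \<le> k then a' (k + 1 - i) else a i" and ?b = "\<lambda>i. if i \<le> k then b' (k + 1 - i) else b i"
  note B = dual_seq_base[OF D] and Ik = exc_seq_interval[OF dual_seq_base[OF D] k]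
  have E: "exc_seq n ?a ?b" using D k unfolding dual_seq_def by auto
  have "\<exists>c. \<forall>p\<in>{1..n}. ind (a k) (b k) p = (\<Sum>i\<in>{1..k}. c i * ind (?a i) (?b i) p)"
  proof (rule exc_seq_int_span[OF E])
    show "ind (a k) (b k) (n + 1) = 0" using ind_ends(3)[OF Ik] by simp
    show "ind (a k) (b k) (?a l) = ind (a k) (b k) (?b l)" if "l \<in> {k<..n}" for l
      using that exc_seq_orth[OF B k, of l] by simp
  qed (use k in simp)
  then obtain c where c: "\<And>p. p \<in> {1..n} \<Longrightarrow> ind (a k) (b k) p = (\<Sum>i\<in>{1..k}. c i * ind (?a i) (?b i) p)"
    by blast
  have "ind (a' j) (b' j) (a k) - ind (a' j) (b' j) (b k)
      = (\<Sum>i\<in>{1..k}. c i * (ind (a' j) (b' j) (?a i) - ind (a' j) (b' j) (?b i)))"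
    by (rule pairing_sum[OF Ik exc_seq_interval[OF E] c]) (use k in auto)
  also have "\<dots> = 0"
  proof (rule sum.neutral, rule ballI)
    fix i assume i: "i \<in> {1..k}"
    show "c i * (ind (a' j) (b' j) (?a i) - ind (a' j) (b' j) (?b i)) = 0"
    proof -
      have "k + 1 - i \<in> {1..n}" "k + 1 - i < j" using i k kj by auto
      then show ?thesis using dual_seq_orth[OF D _ j] i by simp
    qed
  qed
  finally show ?thesis by simp
qed

text \<open>The value 0 would make \<open>E'_k\<close> orthogonal to the whole sequence, against
  nondegeneracy; a difference of indicator values leaves only the two signs.\<close>

lemma dual_seq_diagonal:
  assumes D: "dual_seq n a b a' b'" and k: "k \<in> {1..n}"
  shows "ind (a' k) (b' k) (a k) - ind (a' k) (b' k) (b k) \<in> {1, -1}"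
proof -
  note I = dual_seq_interval[OF D k]
  have "ind (a' k) (b' k) (a k) \<noteq> ind (a' k) (b' k) (b k)"
  proof
    assume *: "ind (a' k) (b' k) (a k) = ind (a' k) (b' k) (b k)"
    have "ind (a' k) (b' k) (a' k) = 0"
    proof (rule exc_seq_nondegenerate[OF dual_seq_base[OF D], where w = "ind (a' k) (b' k)"])
      show "ind (a' k) (b' k) (n + 1) = 0" using ind_ends(3)[OF I] by simp
      show "ind (a' k) (b' k) (a l) = ind (a' k) (b' k) (b l)" if "l \<in> {1..n}" for l
        using * dual_seq_earlier[OF D k that] dual_seq_later[OF D k that] by (cases l k rule: linorder_cases) auto
      show "a' k \<in> {1..n}" using I by (auto simp: interval_def)
    qed
    then show False using ind_ends(1)[OF I] by simp
  qed
  moreover have "ind (a' k) (b' k) p \<in> {0, 1}" for p by (simp add: ind_def)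
  ultimately show ?thesis
    by (metis (no_types, lifting) diff_0 diff_zero insertE insertI1 insertI2 singletonD)
qed

text \<open>With this \<open>s\<close> the difference is orthogonal to \<open>E_k\<close> and to
  everything after it. The sequence \<open>c\<close>, \<open>d\<close> is left free before place
  \<open>k\<close>, because two expansions are wanted: along the original \<open>E_j\<close> for the
  bijection, and along the \<open>E'_j\<close> for relative projectivity.\<close>

lemma dual_seq_expand:
  assumes D: "dual_seq n a b a' b'" and k: "k \<in> {1..n}"
    and E: "exc_seq n c d" and cd: "\<And>l. l \<in> {k..n} \<Longrightarrow> c l = a l \<and> d l = b l"
  defines "s \<equiv> ind (a' k) (b' k) (a k) - ind (a' k) (b' k) (b k)"
  shows "\<exists>m. \<forall>p\<in>{1..n}. ind (a' k) (b' k) p - s * ind (a k) (b k) p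
      = (\<Sum>j\<in>{1..k - 1}. m j * ind (c j) (d j) p)"
proof (rule exc_seq_int_span[OF E])
  note B = dual_seq_base[OF D]
  note I = dual_seq_interval[OF D k] and Ik = exc_seq_interval[OF B k]
  show "k - 1 \<le> n" using k by auto
  show "ind (a' k) (b' k) (n + 1) - s * ind (a k) (b k) (n + 1) = 0"
    using ind_ends(3)[OF I] ind_ends(3)[OF Ik] by simp
  fix l assume l: "l \<in> {k - 1<..n}"
  then have "l \<in> {k..n}" using k by auto
  then have l': "c l = a l" "d l = b l" using cd by auto
  show "ind (a' k) (b' k) (c l) - s * ind (a k) (b k) (c l) = ind (a' k) (b' k) (d l) - s * ind (a k) (b k) (d l)"
  proof (cases "l = k")
    case True
    then show ?thesis using l' ind_ends(1)[OF Ik] by (simp add: s_def ind_ends(2))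
  next
    case False
    then have "k < l" "l \<in> {1..n}" using l by auto
    then show ?thesis using l' dual_seq_later[OF D k, of l] exc_seq_orth[OF B k, of l] by simp
  qed
qed

text \<open>Any integer function \<open>w\<close> that is constant on the edges \<open>(a' j, b' j)\<close>, \<open>j < k\<close>, satisfies
  \<open>w u - w v = s * (w (a k) - w (b k))\<close> with \<open>(u, v) = (a' k, b' k)\<close>. This is applied to the
  indicator function of the connected component of \<open>v\<close>, which does not contain \<open>u\<close>.\<close>

lemma dual_seq_component:
  fixes a b a' b' :: "nat \<Rightarrow> nat"
  assumes D: "dual_seq n a b a' b'" and k: "k \<in> {1..n}"
  defines "s \<equiv> ind (a' k) (b' k) (a k) - ind (a' k) (b' k) (b k)"
    and "R \<equiv> {(a' j, b' j) |j. j \<in> {1..k - 1}}"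
  shows "s = 1 \<Longrightarrow> (b' k, b k) \<in> (R \<union> R\<inverse>)\<^sup>*"
    and "s = - 1 \<Longrightarrow> (b' k, a k) \<in> (R \<union> R\<inverse>)\<^sup>* \<and> a k < a' k"
proof -
  note B = dual_seq_base[OF D]
  note I = dual_seq_interval[OF D k] and Ik = exc_seq_interval[OF B k]
  let ?a = "\<lambda>i. if i \<le> k - 1 then a' (k - 1 + 1 - i) else a i"
  let ?b = "\<lambda>i. if i \<le> k - 1 then b' (k - 1 + 1 - i) else b i"
  have "k - 1 \<le> n" using k by auto
  then have E: "exc_seq n ?a ?b" using D unfolding dual_seq_def by blast
  have kk: "?a k = a k" "?b k = b k" using k by auto
  define w :: "nat \<Rightarrow> int" where "w p = (if (b' k, p) \<in> (R \<union> R\<inverse>)\<^sup>* then 1 else 0)" for p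
  have wR: "w (a' j) = w (b' j)" if "j \<in> {1..k - 1}" for j
  proof -
    have "(a' j, b' j) \<in> R \<union> R\<inverse>" "(b' j, a' j) \<in> R \<union> R\<inverse>" using that by (auto simp: R_def)
    then show ?thesis unfolding w_def by (metis rtrancl.rtrancl_into_rtrancl)
  qed
  \<comment> \<open>\<open>E'_k\<close> is orthogonal to each earlier \<open>E'_j\<close>, so its
    indicator function is constant on components. Being 1 at \<open>a' k\<close> and 0 at
    \<open>b' k\<close>, it separates the two ends.\<close>
  have const: "ind (a' k) (b' k) p = ind (a' k) (b' k) q" if "(p, q) \<in> (R \<union> R\<inverse>)\<^sup>*" for p q
    using that
  proof (induction rule: rtrancl_induct)
    case (step q r)
    have "ind (a' k) (b' k) (a' j) = ind (a' k) (b' k) (b' j)" if "j \<in> {1..k - 1}" for j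
      using dual_seq_orth[OF D _ k, of j] that k by auto
    then show ?case using step by (auto simp: R_def)
  qed simp
  have "(b' k, a' k) \<notin> (R \<union> R\<inverse>)\<^sup>*"
    using const[of "b' k" "a' k"] ind_ends(1)[OF I] by (auto simp: ind_ends(2))
  then have wu: "w (a' k) = 0" by (simp add: w_def)
  have wv: "w (b' k) = 1" by (simp add: w_def)
  have "\<exists>c. \<forall>p\<in>{1..n}. ind (a' k) (b' k) p - s * ind (a k) (b k) p
      = (\<Sum>i\<in>{1..k - 1}. c i * ind (?a i) (?b i) p)"
    unfolding s_def by (rule dual_seq_expand[OF D k E]) (use k in auto)
  then obtain c where c: "\<And>p. p \<in> {1..n} \<Longrightarrow> ind (a' k) (b' k) p - s * ind (a k) (b k) p
      = (\<Sum>i\<in>{1..k - 1}. c i * ind (?a i) (?b i) p)"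
    by blast
  define c' where "c' = c(k := s)"
  have ks: "{1..k} = insert k {1..k - 1}" using k by auto
  have "w (a' k) - w (b' k) = (\<Sum>i\<in>{1..k}. c' i * (w (?a i) - w (?b i)))"
  proof (rule pairing_sum[OF I])
    show "interval n (?a j) (?b j)" if "j \<in> {1..k}" for j
      by (rule exc_seq_interval[OF E]) (use that k in auto)
    fix p assume p: "p \<in> {1..n}"
    have "(\<Sum>i\<in>{1..k - 1}. c' i * ind (?a i) (?b i) p) = (\<Sum>i\<in>{1..k - 1}. c i * ind (?a i) (?b i) p)"
      by (intro sum.cong) (auto simp: c'_def)
    moreover have "k \<notin> {1..k - 1}" using k by auto
    ultimately show "ind (a' k) (b' k) p = (\<Sum>i\<in>{1..k}. c' i * ind (?a i) (?b i) p)"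
      unfolding ks using c[OF p] kk by (simp add: c'_def)
  qed
  also have "\<dots> = s * (w (a k) - w (b k))"
  proof -
    have "(\<Sum>i\<in>{1..k - 1}. c' i * (w (?a i) - w (?b i))) = 0"
    proof (rule sum.neutral, rule ballI)
      fix i assume "i \<in> {1..k - 1}"
      moreover from this have "k - 1 + 1 - i \<in> {1..k - 1}" by auto
      ultimately show "c' i * (w (?a i) - w (?b i)) = 0" using wR[of "k - 1 + 1 - i"] by simp
    qed
    moreover have "k \<notin> {1..k - 1}" using k by auto
    ultimately show ?thesis unfolding ks using kk by (simp add: c'_def)
  qed
  finally have eq: "s * (w (a k) - w (b k)) = - 1" using wu wv by simp
  show "s = 1 \<Longrightarrow> (b' k, b k) \<in> (R \<union> R\<inverse>)\<^sup>*"
    using eq by (auto simp: w_def split: if_splits)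
  show "s = - 1 \<Longrightarrow> (b' k, a k) \<in> (R \<union> R\<inverse>)\<^sup>* \<and> a k < a' k"
  proof
    assume s: "s = - 1"
    show "(b' k, a k) \<in> (R \<union> R\<inverse>)\<^sup>*"
      using eq s by (auto simp: w_def split: if_splits)
    \<comment> \<open>For \<open>s = - 1\<close> the interval \<open>E'_k\<close> contains
      \<open>b k\<close> but not the smaller vertex \<open>a k\<close>, so it starts after
      \<open>a k\<close>.\<close>
    show "a k < a' k"
      using s Ik unfolding s_def by (auto simp: ind_def interval_def split: if_splits)
  qed
qed

section \<open>Representations and homomorphisms\<close>

text \<open>Vectors are functions, but are not to be decomposed into coordinates by the simplifier.\<close>

declare plus_fun_apply [simp del] minus_apply [simp del] uminus_apply [simp del]

lemma zero_fun_eta [simp]: "(\<lambda>_. 0) = 0"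
  by (simp add: zero_fun_def)

lemmas pointwise = plus_fun_apply minus_apply uminus_apply

text \<open>With the value \<open>0\<close> outside the range of vertices and arrows, the conditions defining
  homomorphisms and the two-term complex hold for all indices.\<close>

definition space_at :: "nat \<Rightarrow> 'k::field rep \<Rightarrow> nat \<Rightarrow> 'k kvec set"
  where "space_at n M i = (if i \<in> {1..n} then vspace M i else {0})"

definition arrow_at :: "nat \<Rightarrow> 'k::field rep \<Rightarrow> nat \<Rightarrow> 'k kvec \<Rightarrow> 'k kvec"
  where "arrow_at n M i v = (if i \<in> {1..<n} then arrow M i v else 0)"

definition linear_rep :: "nat \<Rightarrow> 'k::field rep \<Rightarrow> bool" where
  "linear_rep n M \<longleftrightarrow> (\<forall>i. kvec.subspace (space_at n M i)) \<and>
     (\<forall>i. arrow_at n M i \<in> lin_maps (space_at n M i) (space_at n M (Suc i)))"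

lemma lin_mapsI:
  assumes "\<And>v. v \<in> V \<Longrightarrow> f v \<in> W"
    and "\<And>u v. u \<in> V \<Longrightarrow> v \<in> V \<Longrightarrow> f (u + v) = f u + f v"
    and "\<And>c v. v \<in> V \<Longrightarrow> f (vscale c v) = vscale c (f v)"
    and "\<And>v. v \<notin> V \<Longrightarrow> f v = 0"
  shows "f \<in> lin_maps V W"
  using assms by (simp add: lin_maps_def)

lemma lin_maps_mem: "f \<in> lin_maps V W \<Longrightarrow> v \<in> V \<Longrightarrow> f v \<in> W"
  and lin_maps_add: "f \<in> lin_maps V W \<Longrightarrow> u \<in> V \<Longrightarrow> v \<in> V \<Longrightarrow> f (u + v) = f u + f v"
  and lin_maps_scale: "f \<in> lin_maps V W \<Longrightarrow> v \<in> V \<Longrightarrow> f (vscale c v) = vscale c (f v)"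
  and lin_maps_outside: "f \<in> lin_maps V W \<Longrightarrow> v \<notin> V \<Longrightarrow> f v = 0"
  by (simp_all add: lin_maps_def)

lemma vscale_0 [simp]: "vscale 0 v = 0" "vscale c 0 = 0"
  by (auto simp: vscale_def fun_eq_iff pointwise)

lemma lin_maps_0: "f \<in> lin_maps V W \<Longrightarrow> f 0 = 0"
  by (metis lin_maps_scale lin_maps_outside vscale_0(1))

lemma lin_maps_diff:
  assumes "f \<in> lin_maps V W" "kvec.subspace V" "u \<in> V" "v \<in> V"
  shows "f (u - v) = f u - f v"
  using lin_maps_add[OF assms(1) kvec.subspace_diff[OF assms(2,3,4)] assms(4)]
  by (simp add: algebra_simps)

lemma lin_maps_comp:
  assumes "f \<in> lin_maps U V" "g \<in> lin_maps V W"
  shows "(\<lambda>v. g (f v)) \<in> lin_maps U W"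
  using assms lin_maps_0[OF assms(2)] by (auto simp: lin_maps_def)

lemma lin_maps_sum:
  assumes "f \<in> lin_maps U V" "g \<in> lin_maps U V" "kvec.subspace V"
  shows "(\<lambda>v. f v + g v) \<in> lin_maps U V"
  using assms
  by (auto simp: lin_maps_def kvec.subspace_add kvec.scale_right_distrib algebra_simps)

lemma lin_maps_zero_codomain: "f \<in> lin_maps V {0} \<longleftrightarrow> f = 0"
proof
  assume f: "f \<in> lin_maps V {0}"
  have "f v = 0" for v
    using lin_maps_mem[OF f, of v] lin_maps_outside[OF f, of v] by auto
  then show "f = 0" by (intro ext) simp
next
  assume "f = 0"
  then show "f \<in> lin_maps V {0}" by (auto intro: lin_mapsI)
qed

lemma lin_maps_zero_domain: "f \<in> lin_maps {0} W \<longleftrightarrow> f = 0 \<and> 0 \<in> W"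
proof
  assume f: "f \<in> lin_maps {0} W"
  then have "f v = 0" for v
    using lin_maps_0[OF f] lin_maps_outside[OF f] by (cases "v = 0") auto
  with f show "f = 0 \<and> 0 \<in> W"
    by (auto simp: lin_maps_def fun_eq_iff)
qed (auto simp: lin_maps_def)

lemma linear_rep_subspace: "linear_rep n M \<Longrightarrow> kvec.subspace (space_at n M i)"
  and linear_rep_arrow:
    "linear_rep n M \<Longrightarrow> arrow_at n M i \<in> lin_maps (space_at n M i) (space_at n M (Suc i))"
  by (auto simp: linear_rep_def)

lemma linear_rep_0: "linear_rep n M \<Longrightarrow> 0 \<in> space_at n M i"
  by (simp add: linear_rep_subspace kvec.subspace_0)

lemma linear_rep_iff:
  "linear_rep n M \<longleftrightarrow> (\<forall>i\<in>{1..n}. kvec.subspace (vspace M i)) \<and>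
     (\<forall>i\<in>{1..<n}. arrow M i \<in> lin_maps (vspace M i) (vspace M (i + 1)))" (is "_ \<longleftrightarrow> ?R")
proof
  assume L: "linear_rep n M"
  show ?R
  proof (intro conjI ballI)
    fix i assume "i \<in> {1..n}"
    then show "kvec.subspace (vspace M i)"
      using linear_rep_subspace[OF L, of i] by (simp add: space_at_def)
  next
    fix i assume i: "i \<in> {1..<n}"
    then have "arrow_at n M i = arrow M i" by (simp add: arrow_at_def fun_eq_iff)
    then show "arrow M i \<in> lin_maps (vspace M i) (vspace M (i + 1))"
      using i linear_rep_arrow[OF L, of i] by (auto simp: space_at_def)
  qed
next
  assume R: ?R
  have sub: "kvec.subspace (space_at n M i)" for i
    using R by (auto simp: space_at_def)
  moreover have "arrow_at n M i \<in> lin_maps (space_at n M i) (space_at n M (Suc i))" for i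
  proof (cases "i \<in> {1..<n}")
    case True
    then have "arrow_at n M i = arrow M i" by (simp add: arrow_at_def fun_eq_iff)
    then show ?thesis using R True by (auto simp: space_at_def)
  next
    case False
    then have "arrow_at n M i = 0" by (auto simp add: arrow_at_def fun_eq_iff)
    then show ?thesis using sub[of "Suc i"]
      by (auto simp: lin_maps_def kvec.subspace_0)
  qed
  ultimately show "linear_rep n M" by (simp add: linear_rep_def)
qed

lemma is_rep_iff: "is_rep n M \<longleftrightarrow> linear_rep n M \<and> (\<forall>i. fin_dim (space_at n M i))"
proof -
  have "fin_dim {0 :: 'a kvec}"
    unfolding fin_dim_def by (rule exI[of _ "{}"]) auto
  then have "(\<forall>i. fin_dim (space_at n M i)) \<longleftrightarrow> (\<forall>i\<in>{1..n}. fin_dim (vspace M i))"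
    by (auto simp: space_at_def)
  then show ?thesis by (auto simp: is_rep_def linear_rep_iff)
qed

lemma is_rep_linear: "is_rep n M \<Longrightarrow> linear_rep n M"
  by (simp add: is_rep_iff)

lemma is_zero_rep_iff: "is_zero_rep n M \<longleftrightarrow> (\<forall>i. space_at n M i = {0})"
  by (auto simp: is_zero_rep_def space_at_def)

lemma vertex_maps_iff:
  "g \<in> vertex_maps n M N \<longleftrightarrow> (\<forall>i. g i \<in> lin_maps (space_at n M i) (space_at n N i))"
proof -
  have "g \<in> vertex_maps n M N \<longleftrightarrow>
      (\<forall>i. (i \<in> {1..n} \<longrightarrow> g i \<in> lin_maps (vspace M i) (vspace N i)) \<and> (i \<notin> {1..n} \<longrightarrow> g i = 0))"
    by (auto simp: vertex_maps_def)
  also have "\<dots> \<longleftrightarrow> (\<forall>i. g i \<in> lin_maps (space_at n M i) (space_at n N i))"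
    by (rule all_cong1) (auto simp: space_at_def lin_maps_zero_codomain)
  finally show ?thesis .
qed

lemma arrow_maps_iff:
  assumes "linear_rep n N"
  shows "h \<in> arrow_maps n M N \<longleftrightarrow> (\<forall>i. h i \<in> lin_maps (space_at n M i) (space_at n N (Suc i)))"
proof -
  have "h \<in> arrow_maps n M N \<longleftrightarrow>
      (\<forall>i. (i \<in> {1..<n} \<longrightarrow> h i \<in> lin_maps (vspace M i) (vspace N (Suc i))) \<and> (i \<notin> {1..<n} \<longrightarrow> h i = 0))"
    by (auto simp: arrow_maps_def)
  also have "\<dots> \<longleftrightarrow> (\<forall>i. h i \<in> lin_maps (space_at n M i) (space_at n N (Suc i)))"
  proof (rule all_cong1)
    fix i
    \<comment> \<open>Off the arrows one of the two spaces is zero: the source for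
      \<open>i = 0\<close>, the target for \<open>i \<ge> n\<close>.\<close>
    consider "i \<in> {1..<n}" | "i = 0" | "i \<ge> n" by force
    then show "(i \<in> {1..<n} \<longrightarrow> h i \<in> lin_maps (vspace M i) (vspace N (Suc i))) \<and> (i \<notin> {1..<n} \<longrightarrow> h i = 0)
      \<longleftrightarrow> h i \<in> lin_maps (space_at n M i) (space_at n N (Suc i))"
    proof cases
      case 2
      then show ?thesis using linear_rep_0[OF assms, of "Suc i"]
        by (simp add: space_at_def[of n M] lin_maps_zero_domain)
    qed (auto simp: space_at_def lin_maps_zero_codomain)
  qed
  finally show ?thesis .
qed

lemma coboundary_eq:
  assumes "g \<in> vertex_maps n M N"
  shows "coboundary n M N g i v = arrow_at n N i (g i v) - g (Suc i) (arrow_at n M i v)"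
proof -
  have "g (Suc i) 0 = 0"
    using assms lin_maps_0 unfolding vertex_maps_iff by blast
  then show ?thesis
    by (auto simp: coboundary_def arrow_at_def)
qed

lemma Hom_iff:
  "f \<in> Hom n M N \<longleftrightarrow> f \<in> vertex_maps n M N \<and>
     (\<forall>i. \<forall>v\<in>space_at n M i. f (Suc i) (arrow_at n M i v) = arrow_at n N i (f i v))"
proof -
  have *: "(\<forall>i\<in>{1..<n}. \<forall>v\<in>vspace M i. f (i + 1) (arrow M i v) = arrow N i (f i v)) \<longleftrightarrow>
     (\<forall>i. \<forall>v\<in>space_at n M i. f (Suc i) (arrow_at n M i v) = arrow_at n N i (f i v))"
    if "f \<in> vertex_maps n M N"
  proof -
    have z: "f i 0 = 0" for i
      using that lin_maps_0 unfolding vertex_maps_iff by blast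
    show ?thesis
      by (auto simp: space_at_def arrow_at_def z)
  qed
  show ?thesis
    using * by (auto simp: Hom_def vertex_maps_def)
qed

lemma Hom_vertex: "f \<in> Hom n M N \<Longrightarrow> f \<in> vertex_maps n M N"
  by (simp add: Hom_iff)

lemma Hom_commute:
  "f \<in> Hom n M N \<Longrightarrow> v \<in> space_at n M i \<Longrightarrow>
    f (Suc i) (arrow_at n M i v) = arrow_at n N i (f i v)"
  by (simp add: Hom_iff)

lemma HomI:
  assumes "\<And>i. f i \<in> lin_maps (space_at n M i) (space_at n N i)"
    and "\<And>i v. v \<in> space_at n M i \<Longrightarrow> f (Suc i) (arrow_at n M i v) = arrow_at n N i (f i v)"
  shows "f \<in> Hom n M N"
  using assms by (simp add: Hom_iff vertex_maps_iff)

lemma vertex_maps_lin: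
  "g \<in> vertex_maps n M N \<Longrightarrow> g i \<in> lin_maps (space_at n M i) (space_at n N i)"
  by (simp add: vertex_maps_iff)

lemma Hom_lin: "f \<in> Hom n M N \<Longrightarrow> f i \<in> lin_maps (space_at n M i) (space_at n N i)"
  by (simp add: Hom_iff vertex_maps_iff)

lemmas Hom_mem = lin_maps_mem[OF Hom_lin]
  and Hom_add = lin_maps_add[OF Hom_lin]
  and Hom_scale = lin_maps_scale[OF Hom_lin]
  and Hom_outside = lin_maps_outside[OF Hom_lin]
  and Hom_0 = lin_maps_0[OF Hom_lin]
  and Hom_diff = lin_maps_diff[OF Hom_lin linear_rep_subspace]

lemma Hom_eqI:
  assumes "f \<in> Hom n M N" "g \<in> Hom n M N"
    and "\<And>i v. v \<in> space_at n M i \<Longrightarrow> f i v = g i v"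
  shows "f = g"
proof -
  have "f i v = g i v" for i v
    using assms Hom_outside[OF assms(1), of v i] Hom_outside[OF assms(2), of v i]
    by (cases "v \<in> space_at n M i") auto
  then show ?thesis by blast
qed

lemma zero_in_Hom: "linear_rep n N \<Longrightarrow> 0 \<in> Hom n M N"
  using lin_maps_0[OF linear_rep_arrow]
  by (auto intro!: HomI simp: lin_maps_def linear_rep_0)

lemma comp_hom_apply [simp]: "comp_hom g f i v = g i (f i v)"
  by (simp add: comp_hom_def)

lemma comp_vertex_maps:
  assumes "f \<in> Hom n A B" "g \<in> vertex_maps n B C"
  shows "comp_hom g f \<in> vertex_maps n A C"
  using assms unfolding vertex_maps_iff comp_hom_def
  by (auto intro: lin_maps_comp Hom_lin)

lemma comp_arrow_maps:
  assumes "linear_rep n C" "f \<in> Hom n A B" "h \<in> arrow_maps n B C"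
  shows "comp_hom h f \<in> arrow_maps n A C"
  using assms(2,3) unfolding arrow_maps_iff[OF assms(1)] comp_hom_def
  by (auto intro: lin_maps_comp Hom_lin)

lemma comp_Hom:
  assumes "f \<in> Hom n A B" "g \<in> Hom n B C"
  shows "comp_hom g f \<in> Hom n A C"
  using assms comp_vertex_maps[OF assms(1) Hom_vertex[OF assms(2)]]
  by (auto simp: Hom_iff[of _ n A C] Hom_commute Hom_mem)

text \<open>Precomposition with \<open>f\<close> is a chain map between the two-term complexes. This
  is the functoriality of Ext in its first argument.\<close>

lemma coboundary_comp:
  assumes f: "f \<in> Hom n A B" and g: "g \<in> vertex_maps n B C"
    and A: "linear_rep n A" and C: "linear_rep n C"
  shows "coboundary n A C (comp_hom g f) = comp_hom (coboundary n B C g) f"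
proof (rule ext, rule ext)
  fix i v
  note * = coboundary_eq[OF comp_vertex_maps[OF f g]] coboundary_eq[OF g]
  show "coboundary n A C (comp_hom g f) i v = comp_hom (coboundary n B C g) f i v"
  proof (cases "v \<in> space_at n A i")
    case True
    then show ?thesis by (simp only: * comp_hom_apply Hom_commute[OF f])
  next
    case False
    have "arrow_at n B i 0 = 0"
      by (metis Hom_0[OF f] Hom_commute[OF f] lin_maps_0[OF linear_rep_arrow[OF A]] linear_rep_0[OF A])
    moreover have "arrow_at n A i v = 0"
      using False lin_maps_outside[OF linear_rep_arrow[OF A]] by blast
    moreover have "f i v = 0" using False Hom_outside[OF f] by blast
    ultimately show ?thesis
      by (simp only: * comp_hom_apply Hom_0[OF f])
  qed
qed

lemma id_hom_eq: "id_hom n M = (\<lambda>i v. if v \<in> space_at n M i then v else 0)"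
  by (auto simp: id_hom_def space_at_def fun_eq_iff)

lemma id_hom_in_Hom: "linear_rep n M \<Longrightarrow> id_hom n M \<in> Hom n M M"
  unfolding id_hom_eq
  by (rule HomI) (auto simp: lin_maps_def linear_rep_subspace kvec.subspace_add kvec.subspace_scale
      lin_maps_mem[OF linear_rep_arrow])

lemma comp_hom_assoc: "comp_hom h (comp_hom g f) = comp_hom (comp_hom h g) f"
  by (simp add: comp_hom_def)

lemma comp_id_arrow_maps:
  assumes "linear_rep n N" "h \<in> arrow_maps n M N"
  shows "comp_hom h (id_hom n M) = h"
proof -
  have "h i \<in> lin_maps (space_at n M i) (space_at n N (Suc i))" for i
    using assms arrow_maps_iff by blast
  then show ?thesis
    using lin_maps_outside lin_maps_0 by (fastforce simp: id_hom_eq fun_eq_iff)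
qed

lemma comp_id_vertex_maps:
  assumes "g \<in> vertex_maps n M N"
  shows "comp_hom g (id_hom n M) = g"
  using lin_maps_outside[OF vertex_maps_lin[OF assms]] lin_maps_0[OF vertex_maps_lin[OF assms]]
  by (fastforce simp: id_hom_eq fun_eq_iff)

lemma id_comp_Hom:
  assumes "f \<in> Hom n M N"
  shows "comp_hom (id_hom n N) f = f"
  using Hom_mem[OF assms] Hom_outside[OF assms] by (fastforce simp: id_hom_eq fun_eq_iff)

lemma iso_rep_refl: "linear_rep n M \<Longrightarrow> iso_rep n M M"
  unfolding iso_rep_def
  by (metis id_hom_in_Hom id_comp_Hom)

lemma iso_rep_sym: "iso_rep n M N \<Longrightarrow> iso_rep n N M"
  unfolding iso_rep_def by blast

lemma iso_rep_trans:
  assumes "iso_rep n L M" "iso_rep n M N"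
  shows "iso_rep n L N"
proof -
  obtain f g where f: "f \<in> Hom n L M" "g \<in> Hom n M L" "comp_hom g f = id_hom n L" "comp_hom f g = id_hom n M"
    using assms(1) unfolding iso_rep_def by blast
  obtain f' g' where f': "f' \<in> Hom n M N" "g' \<in> Hom n N M" "comp_hom g' f' = id_hom n M" "comp_hom f' g' = id_hom n N"
    using assms(2) unfolding iso_rep_def by blast
  have "comp_hom (comp_hom g g') (comp_hom f' f) = id_hom n L"
    by (metis comp_hom_assoc f f'(3) id_comp_Hom)
  moreover have "comp_hom (comp_hom f' f) (comp_hom g g') = id_hom n N"
    by (metis comp_hom_assoc f(4) f' id_comp_Hom)
  ultimately show ?thesis
    unfolding iso_rep_def using comp_Hom f f' by meson
qed

section \<open>Retracts and biproducts\<close>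

lemma Ext_vanishes_0_iff:
  "linear_rep n N \<Longrightarrow> Ext_vanishes n 0 M N \<longleftrightarrow> (\<forall>f\<in>Hom n M N. f = 0)"
  using zero_in_Hom by (auto simp: Ext_vanishes_def)

lemma Ext_vanishes_1_iff:
  "Ext_vanishes n 1 M N \<longleftrightarrow> (\<forall>h\<in>arrow_maps n M N. \<exists>g\<in>vertex_maps n M N. coboundary n M N g = h)"
  by (auto simp: Ext_vanishes_def)

text \<open>Inclusions of direct summands and isomorphisms are both retracts, so one transfer of
  vanishing serves both.\<close>

definition retract :: "nat \<Rightarrow> 'k::field rep \<Rightarrow> 'k rep \<Rightarrow> 'k fam \<Rightarrow> 'k fam \<Rightarrow> bool" where
  "retract n A D \<iota> \<pi> \<longleftrightarrow> \<iota> \<in> Hom n A D \<and> \<pi> \<in> Hom n D A \<and> comp_hom \<pi> \<iota> = id_hom n A"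

lemma retract_apply:
  assumes "retract n A D \<iota> \<pi>" "v \<in> space_at n A i"
  shows "\<pi> i (\<iota> i v) = v"
proof -
  have "comp_hom \<pi> \<iota> i v = v" using assms by (simp add: retract_def id_hom_eq del: comp_hom_apply)
  then show ?thesis by simp
qed

lemma Hom_vanishes_retract:
  assumes "linear_rep n Y" "retract n A D \<iota> \<pi>" "Ext_vanishes n 0 D Y"
  shows "Ext_vanishes n 0 A Y"
  unfolding Ext_vanishes_0_iff[OF assms(1)]
proof
  fix f assume f: "f \<in> Hom n A Y"
  then have "comp_hom f \<pi> = 0"
    using assms comp_Hom unfolding retract_def Ext_vanishes_0_iff[OF assms(1)] by blast
  then have "comp_hom (comp_hom f \<pi>) \<iota> = 0"
    by (simp add: fun_eq_iff)
  then show "f = 0"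
    using assms(2) comp_id_vertex_maps[OF Hom_vertex[OF f]]
    by (simp add: retract_def flip: comp_hom_assoc)
qed

text \<open>A cocycle on \<open>A\<close> is pulled back along \<open>\<pi>\<close>, solved on
  \<open>D\<close>, and the solution is restricted along \<open>\<iota>\<close>.\<close>

lemma Ext1_vanishes_retract:
  assumes A: "linear_rep n A" and Y: "linear_rep n Y"
    and r: "retract n A D \<iota> \<pi>" and E: "Ext_vanishes n 1 D Y"
  shows "Ext_vanishes n 1 A Y"
  unfolding Ext_vanishes_1_iff
proof
  fix h assume h: "h \<in> arrow_maps n A Y"
  have \<iota>: "\<iota> \<in> Hom n A D" and \<pi>: "\<pi> \<in> Hom n D A" and c: "comp_hom \<pi> \<iota> = id_hom n A"
    using r by (auto simp: retract_def)
  obtain g where g: "g \<in> vertex_maps n D Y" "coboundary n D Y g = comp_hom h \<pi>"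
    using E comp_arrow_maps[OF Y \<pi> h] unfolding Ext_vanishes_1_iff by blast
  have "coboundary n A Y (comp_hom g \<iota>) = h"
    using coboundary_comp[OF \<iota> g(1) A Y] g(2) c comp_id_arrow_maps[OF Y h]
    by (simp flip: comp_hom_assoc)
  then show "\<exists>g\<in>vertex_maps n A Y. coboundary n A Y g = h"
    using comp_vertex_maps[OF \<iota> g(1)] by blast
qed

lemma iso_rep_retract: "iso_rep n A D \<Longrightarrow> \<exists>\<iota> \<pi>. retract n A D \<iota> \<pi>"
  by (auto simp: iso_rep_def retract_def)

lemma Ext_vanishes_iso:
  assumes "iso_rep n A D" "linear_rep n A" "linear_rep n D" "linear_rep n Y" "k \<in> {0, 1}"
  shows "Ext_vanishes n k A Y \<longleftrightarrow> Ext_vanishes n k D Y"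
proof -
  obtain \<iota> \<pi> \<iota>' \<pi>' where "retract n A D \<iota> \<pi>" "retract n D A \<iota>' \<pi>'"
    using iso_rep_retract[OF assms(1)] iso_rep_retract[OF iso_rep_sym[OF assms(1)]] by blast
  then show ?thesis
    using assms Hom_vanishes_retract Ext1_vanishes_retract by blast
qed

definition biproduct :: "nat \<Rightarrow> 'k::field rep \<Rightarrow> 'k rep \<Rightarrow> 'k rep \<Rightarrow> bool" where
  "biproduct n D A B \<longleftrightarrow> (\<exists>\<iota>A \<pi>A \<iota>B \<pi>B. retract n A D \<iota>A \<pi>A \<and> retract n B D \<iota>B \<pi>B \<and>
     comp_hom \<pi>A \<iota>B = 0 \<and> comp_hom \<pi>B \<iota>A = 0 \<and>
     (\<forall>i. \<forall>v\<in>space_at n D i. \<iota>A i (\<pi>A i v) + \<iota>B i (\<pi>B i v) = v))"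

lemma Ext_vanishes_biproduct:
  assumes b: "biproduct n D A B" and A: "linear_rep n A" and B: "linear_rep n B"
    and D: "linear_rep n D" and Y: "linear_rep n Y" and k: "k \<in> {0, 1}"
  shows "Ext_vanishes n k D Y \<longleftrightarrow> Ext_vanishes n k A Y \<and> Ext_vanishes n k B Y"
proof -
  obtain \<iota>A \<pi>A \<iota>B \<pi>B where rA: "retract n A D \<iota>A \<pi>A" and rB: "retract n B D \<iota>B \<pi>B"
    and s: "\<And>i v. v \<in> space_at n D i \<Longrightarrow> \<iota>A i (\<pi>A i v) + \<iota>B i (\<pi>B i v) = v"
    using b unfolding biproduct_def by metis
  have HA: "\<iota>A \<in> Hom n A D" "\<pi>A \<in> Hom n D A" and HB: "\<iota>B \<in> Hom n B D" "\<pi>B \<in> Hom n D B"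
    using rA rB by (auto simp: retract_def)
  \<comment> \<open>The codomain \<open>W\<close> is left open so that the decomposition applies
    both to vertex families, with values in \<open>Y_i\<close>, and to arrow families, with values
    in \<open>Y_(i + 1)\<close>.\<close>
  have split: "comp_hom (comp_hom f \<iota>A) \<pi>A i v + comp_hom (comp_hom f \<iota>B) \<pi>B i v = f i v"
    if "f i \<in> lin_maps (space_at n D i) W" for f i v and W :: "'a kvec set"
  proof (cases "v \<in> space_at n D i")
    case True
    then have "f i (\<iota>A i (\<pi>A i v) + \<iota>B i (\<pi>B i v)) = f i (\<iota>A i (\<pi>A i v)) + f i (\<iota>B i (\<pi>B i v))"
      using HA HB by (auto intro!: lin_maps_add[OF that] simp: Hom_mem)
    then show ?thesis using s[OF True] by simp
  next
    case False
    then have "\<pi>A i v = 0" "\<pi>B i v = 0" "f i v = 0"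
      using Hom_outside[OF HA(2)] Hom_outside[OF HB(2)] lin_maps_outside[OF that] by auto
    moreover have "f i 0 = 0" "\<iota>A i 0 = 0" "\<iota>B i 0 = 0"
      using lin_maps_0[OF that] Hom_0[OF HA(1)] Hom_0[OF HB(1)] by auto
    ultimately show ?thesis by (simp only: comp_hom_apply add_0)
  qed
  have "Ext_vanishes n 0 D Y" if "Ext_vanishes n 0 A Y" "Ext_vanishes n 0 B Y"
    unfolding Ext_vanishes_0_iff[OF Y]
  proof
    fix f assume f: "f \<in> Hom n D Y"
    then have "comp_hom f \<iota>A = 0" "comp_hom f \<iota>B = 0"
      using that HA HB comp_Hom unfolding Ext_vanishes_0_iff[OF Y] by blast+
    then show "f = 0"
      using split[of f, OF Hom_lin[OF f]] by (simp add: fun_eq_iff)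
  qed
  moreover have "Ext_vanishes n 1 D Y" if EA: "Ext_vanishes n 1 A Y" and EB: "Ext_vanishes n 1 B Y"
    unfolding Ext_vanishes_1_iff
  proof
    fix h assume h: "h \<in> arrow_maps n D Y"
    obtain a where a: "a \<in> vertex_maps n A Y" "coboundary n A Y a = comp_hom h \<iota>A"
      using EA comp_arrow_maps[OF Y HA(1) h] unfolding Ext_vanishes_1_iff by blast
    obtain b where b: "b \<in> vertex_maps n B Y" "coboundary n B Y b = comp_hom h \<iota>B"
      using EB comp_arrow_maps[OF Y HB(1) h] unfolding Ext_vanishes_1_iff by blast
    let ?a = "comp_hom a \<pi>A" and ?b = "comp_hom b \<pi>B"
    have va: "?a \<in> vertex_maps n D Y" "?b \<in> vertex_maps n D Y"
      using comp_vertex_maps a b HA HB by blast+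
    have hl: "h i \<in> lin_maps (space_at n D i) (space_at n Y (Suc i))" for i
      using h arrow_maps_iff[OF Y] by blast
    define g where "g = (\<lambda>i v. ?a i v + ?b i v)"
    have g: "g \<in> vertex_maps n D Y"
      unfolding vertex_maps_iff g_def
      using lin_maps_sum[OF vertex_maps_lin[OF va(1)] vertex_maps_lin[OF va(2)] linear_rep_subspace[OF Y]]
      by blast
    have "coboundary n D Y g i v = h i v" for i v
    proof -
      have m: "?a i v \<in> space_at n Y i" "?b i v \<in> space_at n Y i"
        using lin_maps_mem[OF vertex_maps_lin[OF va(1)]] lin_maps_outside[OF vertex_maps_lin[OF va(1)]]
          lin_maps_mem[OF vertex_maps_lin[OF va(2)]] lin_maps_outside[OF vertex_maps_lin[OF va(2)]]
          linear_rep_0[OF Y] by metis+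
      have "coboundary n D Y g i v = coboundary n D Y ?a i v + coboundary n D Y ?b i v"
        unfolding coboundary_eq[OF g] coboundary_eq[OF va(1)] coboundary_eq[OF va(2)]
        using lin_maps_add[OF linear_rep_arrow[OF Y] m] by (simp add: g_def)
      also have "\<dots> = comp_hom (comp_hom h \<iota>A) \<pi>A i v + comp_hom (comp_hom h \<iota>B) \<pi>B i v"
        by (simp only: coboundary_comp[OF HA(2) a(1) D Y] coboundary_comp[OF HB(2) b(1) D Y] a(2) b(2))
      also have "\<dots> = h i v" by (rule split[OF hl])
      finally show ?thesis .
    qed
    then show "\<exists>g\<in>vertex_maps n D Y. coboundary n D Y g = h"
      using g by blast
  qed
  ultimately show ?thesis
    using k Hom_vanishes_retract[OF Y rA] Hom_vanishes_retract[OF Y rB]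
      Ext1_vanishes_retract[OF A Y rA] Ext1_vanishes_retract[OF B Y rB] by auto
qed

section \<open>Interleaving of coordinates as a biproduct\<close>

lemma evens_pair [simp]: "evens (pair_vec u v) = u"
  and odds_pair [simp]: "odds (pair_vec u v) = v"
  and pair_evens_odds [simp]: "pair_vec (evens w) (odds w) = w"
  by (auto simp: evens_def odds_def pair_vec_def fun_eq_iff pointwise)

lemma evens_0 [simp]: "evens 0 = 0" and odds_0 [simp]: "odds 0 = 0"
  and pair_0 [simp]: "pair_vec 0 0 = 0"
  by (auto simp: evens_def odds_def pair_vec_def fun_eq_iff pointwise)

lemma evens_add: "evens (u + v) = evens u + evens v"
  and odds_add: "odds (u + v) = odds u + odds v"
  and pair_add: "pair_vec (a + b) (c + d) = pair_vec a c + pair_vec b d"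
  by (auto simp: evens_def odds_def pair_vec_def fun_eq_iff pointwise)

lemma evens_scale: "evens (vscale c v) = vscale c (evens v)"
  and odds_scale: "odds (vscale c v) = vscale c (odds v)"
  and pair_scale: "pair_vec (vscale c u) (vscale c v) = vscale c (pair_vec u v)"
  by (auto simp: evens_def odds_def pair_vec_def vscale_def fun_eq_iff pointwise)

lemma evens_odds_0_iff: "evens w = 0 \<and> odds w = 0 \<longleftrightarrow> w = 0"
  by (metis evens_0 odds_0 pair_evens_odds)

lemma space_at_dsum:
  "space_at n (dsum A B) i = {w. evens w \<in> space_at n A i \<and> odds w \<in> space_at n B i}"
  by (auto simp: space_at_def dsum_def Let_def evens_odds_0_iff)

lemma arrow_at_dsum:
  "arrow_at n (dsum A B) i w =
     (if w \<in> space_at n (dsum A B) i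
      then pair_vec (arrow_at n A i (evens w)) (arrow_at n B i (odds w)) else 0)"
  by (simp add: arrow_at_def space_at_def dsum_def Let_def)

lemma linear_rep_dsum:
  assumes A: "linear_rep n A" and B: "linear_rep n B"
  shows "linear_rep n (dsum A B)"
proof -
  note sub = linear_rep_subspace[OF A] linear_rep_subspace[OF B]
  have s: "kvec.subspace (space_at n (dsum A B) i)" for i
    unfolding space_at_dsum using sub[THEN kvec.subspace_add] sub[THEN kvec.subspace_scale]
    by (auto intro!: kvec.subspaceI simp: evens_add odds_add evens_scale odds_scale
        linear_rep_0[OF A] linear_rep_0[OF B])
  moreover have "arrow_at n (dsum A B) i \<in> lin_maps (space_at n (dsum A B) i) (space_at n (dsum A B) (Suc i))" for i
  proof (rule lin_mapsI)
    note a = linear_rep_arrow[OF A, of i] and b = linear_rep_arrow[OF B, of i]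
    fix v assume v: "v \<in> space_at n (dsum A B) i"
    show "arrow_at n (dsum A B) i v \<in> space_at n (dsum A B) (Suc i)"
      using v lin_maps_mem[OF a] lin_maps_mem[OF b] by (simp add: arrow_at_dsum) (simp add: space_at_dsum)
    show "arrow_at n (dsum A B) i (vscale c v) = vscale c (arrow_at n (dsum A B) i v)" for c
      using v kvec.subspace_scale[OF s v, of c] lin_maps_scale[OF a] lin_maps_scale[OF b]
      by (simp add: arrow_at_dsum evens_scale odds_scale) (simp add: space_at_dsum pair_scale)
    fix u assume u: "u \<in> space_at n (dsum A B) i"
    show "arrow_at n (dsum A B) i (u + v) = arrow_at n (dsum A B) i u + arrow_at n (dsum A B) i v"
      using u v kvec.subspace_add[OF s u v] lin_maps_add[OF a] lin_maps_add[OF b]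
      by (simp add: arrow_at_dsum evens_add odds_add) (simp add: space_at_dsum pair_add)
  qed (simp add: arrow_at_dsum)
  ultimately show ?thesis by (simp add: linear_rep_def)
qed

lemma biproduct_dsum:
  assumes A: "linear_rep n A" and B: "linear_rep n B"
  shows "biproduct n (dsum A B) A B"
proof -
  let ?D = "dsum A B"
  note D = linear_rep_dsum[OF A B]
  note sub = linear_rep_subspace[OF A] linear_rep_subspace[OF B] linear_rep_subspace[OF D]
  note closed = sub[THEN kvec.subspace_add] sub[THEN kvec.subspace_scale] linear_rep_0[OF A] linear_rep_0[OF B]
  note arr0 = lin_maps_0[OF linear_rep_arrow[OF A]] lin_maps_0[OF linear_rep_arrow[OF B]]
  note mem = lin_maps_mem[OF linear_rep_arrow[OF A]] lin_maps_mem[OF linear_rep_arrow[OF B]]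
    lin_maps_mem[OF linear_rep_arrow[OF D]]
  have pair_mem: "pair_vec u v \<in> space_at n ?D i \<longleftrightarrow> u \<in> space_at n A i \<and> v \<in> space_at n B i" for u v i
    by (simp add: space_at_dsum)
  have parts: "evens w \<in> space_at n A i" "odds w \<in> space_at n B i" if "w \<in> space_at n ?D i" for w i
    using that by (auto simp: space_at_dsum)
  define \<iota>A where "\<iota>A = (\<lambda>i u. if u \<in> space_at n A i then pair_vec u 0 else 0)"
  define \<iota>B where "\<iota>B = (\<lambda>i u. if u \<in> space_at n B i then pair_vec 0 u else 0)"
  define \<pi>A where "\<pi>A = (\<lambda>i w. if w \<in> space_at n ?D i then evens w else 0)"
  define \<pi>B where "\<pi>B = (\<lambda>i w. if w \<in> space_at n ?D i then odds w else 0)"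
  have "\<iota>A \<in> Hom n A ?D"
    unfolding \<iota>A_def
    by (rule HomI, rule lin_mapsI)
      (auto simp: closed mem pair_mem arrow_at_dsum arr0 simp flip: pair_add pair_scale)
  moreover have "\<iota>B \<in> Hom n B ?D"
    unfolding \<iota>B_def
    by (rule HomI, rule lin_mapsI)
      (auto simp: closed mem pair_mem arrow_at_dsum arr0 simp flip: pair_add pair_scale)
  moreover have "\<pi>A \<in> Hom n ?D A" "\<pi>B \<in> Hom n ?D B"
    unfolding \<pi>A_def \<pi>B_def
    by (rule HomI, rule lin_mapsI;
        auto simp: closed mem parts evens_add evens_scale odds_add odds_scale;
        simp add: arrow_at_dsum)+
  moreover have "comp_hom \<pi>A \<iota>A = id_hom n A" "comp_hom \<pi>B \<iota>B = id_hom n B"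
      "comp_hom \<pi>A \<iota>B = 0" "comp_hom \<pi>B \<iota>A = 0"
    unfolding comp_hom_def id_hom_eq
    by (intro ext; simp add: \<iota>A_def \<pi>A_def \<iota>B_def \<pi>B_def pair_mem closed pointwise)+
  moreover have "\<iota>A i (\<pi>A i v) + \<iota>B i (\<pi>B i v) = v" if "v \<in> space_at n ?D i" for i v
    using that by (simp add: \<iota>A_def \<pi>A_def \<iota>B_def \<pi>B_def parts flip: pair_add)
  ultimately show ?thesis
    unfolding biproduct_def retract_def by blast
qed

lemma Ext_vanishes_zero_rep:
  assumes Y: "linear_rep n Y" and "k \<in> {0, 1}"
  shows "Ext_vanishes n k zero_rep Y"
proof -
  have s: "space_at n (zero_rep :: 'a rep) i = {0}" for i
    by (simp add: space_at_def zero_rep_def)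
  have "f = 0" if "f \<in> Hom n zero_rep Y" for f
    using Hom_lin[OF that] by (simp add: s lin_maps_zero_domain fun_eq_iff)
  moreover have "h = coboundary n zero_rep Y 0" if "h \<in> arrow_maps n zero_rep Y" for h
  proof -
    have "h i = 0" for i
      using that by (simp add: s arrow_maps_iff[OF Y] lin_maps_zero_domain)
    moreover have "coboundary n zero_rep Y 0 i v = 0" for i v
      using coboundary_eq[OF Hom_vertex[OF zero_in_Hom[OF Y]], of "zero_rep" i v]
        lin_maps_0[OF linear_rep_arrow[OF Y]] by simp
    ultimately show ?thesis by (intro ext) simp
  qed
  ultimately show ?thesis
    using assms Hom_vertex[OF zero_in_Hom[OF Y]]
    unfolding Ext_vanishes_0_iff[OF Y] Ext_vanishes_1_iff by (metis Ext_vanishes_0_iff Ext_vanishes_1_iff Y empty_iff insert_iff)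
qed

lemma linear_rep_dsum_list:
  "(\<And>M. M \<in> set Ms \<Longrightarrow> linear_rep n M) \<Longrightarrow> linear_rep n (dsum_list Ms)"
proof (induction Ms)
  case Nil
  have "kvec.subspace {0 :: 'a kvec}" by simp
  then show ?case
    by (auto simp: dsum_list_def linear_rep_def space_at_def arrow_at_def zero_rep_def lin_maps_def)
next
  case (Cons M Ms)
  then show ?case by (simp add: dsum_list_def linear_rep_dsum)
qed

lemma Ext_vanishes_dsum_list:
  assumes Y: "linear_rep n Y" and k: "k \<in> {0, 1}"
    and "\<And>M. M \<in> set Ms \<Longrightarrow> linear_rep n M"
  shows "Ext_vanishes n k (dsum_list Ms) Y \<longleftrightarrow> (\<forall>M\<in>set Ms. Ext_vanishes n k M Y)"
  using assms(3)
proof (induction Ms)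
  case Nil
  show ?case using Ext_vanishes_zero_rep[OF Y k] by (simp add: dsum_list_def)
next
  case (Cons M Ms)
  have "linear_rep n M" and Ms: "linear_rep n (dsum_list Ms)"
    using Cons.prems by (auto intro: linear_rep_dsum_list)
  then have "Ext_vanishes n k (dsum M (dsum_list Ms)) Y \<longleftrightarrow>
      Ext_vanishes n k M Y \<and> Ext_vanishes n k (dsum_list Ms) Y"
    using Ext_vanishes_biproduct[OF biproduct_dsum _ _ linear_rep_dsum Y k] by blast
  then show ?case using Cons by (simp add: dsum_list_def)
qed

section \<open>Transport along the quiver\<close>

text \<open>Composite of the arrows from \<open>p\<close> up to \<open>q\<close>, by recursion on
  the target. The default \<open>v\<close> for \<open>q \<le> p\<close> makes the empty composite
  the identity.\<close>

primrec transport :: "nat \<Rightarrow> 'k::field rep \<Rightarrow> nat \<Rightarrow> nat \<Rightarrow> 'k kvec \<Rightarrow> 'k kvec" where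
  "transport n M p 0 v = v"
| "transport n M p (Suc q) v = (if p \<le> q then arrow_at n M q (transport n M p q v) else v)"

lemma transport_self [simp]: "transport n M p p v = v"
  by (cases p) auto

lemma transport_Suc: "p \<le> q \<Longrightarrow> transport n M p (Suc q) v = arrow_at n M q (transport n M p q v)"
  by simp

declare transport.simps(2) [simp del]

lemma transport_comp:
  assumes "p \<le> q" "q \<le> r"
  shows "transport n M q r (transport n M p q v) = transport n M p r v"
  using assms(2,1) by (induction r rule: dec_induct) (simp_all add: transport_Suc)

lemma transport_lin:
  assumes "linear_rep n M" "p \<le> q"
  shows "transport n M p q \<in> {f. (\<forall>v\<in>space_at n M p. f v \<in> space_at n M q) \<and>
     (\<forall>u\<in>space_at n M p. \<forall>v\<in>space_at n M p. f (u + v) = f u + f v) \<and>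
     (\<forall>c. \<forall>v\<in>space_at n M p. f (vscale c v) = vscale c (f v))}"
  using assms(2)
proof (induction q rule: dec_induct)
  case (step q)
  note a = linear_rep_arrow[OF assms(1), of q]
  from step show ?case
    by (simp add: transport_Suc lin_maps_mem[OF a] lin_maps_add[OF a] lin_maps_scale[OF a])
qed simp

lemma transport_mem: "linear_rep n M \<Longrightarrow> p \<le> q \<Longrightarrow> v \<in> space_at n M p \<Longrightarrow> transport n M p q v \<in> space_at n M q"
  and transport_add: "linear_rep n M \<Longrightarrow> p \<le> q \<Longrightarrow> u \<in> space_at n M p \<Longrightarrow> v \<in> space_at n M p \<Longrightarrow>
    transport n M p q (u + v) = transport n M p q u + transport n M p q v"
  and transport_scale: "linear_rep n M \<Longrightarrow> p \<le> q \<Longrightarrow> v \<in> space_at n M p \<Longrightarrow>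
    transport n M p q (vscale c v) = vscale c (transport n M p q v)"
  using transport_lin by blast+

lemma transport_0: "linear_rep n M \<Longrightarrow> p \<le> q \<Longrightarrow> transport n M p q 0 = 0"
  by (metis transport_scale linear_rep_0 vscale_0(1))

lemma transport_diff:
  assumes "linear_rep n M" "p \<le> q" "u \<in> space_at n M p" "v \<in> space_at n M p"
  shows "transport n M p q (u - v) = transport n M p q u - transport n M p q v"
  using transport_add[OF assms(1,2) kvec.subspace_diff[OF linear_rep_subspace[OF assms(1)] assms(3,4)] assms(4)]
  by (simp add: algebra_simps)

lemma Hom_transport:
  assumes f: "f \<in> Hom n M N" and M: "linear_rep n M" and v: "v \<in> space_at n M p" and "p \<le> q"
  shows "f q (transport n M p q v) = transport n N p q (f p v)"
  using assms(4)
proof (induction q rule: dec_induct)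
  case (step q)
  then show ?case
    using Hom_commute[OF f transport_mem[OF M step(1) v]] by (simp add: transport_Suc)
qed simp

definition transport_inj :: "nat \<Rightarrow> 'k::field rep \<Rightarrow> nat \<Rightarrow> nat \<Rightarrow> bool" where
  "transport_inj n Y p q \<longleftrightarrow> (\<forall>u\<in>space_at n Y p. transport n Y p q u = 0 \<longrightarrow> u = 0)"

definition transport_surj :: "nat \<Rightarrow> 'k::field rep \<Rightarrow> nat \<Rightarrow> nat \<Rightarrow> bool" where
  "transport_surj n Y p q \<longleftrightarrow> (\<forall>v\<in>space_at n Y q. \<exists>u\<in>space_at n Y p. transport n Y p q u = v)"

lemma transport_injD:
  "transport_inj n Y p q \<Longrightarrow> u \<in> space_at n Y p \<Longrightarrow> transport n Y p q u = 0 \<Longrightarrow> u = 0"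
  by (simp add: transport_inj_def)

section \<open>Interval modules\<close>

definition line :: "'k::field kvec set"
  where "line = {v. \<forall>m>0. v m = 0}"

definition unit_vec :: "'k::field kvec"
  where "unit_vec = (\<lambda>m. if m = 0 then 1 else 0)"

text \<open>The top is at \<open>x\<close> and the socle at \<open>y - 1\<close>.\<close>

definition ival :: "nat \<Rightarrow> nat \<Rightarrow> 'k::field rep" where
  "ival x y = \<lparr>vspace = (\<lambda>j. if x \<le> j \<and> j < y then line else {0}),
     arrow = (\<lambda>j v. if x \<le> j \<and> Suc j < y \<and> v \<in> line then v else 0)\<rparr>"

lemma vscale_at: "vscale c v m = c * v m"
  by (simp add: vscale_def)

lemma line_scale: "v \<in> line \<Longrightarrow> vscale (v 0) unit_vec = v"
  by (auto simp: line_def unit_vec_def vscale_def fun_eq_iff pointwise)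

lemma unit_vec_line [simp]: "unit_vec \<in> line"
  by (simp add: line_def unit_vec_def)

lemma unit_vec_nonzero [simp]: "unit_vec \<noteq> (0 :: 'k::field kvec)"
  by (auto simp: unit_vec_def fun_eq_iff pointwise)

lemma unit_vec_at_0 [simp]: "unit_vec 0 = 1"
  by (simp add: unit_vec_def)

lemma subspace_line: "kvec.subspace line"
  by (rule kvec.subspaceI) (auto simp: line_def vscale_def pointwise)

lemma line_0 [simp]: "0 \<in> line"
  by (simp add: line_def pointwise)

lemma line_add: "u \<in> line \<Longrightarrow> v \<in> line \<Longrightarrow> u + v \<in> line"
  and line_vscale: "v \<in> line \<Longrightarrow> vscale c v \<in> line"
  using subspace_line kvec.subspace_add kvec.subspace_scale by blast+

lemma space_at_ival:
  "interval n x y \<Longrightarrow> space_at n (ival x y) j = (if x \<le> j \<and> j < y then line else {0})"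
  by (auto simp: interval_def space_at_def ival_def)

lemma arrow_at_ival:
  "interval n x y \<Longrightarrow>
    arrow_at n (ival x y) j v = (if x \<le> j \<and> Suc j < y \<and> v \<in> line then v else 0)"
  by (auto simp: interval_def arrow_at_def ival_def)

lemma linear_rep_ival: "interval n x y \<Longrightarrow> linear_rep n (ival x y)"
  by (auto simp: linear_rep_def space_at_ival subspace_line arrow_at_ival
      intro!: lin_mapsI line_add line_vscale)

lemma is_rep_ival: 
  assumes "interval n x y"
  shows "is_rep n (ival x y :: 'k::field rep)"
proof -
  have "line \<subseteq> kvec.span {unit_vec :: 'k kvec}"
    using line_scale by (metis insertI1 kvec.span_base kvec.span_scale subsetI)
  then have "fin_dim (line :: 'k kvec set)"
    unfolding fin_dim_def by blast
  moreover have "fin_dim {0 :: 'k kvec}"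
    unfolding fin_dim_def by (rule exI[of _ "{}"]) auto
  ultimately show ?thesis
    using assms by (simp add: is_rep_iff linear_rep_ival space_at_ival)
qed

lemma transport_ival:
  assumes "interval n x y" "v \<in> space_at n (ival x y) p" "p < q"
  shows "transport n (ival x y) p q v = (if q < y then v else 0)"
proof -
  have "Suc p \<le> q" using assms(3) by simp
  then show ?thesis
  proof (induction q rule: dec_induct)
    case base
    show ?case using assms(2)
      by (auto simp: transport_Suc arrow_at_ival[OF assms(1)] space_at_ival[OF assms(1)] split: if_splits)
  next
    case (step q)
    then show ?case using assms(2)
      by (auto simp: transport_Suc arrow_at_ival[OF assms(1)] space_at_ival[OF assms(1)] split: if_splits)
  qed
qed

text \<open>The interval module is \<open>P_x\<close> modulo \<open>P_y\<close>: one generator at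
  \<open>x\<close>, subject to the relation that its image at \<open>y\<close> vanishes. For
  \<open>y = n + 1\<close> the relation is void, the space at \<open>n + 1\<close> being
  zero.\<close>

lemma Hom_from_ival:
  fixes Y :: "'k::field rep"
  assumes I: "interval n x y" and Y: "linear_rep n Y"
    and u: "u \<in> space_at n Y x" "transport n Y x y u = 0"
  defines "f \<equiv> (\<lambda>j v :: 'k kvec. if x \<le> j \<and> j < y \<and> v \<in> line then vscale (v 0) (transport n Y x j u) else 0)"
  shows "f \<in> Hom n (ival x y) Y"
proof (rule HomI)
  note Y0 = linear_rep_0[OF Y] and Ys = linear_rep_subspace[OF Y]
  have m: "transport n Y x j u \<in> space_at n Y j" if "x \<le> j" for j
    using transport_mem[OF Y that u(1)] .
  fix j
  show "f j \<in> lin_maps (space_at n (ival x y) j) (space_at n Y j)"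
  proof (rule lin_mapsI)
    fix a :: "'k kvec" assume a: "a \<in> space_at n (ival x y) j"
    then show "f j a \<in> space_at n Y j"
      by (auto simp: f_def Y0 m kvec.subspace_scale[OF Ys])
    show "f j (vscale c a) = vscale c (f j a)" for c
      using a by (auto simp: f_def space_at_ival[OF I] line_vscale) (simp add: vscale_at)
    fix b :: "'k kvec" assume b: "b \<in> space_at n (ival x y) j"
    show "f j (a + b) = f j a + f j b"
      using a b by (auto simp: f_def space_at_ival[OF I] line_add kvec.scale_left_distrib pointwise split: if_splits)
  qed (auto simp: f_def space_at_ival[OF I] split: if_splits)
  fix v :: "'k kvec" assume v: "v \<in> space_at n (ival x y) j"
  show "f (Suc j) (arrow_at n (ival x y) j v) = arrow_at n Y j (f j v)"
  proof (cases "x \<le> j \<and> j < y")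
    case True
    then have vl: "v \<in> line" using v by (simp add: space_at_ival[OF I])
    have "arrow_at n Y j (f j v) = vscale (v 0) (transport n Y x (Suc j) u)"
      using True vl lin_maps_scale[OF linear_rep_arrow[OF Y] m] by (simp add: f_def transport_Suc)
    moreover have "transport n Y x (Suc j) u = 0" if "\<not> Suc j < y"
    proof -
      have "Suc j = y" using that True by simp
      then show ?thesis using u(2) by blast
    qed
    ultimately show ?thesis
      using True vl by (cases "Suc j < y") (auto simp: f_def arrow_at_ival[OF I])
  next
    case False
    then have "v = 0" using v by (auto simp add: space_at_ival[OF I])
    then show ?thesis using lin_maps_0[OF linear_rep_arrow[OF Y]]
      by (auto simp add: f_def arrow_at_ival[OF I])
  qed
qed

lemma Hom_ival_vanishes_iff:
  fixes Y :: "'k::field rep"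
  assumes I: "interval n x y" and Y: "linear_rep n Y"
  shows "Ext_vanishes n 0 (ival x y) Y \<longleftrightarrow> transport_inj n Y x y"
proof
  assume E: "Ext_vanishes n 0 (ival x y) Y"
  show "transport_inj n Y x y"
    unfolding transport_inj_def
  proof (intro ballI impI)
    fix u assume u: "u \<in> space_at n Y x" "transport n Y x y u = 0"
    let ?f = "\<lambda>j v. if x \<le> j \<and> j < y \<and> v \<in> line then vscale (v 0) (transport n Y x j u) else 0"
    have "?f = 0"
      using E Hom_from_ival[OF I Y u] unfolding Ext_vanishes_0_iff[OF Y] by blast
    from fun_cong[OF fun_cong[OF this, of x], of unit_vec] have "?f x unit_vec = 0" by simp
    then show "u = 0" using I by (simp add: interval_def pointwise)
  qed
next
  assume inj: "transport_inj n Y x y"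
  note L = linear_rep_ival[OF I]
  have xs: "(unit_vec :: 'k kvec) \<in> space_at n (ival x y) x"
    using I by (simp add: space_at_ival) (simp add: interval_def)
  show "Ext_vanishes n 0 (ival x y) Y"
    unfolding Ext_vanishes_0_iff[OF Y]
  proof
    fix f assume f: "f \<in> Hom n (ival x y) Y"
    let ?u = "f x unit_vec"
    have "transport n Y x y ?u = f y (transport n (ival x y) x y unit_vec)"
      using Hom_transport[OF f L xs, of y] I by (simp add: interval_def)
    also have "\<dots> = 0"
      using transport_ival[OF I xs, of y] I Hom_0[OF f, of y] by (auto simp: interval_def)
    finally have u0: "?u = 0" using inj Hom_mem[OF f xs] by (simp add: transport_inj_def)
    have "f j v = 0" if v: "v \<in> space_at n (ival x y) j" for j v
    proof (cases "x \<le> j \<and> j < y")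
      case True
      then have vl: "v \<in> line" using v by (simp add: space_at_ival[OF I])
      have "transport n (ival x y) x j unit_vec = (unit_vec :: 'k kvec)"
        using True transport_ival[OF I xs] by (cases "x = j") auto
      then have "f j unit_vec = 0"
        using Hom_transport[OF f L xs, of j] u0 True transport_0[OF Y] by simp
      then have "f j (vscale (v 0) unit_vec) = 0"
        using Hom_scale[OF f, of unit_vec] True by (simp add: space_at_ival[OF I])
      then show ?thesis by (simp add: line_scale[OF vl])
    next
      case False
      then have "v = 0" using v by (auto simp add: space_at_ival[OF I])
      then show ?thesis by (simp add: Hom_0[OF f])
    qed
    then show "f = 0" by (intro Hom_eqI[OF f zero_in_Hom[OF Y]]) simp
  qed
qed

lemma Ext_ival_vanishes_iff:
  assumes I: "interval n x y" and Y: "linear_rep n Y"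
  shows "Ext_vanishes n 1 (ival x y) Y \<longleftrightarrow> transport_surj n Y x y"
proof
  assume E: "Ext_vanishes n 1 (ival x y) Y"
  show "transport_surj n Y x y"
    unfolding transport_surj_def
  proof
    fix w assume w: "w \<in> space_at n Y y"
    \<comment> \<open>An extension concentrated on the last arrow, from \<open>y - 1\<close> to
      \<open>y\<close>, with value \<open>w\<close>. On the earlier arrows the equation for
      \<open>g\<close> says that \<open>g\<close> follows the transport of its value at
      \<open>x\<close>, so the last arrow forces that transport to end at \<open>w\<close>.\<close>
    define h where "h = (\<lambda>j v. if Suc j = y \<and> v \<in> line then vscale (v 0) w else 0)"
    have "h j \<in> lin_maps (space_at n (ival x y) j) (space_at n Y (Suc j))" for j
      using I w by (intro lin_mapsI) (auto simp: h_def space_at_ival[OF I] interval_def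
        linear_rep_0[OF Y] kvec.subspace_scale[OF linear_rep_subspace[OF Y]] line_add line_vscale kvec.scale_left_distrib
        vscale_at pointwise split: if_splits)
    then have "h \<in> arrow_maps n (ival x y) Y" by (simp add: arrow_maps_iff[OF Y])
    then obtain g where g: "g \<in> vertex_maps n (ival x y) Y" "coboundary n (ival x y) Y g = h"
      using E unfolding Ext_vanishes_1_iff by blast
    have c: "h j v = arrow_at n Y j (g j v) - g (Suc j) (arrow_at n (ival x y) j v)" for j v
      using coboundary_eq[OF g(1), of j v] g(2) by simp
    let ?u = "g x unit_vec"
    have t: "transport n Y x j ?u = g j unit_vec" if "x \<le> j" "j < y" for j
      using that
    proof (induction j rule: dec_induct)
      case (step j)
      then have "arrow_at n Y j (g j unit_vec) = g (Suc j) unit_vec"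
        using c[of j unit_vec] by (simp add: h_def arrow_at_ival[OF I])
      then show ?case using step by (simp add: transport_Suc)
    qed simp
    obtain j where j: "y = Suc j" "x \<le> j" using I by (cases y) (auto simp: interval_def)
    have "arrow_at n (ival x y) j unit_vec = (0 :: 'a kvec)"
      using j arrow_at_ival[OF I, of j "unit_vec :: 'a kvec"] by simp
    then have "w = arrow_at n Y j (g j unit_vec)"
      using c[of j unit_vec] j lin_maps_0[OF vertex_maps_lin[OF g(1)]]
      by (simp add: h_def)
    then have "transport n Y x y ?u = w" using t j by (simp add: transport_Suc)
    moreover have "?u \<in> space_at n Y x"
      using lin_maps_mem[OF vertex_maps_lin[OF g(1)], of unit_vec x] I
      by (simp add: space_at_ival) (simp add: interval_def)
    ultimately show "\<exists>u\<in>space_at n Y x. transport n Y x y u = w" by blast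
  qed
next
  assume surj: "transport_surj n Y x y"
  note Ys = linear_rep_subspace[OF Y] and Y0 = linear_rep_0[OF Y] and arr = linear_rep_arrow[OF Y]
  show "Ext_vanishes n 1 (ival x y) Y"
    unfolding Ext_vanishes_1_iff
  proof
    fix h assume h: "h \<in> arrow_maps n (ival x y) Y"
    have hl: "h j \<in> lin_maps (space_at n (ival x y) j) (space_at n Y (Suc j))" for j
      using h arrow_maps_iff[OF Y] by blast
    define w where "w j = h j unit_vec" for j
    have w: "w j \<in> space_at n Y (Suc j)" for j
      using lin_maps_mem[OF hl] lin_maps_outside[OF hl] Y0 unfolding w_def by metis
    \<comment> \<open>The coboundary equation determines a solution recursively from its value at
      \<open>x\<close>. Starting from 0 gives \<open>P\<close>, whose value at \<open>y\<close>
      should be 0 but need not be; surjectivity yields a starting value \<open>t\<close> whose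
      transport cancels it.\<close>
    define P where "P = rec_nat 0 (\<lambda>d p. arrow_at n Y (x + d) p - w (x + d))"
    have P0: "P 0 = 0" and PS: "P (Suc d) = arrow_at n Y (x + d) (P d) - w (x + d)" for d
      by (simp_all add: P_def)
    have Pm: "P d \<in> space_at n Y (x + d)" for d
    proof (induction d)
      case 0
      show ?case using Y0[of x] P0 by (metis add_0_right)
    next
      case (Suc d)
      show ?case unfolding PS add_Suc_right
        by (rule kvec.subspace_diff[OF Ys lin_maps_mem[OF arr Suc] w])
    qed
    have "- P (y - x) \<in> space_at n Y y"
      using Pm[of "y - x"] I kvec.subspace_neg[OF Ys] by (simp add: interval_def)
    then obtain t where t: "t \<in> space_at n Y x" "transport n Y x y t = - P (y - x)"
      using surj by (auto simp: transport_surj_def)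
    define Q where "Q j = P (j - x) + transport n Y x j t" for j
    have Qm: "Q j \<in> space_at n Y j" if "x \<le> j" for j
      using Pm[of "j - x"] transport_mem[OF Y that t(1)] that kvec.subspace_add[OF Ys] by (simp add: Q_def)
    have QS: "arrow_at n Y j (Q j) - Q (Suc j) = w j" if "x \<le> j" for j
      using that Pm[of "j - x"] lin_maps_add[OF arr _ transport_mem[OF Y that t(1)], of "P (j - x)"]
        PS[of "j - x"]
      by (simp add: Q_def Suc_diff_le transport_Suc)
    have Qy: "Q y = 0" using t by (simp add: Q_def)
    define g where "g = (\<lambda>j v. if x \<le> j \<and> j < y \<and> v \<in> line then vscale (v 0) (Q j) else 0)"
    have g: "g \<in> vertex_maps n (ival x y) Y"
      unfolding vertex_maps_iff g_def
      by (intro allI lin_mapsI) (auto simp: space_at_ival[OF I] Y0 Qm kvec.subspace_scale[OF Ys]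
        line_add line_vscale kvec.scale_left_distrib vscale_at pointwise split: if_splits)
    have "coboundary n (ival x y) Y g j v = h j v" for j v
    proof (cases "x \<le> j \<and> j < y \<and> v \<in> line")
      case True
      then have "arrow_at n Y j (g j v) = vscale (v 0) (arrow_at n Y j (Q j))"
        using lin_maps_scale[OF arr Qm] by (simp add: g_def)
      moreover have "g (Suc j) (arrow_at n (ival x y) j v) = vscale (v 0) (Q (Suc j))"
      proof (cases "Suc j < y")
        case False
        then have "Suc j = y" using True by simp
        then show ?thesis using Qy by (simp add: g_def)
      qed (use True in \<open>simp add: g_def arrow_at_ival[OF I]\<close>)
      ultimately have "coboundary n (ival x y) Y g j v = vscale (v 0) (w j)"
        using QS True by (simp add: coboundary_eq[OF g] flip: kvec.scale_right_diff_distrib)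
      also have "\<dots> = h j (vscale (v 0) unit_vec)"
        using True lin_maps_scale[OF hl, of unit_vec] by (simp add: w_def space_at_ival[OF I])
      finally show ?thesis using True by (simp add: line_scale)
    next
      case False
      then have "h j v = 0"
        using lin_maps_outside[OF hl, of v j] lin_maps_0[OF hl, of j]
        by (cases "v = 0") (auto simp: space_at_ival[OF I] split: if_splits)
      moreover have "g j v = 0" "arrow_at n (ival x y) j v = 0"
        using False by (auto simp: g_def arrow_at_ival[OF I])
      ultimately show ?thesis
        using lin_maps_0[OF arr] by (simp add: coboundary_eq[OF g]) (simp add: g_def)
    qed
    then show "\<exists>g\<in>vertex_maps n (ival x y) Y. coboundary n (ival x y) Y g = h"
      using g by blast
  qed
qed

section \<open>Classification of the indecomposable modules\<close>

definition kernel_rep :: "nat \<Rightarrow> 'k::field rep \<Rightarrow> 'k fam \<Rightarrow> 'k rep" where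
  "kernel_rep n M \<pi> = \<lparr>vspace = (\<lambda>i. {v \<in> space_at n M i. \<pi> i v = 0}),
     arrow = (\<lambda>i v. if v \<in> space_at n M i \<and> \<pi> i v = 0 then arrow_at n M i v else 0)\<rparr>"

lemma space_at_kernel:
  "\<pi> \<in> Hom n M N \<Longrightarrow> space_at n (kernel_rep n M \<pi>) i = {v \<in> space_at n M i. \<pi> i v = 0}"
  using Hom_0[of \<pi> n M N i] by (auto simp: space_at_def kernel_rep_def)

lemma arrow_at_kernel:
  "arrow_at n (kernel_rep n M \<pi>) i v =
     (if v \<in> space_at n M i \<and> \<pi> i v = 0 then arrow_at n M i v else 0)"
  by (auto simp: arrow_at_def kernel_rep_def)

lemma linear_rep_kernel:
  assumes M: "linear_rep n M" and N: "linear_rep n N" and \<pi>: "\<pi> \<in> Hom n M N"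
  shows "linear_rep n (kernel_rep n M \<pi>)"
proof -
  note S = linear_rep_subspace[OF M] and a = linear_rep_arrow[OF M]
  have sub: "kvec.subspace (space_at n (kernel_rep n M \<pi>) i)" for i
    by (rule kvec.subspaceI)
      (auto simp: space_at_kernel[OF \<pi>] linear_rep_0[OF M] Hom_0[OF \<pi>] kvec.subspace_add[OF S]
        kvec.subspace_scale[OF S] Hom_add[OF \<pi>] Hom_scale[OF \<pi>])
  moreover have "arrow_at n (kernel_rep n M \<pi>) i
      \<in> lin_maps (space_at n (kernel_rep n M \<pi>) i) (space_at n (kernel_rep n M \<pi>) (Suc i))" for i
    by (rule lin_mapsI)
      (auto simp: space_at_kernel[OF \<pi>] arrow_at_kernel lin_maps_mem[OF a] Hom_commute[OF \<pi>]
        lin_maps_0[OF linear_rep_arrow[OF N]] kvec.subspace_add[OF S] kvec.subspace_scale[OF S]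
        Hom_add[OF \<pi>] Hom_scale[OF \<pi>] lin_maps_add[OF a] lin_maps_scale[OF a])
  ultimately show ?thesis by (simp add: linear_rep_def)
qed

lemma is_rep_kernel:
  assumes M: "is_rep n M" and N: "linear_rep n N" and \<pi>: "\<pi> \<in> Hom n M N"
  shows "is_rep n (kernel_rep n M \<pi>)"
proof -
  have "fin_dim (space_at n (kernel_rep n M \<pi>) i)" for i
  proof -
    have "fin_dim (space_at n M i)" using M by (simp add: is_rep_iff)
    then show ?thesis by (auto simp: fin_dim_def space_at_kernel[OF \<pi>])
  qed
  then show ?thesis using linear_rep_kernel[OF is_rep_linear[OF M] N \<pi>] by (simp add: is_rep_iff)
qed

text \<open>Each \<open>v\<close> splits as \<open>\<iota> (\<pi> v)\<close> plus a remainder killed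
  by \<open>\<pi>\<close>, and both parts depend naturally on \<open>v\<close>.\<close>

lemma retract_iso_dsum:
  assumes M: "linear_rep n M" and A: "linear_rep n A" and r: "retract n A M \<iota> \<pi>"
  shows "iso_rep n M (dsum A (kernel_rep n M \<pi>))"
proof -
  let ?B = "kernel_rep n M \<pi>"
  have \<iota>: "\<iota> \<in> Hom n A M" and \<pi>: "\<pi> \<in> Hom n M A" using r by (auto simp: retract_def)
  note B = linear_rep_kernel[OF M A \<pi>]
  note S = linear_rep_subspace[OF M] and a = linear_rep_arrow[OF M]
  let ?D = "dsum A ?B"
  note D = linear_rep_dsum[OF A B]
  note SD = linear_rep_subspace[OF D]
  let ?c = "\<lambda>i v. v - \<iota> i (\<pi> i v)"
  have c: "?c i v \<in> space_at n ?B i" if "v \<in> space_at n M i" for i v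
    using that Hom_mem[OF \<iota>] Hom_mem[OF \<pi>] retract_apply[OF r]
    by (simp add: space_at_kernel[OF \<pi>] kvec.subspace_diff[OF S] Hom_diff[OF \<pi> M])
  have Dm: "pair_vec u v \<in> space_at n ?D i \<longleftrightarrow> u \<in> space_at n A i \<and> v \<in> space_at n ?B i" for u v i
    by (simp add: space_at_dsum)
  have Dp: "evens w \<in> space_at n A i" "odds w \<in> space_at n ?B i" "odds w \<in> space_at n M i" "\<pi> i (odds w) = 0"
    if "w \<in> space_at n ?D i" for w i
    using that by (auto simp: space_at_dsum space_at_kernel[OF \<pi>])
  define f where "f = (\<lambda>i v. if v \<in> space_at n M i then pair_vec (\<pi> i v) (?c i v) else 0)"
  define g where "g = (\<lambda>i w. if w \<in> space_at n ?D i then \<iota> i (evens w) + odds w else 0)"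
  have f: "f \<in> Hom n M ?D"
  proof (rule HomI, rule lin_mapsI)
    fix i v assume v: "v \<in> space_at n M i"
    show "f i v \<in> space_at n ?D i" using v by (simp add: f_def Dm Hom_mem[OF \<pi>] c)
    show "f i (vscale k v) = vscale k (f i v)" for k
      using v by (simp add: f_def kvec.subspace_scale[OF S] Hom_scale[OF \<pi>] Hom_mem[OF \<pi>] Hom_scale[OF \<iota>]
          kvec.scale_right_diff_distrib flip: pair_scale)
    have cc: "arrow_at n M i (?c i v) = ?c (Suc i) (arrow_at n M i v)"
      using v by (simp add: lin_maps_diff[OF a S] Hom_mem[OF \<pi>] Hom_mem[OF \<iota>] Hom_commute[OF \<pi>]
          flip: Hom_commute[OF \<iota>])
    show "f (Suc i) (arrow_at n M i v) = arrow_at n ?D i (f i v)"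
      using v c[OF v] cc by (simp add: f_def lin_maps_mem[OF a] arrow_at_dsum Dm Hom_mem[OF \<pi>] Hom_commute[OF \<pi>]
          arrow_at_kernel) (simp add: space_at_kernel[OF \<pi>])
    fix u assume u: "u \<in> space_at n M i"
    show "f i (u + v) = f i u + f i v"
      using u v by (simp add: f_def kvec.subspace_add[OF S] Hom_add[OF \<pi>] Hom_mem[OF \<pi>] Hom_add[OF \<iota>]
         add_diff_add flip: pair_add)
  qed (simp add: f_def)
  have g: "g \<in> Hom n ?D M"
  proof (rule HomI, rule lin_mapsI)
    fix i w assume w: "w \<in> space_at n ?D i"
    note wp = Dp[OF w]
    show "g i w \<in> space_at n M i"
      using w wp by (simp add: g_def kvec.subspace_add[OF S] Hom_mem[OF \<iota>])
    show "g i (vscale k w) = vscale k (g i w)" for k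
      using w wp by (simp add: g_def kvec.subspace_scale[OF SD] evens_scale odds_scale Hom_scale[OF \<iota>]
         kvec.scale_right_distrib)
    show "g (Suc i) (arrow_at n ?D i w) = arrow_at n M i (g i w)"
      using w wp lin_maps_mem[OF linear_rep_arrow[OF D] w]
      by (simp add: g_def lin_maps_add[OF a] Hom_mem[OF \<iota>] Hom_commute[OF \<iota>])
        (simp add: arrow_at_dsum arrow_at_kernel Hom_commute[OF \<iota>])
    fix u assume u: "u \<in> space_at n ?D i"
    show "g i (u + w) = g i u + g i w"
      using u w wp Dp[OF u] by (simp add: g_def kvec.subspace_add[OF SD] evens_add odds_add Hom_add[OF \<iota>])
  qed (simp add: g_def)
  have "comp_hom g f = id_hom n M"
  proof (rule Hom_eqI[OF comp_Hom[OF f g] id_hom_in_Hom[OF M]])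
    fix i v assume v: "v \<in> space_at n M i"
    then show "comp_hom g f i v = id_hom n M i v"
      using Hom_mem[OF f v] by (simp add: id_hom_eq g_def) (simp add: f_def)
  qed
  moreover have "comp_hom f g = id_hom n ?D"
  proof (rule Hom_eqI[OF comp_Hom[OF g f] id_hom_in_Hom[OF D]])
    fix i w assume w: "w \<in> space_at n ?D i"
    note wp = Dp[OF w]
    have "\<pi> i (g i w) = evens w"
      using w wp by (simp add: g_def Hom_add[OF \<pi>] Hom_mem[OF \<iota>] retract_apply[OF r])
    then show "comp_hom f g i w = id_hom n ?D i w"
      using w Hom_mem[OF g w] by (simp add: id_hom_eq f_def) (simp add: g_def)
  qed
  ultimately show ?thesis using f g unfolding iso_rep_def by blast
qed

lemma indecomposable_retract:
  assumes M: "indecomposable n M" and A: "is_rep n A" "\<not> is_zero_rep n A" and r: "retract n A M \<iota> \<pi>"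
  shows "iso_rep n M A"
proof -
  have M': "is_rep n M" using M by (simp add: indecomposable_def)
  have \<iota>: "\<iota> \<in> Hom n A M" and \<pi>: "\<pi> \<in> Hom n M A" and c: "comp_hom \<pi> \<iota> = id_hom n A"
    using r by (auto simp: retract_def)
  note L = is_rep_linear[OF M'] is_rep_linear[OF A(1)]
  have "is_zero_rep n (kernel_rep n M \<pi>)"
    using M A retract_iso_dsum[OF L r] is_rep_kernel[OF M' L(2) \<pi>] by (auto simp: indecomposable_def)
  then have z: "v = 0" if "v \<in> space_at n M i" "\<pi> i v = 0" for i v
    using that by (auto simp: is_zero_rep_iff space_at_kernel[OF \<pi>])
  have "comp_hom \<iota> \<pi> = id_hom n M"
  proof (rule Hom_eqI[OF comp_Hom[OF \<pi> \<iota>] id_hom_in_Hom[OF L(1)]])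
    fix i v assume v: "v \<in> space_at n M i"
    note m = Hom_mem[OF \<iota> Hom_mem[OF \<pi> v]]
    have "v - \<iota> i (\<pi> i v) = 0"
      by (rule z[of _ i]) (use v m Hom_mem[OF \<pi> v] in
        \<open>simp_all add: kvec.subspace_diff[OF linear_rep_subspace[OF L(1)]] Hom_diff[OF \<pi> L(1)] retract_apply[OF r]\<close>)
    then show "comp_hom \<iota> \<pi> i v = id_hom n M i v"
      using v by (simp add: id_hom_eq)
  qed
  then show ?thesis using \<iota> \<pi> c unfolding iso_rep_def by blast
qed

text \<open>If \<open>a\<close> is the first vertex with \<open>M\<^sub>a \<noteq> 0\<close>, every nonzero vector of \<open>M\<^sub>a\<close>
  generates a direct summand.\<close>

lemma indecomposable_is_ival:
  fixes M :: "'k::field rep"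
  assumes M: "indecomposable n M"
  obtains x y where "interval n x y" "iso_rep n M (ival x y)"
proof -
  have M': "is_rep n M" using M by (simp add: indecomposable_def)
  note L = is_rep_linear[OF M']
  define x where "x = (LEAST i. space_at n M i \<noteq> {0})"
  have "\<exists>i. space_at n M i \<noteq> {0}"
    using M by (simp add: indecomposable_def is_zero_rep_iff)
  from LeastI_ex[OF this] have x: "space_at n M x \<noteq> {0}" by (simp add: x_def)
  have xmin: "space_at n M i = {0}" if "i < x" for i
    using not_less_Least[of i "\<lambda>i. space_at n M i \<noteq> {0}"] that by (simp add: x_def)
  obtain v where v: "v \<in> space_at n M x" "v \<noteq> 0"
    using x linear_rep_0[OF L, of x] by fast
  have "x \<in> {1..n}"
  proof (rule ccontr)
    assume "x \<notin> {1..n}"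
    then have "space_at n M x = {0}" unfolding space_at_def by (rule if_not_P)
    then show False using x by blast
  qed
  then have xn: "1 \<le> x" "x \<le> n" by auto
  \<comment> \<open>The first vertex after \<open>x\<close> at which \<open>v\<close> has died;
    \<open>n + 1\<close> always qualifies, its space being zero.\<close>
  define y where "y = (LEAST q. x < q \<and> transport n M x q v = 0)"
  have "transport n M x (Suc n) v = 0"
    using transport_mem[OF L, of x "Suc n" v] xn v by (simp add: space_at_def)
  then have ex: "x < Suc n \<and> transport n M x (Suc n) v = 0" using xn by simp
  have y: "x < y" "transport n M x y v = 0"
    using LeastI[of "\<lambda>q. x < q \<and> transport n M x q v = 0", OF ex] by (auto simp: y_def)
  have "y \<le> Suc n"
    using Least_le[of "\<lambda>q. x < q \<and> transport n M x q v = 0", OF ex] by (simp add: y_def)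
  then have I: "interval n x y" using xn y by (simp add: interval_def)
  obtain z where z: "y = Suc z" "x \<le> z" using y by (cases y) auto
  let ?t = "transport n M x z v"
  have "?t \<noteq> 0"
  proof (cases "x = z")
    case False
    then have "x < z" using z by simp
    then show ?thesis
      using not_less_Least[of z "\<lambda>q. x < q \<and> transport n M x q v = 0"] z by (simp add: y_def)
  qed (use v in simp)
  then obtain m where m: "?t m \<noteq> 0" by (auto simp: fun_eq_iff)
  define \<iota> where "\<iota> = (\<lambda>j a :: 'k kvec. if x \<le> j \<and> j < y \<and> a \<in> line then vscale (a 0) (transport n M x j v) else 0)"
  have \<iota>: "\<iota> \<in> Hom n (ival x y) M"
    unfolding \<iota>_def by (rule Hom_from_ival[OF I L v(1) y(2)])
  \<comment> \<open>A coordinate \<open>m\<close> at which the last nonzero transport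
    \<open>?t\<close> does not vanish gives a linear functional with value 1 on \<open>?t\<close>.
    Pulling it back along the transports to \<open>z\<close> defines the retraction
    \<open>\<pi>\<close>.\<close>
  define \<phi> where "\<phi> u = vscale (u m / ?t m) unit_vec" for u :: "'k kvec"
  have \<phi>_add: "\<phi> (u + w) = \<phi> u + \<phi> w" for u w
    by (simp add: \<phi>_def add_divide_distrib kvec.scale_left_distrib pointwise)
  have \<phi>_scale: "\<phi> (vscale k u) = vscale k (\<phi> u)" for k u
    by (simp add: \<phi>_def vscale_at)
  have \<phi>_line: "\<phi> u \<in> line" for u
    by (simp add: \<phi>_def line_vscale)
  define \<pi> where "\<pi> = (\<lambda>j u. if x \<le> j \<and> j < y \<and> u \<in> space_at n M j then \<phi> (transport n M j z u) else 0)"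
  have \<phi>_0: "\<phi> 0 = 0" using \<phi>_scale[of 0 0] by simp
  have \<pi>: "\<pi> \<in> Hom n M (ival x y)"
  proof (rule HomI, rule lin_mapsI)
    fix j u assume u: "u \<in> space_at n M j"
    show "\<pi> j u \<in> space_at n (ival x y) j"
      by (auto simp: \<pi>_def space_at_ival[OF I] \<phi>_line)
    show "\<pi> j (vscale k u) = vscale k (\<pi> j u)" for k
      using u z kvec.subspace_scale[OF linear_rep_subspace[OF L] u]
      by (auto simp: \<pi>_def transport_scale[OF L] \<phi>_scale)
    show "\<pi> (Suc j) (arrow_at n M j u) = arrow_at n (ival x y) j (\<pi> j u)"
    proof (cases "x \<le> j \<and> Suc j < y")
      case True
      have "transport n M (Suc j) z (arrow_at n M j u) = transport n M j z u"
        using True z transport_comp[of j "Suc j" z n M u] by (simp add: transport_Suc)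
      then show ?thesis
        using True u lin_maps_mem[OF linear_rep_arrow[OF L] u]
        by (simp add: \<pi>_def arrow_at_ival[OF I] \<phi>_line)
    next
      case False
      have "\<pi> (Suc j) (arrow_at n M j u) = 0"
      \<comment> \<open>The arrow entering \<open>x\<close> is where minimality of \<open>x\<close>
        matters: a nonzero image from \<open>x - 1\<close> could be seen by \<open>\<pi>\<close>,
        while the interval module has nothing at \<open>x - 1\<close>.\<close>
      proof (cases "x = Suc j")
        case True
        then have "arrow_at n M j u = 0"
          using u xmin[of j] lin_maps_0[OF linear_rep_arrow[OF L]] by simp
        then show ?thesis using z True by (simp add: \<pi>_def transport_0[OF L] \<phi>_0)
      qed (use False in \<open>auto simp: \<pi>_def\<close>)
      moreover have "arrow_at n (ival x y) j (\<pi> j u) = 0"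
        using False arrow_at_ival[OF I, of j "\<pi> j u"] by auto
      ultimately show ?thesis by simp
    qed
    fix w assume w: "w \<in> space_at n M j"
    show "\<pi> j (w + u) = \<pi> j w + \<pi> j u"
      using u w z kvec.subspace_add[OF linear_rep_subspace[OF L] w u]
      by (auto simp: \<pi>_def transport_add[OF L] \<phi>_add)
  qed (simp add: \<pi>_def)
  have LI: "linear_rep n (ival x y :: 'k rep)" by (rule linear_rep_ival[OF I])
  have "comp_hom \<pi> \<iota> = id_hom n (ival x y)"
  proof (rule Hom_eqI[OF comp_Hom[OF \<iota> \<pi>] id_hom_in_Hom[OF LI]])
    fix j and a :: "'k kvec" assume a: "a \<in> space_at n (ival x y) j"
    show "comp_hom \<pi> \<iota> j a = id_hom n (ival x y) j a"
    proof (cases "x \<le> j \<and> j < y")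
      case True
      then have al: "a \<in> line" using a by (simp add: space_at_ival[OF I])
      have "transport n M j z (transport n M x j v) = ?t"
        using True z by (intro transport_comp) auto
      then have "\<pi> j (\<iota> j a) = \<phi> (vscale (a 0) ?t)"
        using True al z transport_mem[OF L _ v(1), of j] kvec.subspace_scale[OF linear_rep_subspace[OF L]]
        by (simp add: \<pi>_def \<iota>_def transport_scale[OF L])
      also have "\<dots> = a" using m line_scale[OF al] by (simp add: \<phi>_def vscale_at)
      finally show ?thesis using a by (simp add: id_hom_eq)
    next
      case False
      then have "a = 0" using a by (auto simp add: space_at_ival[OF I])
      then show ?thesis using a by (simp add: id_hom_eq Hom_0[OF \<iota>] Hom_0[OF \<pi>])
    qed
  qed
  then have r: "retract n (ival x y) M \<iota> \<pi>" using \<iota> \<pi> by (simp add: retract_def)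
  have "\<not> is_zero_rep n (ival x y :: 'k rep)"
  proof
    assume "is_zero_rep n (ival x y :: 'k rep)"
    then have "(unit_vec :: 'k kvec) \<in> {0}"
      using space_at_ival[OF I, of x, where 'a='k] y(1) by (simp add: is_zero_rep_iff)
    then show False by simp
  qed
  then show thesis
    using that[OF I] indecomposable_retract[OF M is_rep_ival[OF I] _ r] by blast
qed

lemma End_ival:
  fixes e :: "'k::field fam"
  assumes I: "interval n x y" and e: "e \<in> Hom n (ival x y) (ival x y)"
  obtains c where "\<And>j v. v \<in> space_at n (ival x y) j \<Longrightarrow> e j v = vscale c v"
proof -
  have xs: "(unit_vec :: 'k kvec) \<in> space_at n (ival x y) x"
    using I by (simp add: space_at_ival) (simp add: interval_def)
  note L = linear_rep_ival[OF I, where 'a='k]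
  let ?a = "e x unit_vec"
  have a: "?a \<in> space_at n (ival x y) x" by (rule Hom_mem[OF e xs])
  then have al: "?a \<in> line" using I by (simp add: space_at_ival) (simp add: interval_def)
  have "e j v = vscale (?a 0) v" if v: "v \<in> space_at n (ival x y) j" for j v
  proof (cases "x \<le> j \<and> j < y")
    case True
    then have vl: "v \<in> line" using v by (simp add: space_at_ival[OF I])
    have t: "transport n (ival x y) x j w = w" if "w \<in> space_at n (ival x y) x" for w :: "'k kvec"
      using True transport_ival[OF I that, of j] by (cases "x = j") auto
    have "e j unit_vec = ?a"
      using Hom_transport[OF e L xs, of j] True t[OF xs] t[OF a] by simp
    then have "e j (vscale (v 0) unit_vec) = vscale (v 0) ?a"
      using Hom_scale[OF e, of unit_vec j] True by (simp add: space_at_ival[OF I])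
    also have "\<dots> = vscale (v 0) (vscale (?a 0) unit_vec)" by (simp add: line_scale[OF al])
    also have "\<dots> = vscale (?a 0) (vscale (v 0) unit_vec)" by (simp add: mult.commute)
    finally show ?thesis by (simp add: line_scale[OF vl])
  next
    case False
    then have "v = 0" using v by (auto simp add: space_at_ival[OF I])
    then show ?thesis by (simp add: Hom_0[OF e])
  qed
  then show thesis using that by blast
qed

text \<open>All endomorphisms are scalars. The idempotents belonging to \<open>A\<close> and
  \<open>B\<close>, carried over to the interval module, are therefore scalars \<open>a\<close> and
  \<open>b\<close> with \<open>a * b = 0\<close>, and a vanishing scalar makes its summand
  zero.\<close>

lemma indecomposable_ival:
  assumes I: "interval n x y"
  shows "indecomposable n (ival x y :: 'k::field rep)"
  unfolding indecomposable_def
proof (intro conjI allI impI)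
  let ?M = "ival x y :: 'k rep"
  show "is_rep n ?M" by (rule is_rep_ival[OF I])
  have xs: "(unit_vec :: 'k kvec) \<in> space_at n ?M x"
    using I by (simp add: space_at_ival) (simp add: interval_def)
  show "\<not> is_zero_rep n ?M"
  proof
    assume "is_zero_rep n ?M"
    then have "(unit_vec :: 'k kvec) \<in> {0}"
      using xs unfolding is_zero_rep_iff by metis
    then show False by simp
  qed
  fix A B :: "'k rep"
  assume AB: "is_rep n A \<and> is_rep n B \<and> iso_rep n ?M (dsum A B)"
  let ?D = "dsum A B"
  have A: "linear_rep n A" and B: "linear_rep n B" using AB by (auto simp: is_rep_linear)
  obtain f g where f: "f \<in> Hom n ?M ?D" and g: "g \<in> Hom n ?D ?M"
    and gf: "comp_hom g f = id_hom n ?M" and fg: "comp_hom f g = id_hom n ?D"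
    using AB unfolding iso_rep_def by blast
  have fg': "f i (g i v) = v" if "v \<in> space_at n ?D i" for i v
    using retract_apply[of n ?D ?M g f v i] f g fg that by (simp add: retract_def)
  obtain \<iota>A \<pi>A \<iota>B \<pi>B where rA: "retract n A ?D \<iota>A \<pi>A" and rB: "retract n B ?D \<iota>B \<pi>B"
    and o: "comp_hom \<pi>A \<iota>B = 0"
    using biproduct_dsum[OF A B] unfolding biproduct_def by blast
  have hA: "\<iota>A \<in> Hom n A ?D" "\<pi>A \<in> Hom n ?D A" and hB: "\<iota>B \<in> Hom n B ?D" "\<pi>B \<in> Hom n ?D B"
    using rA rB by (auto simp: retract_def)
  have o': "\<pi>A i (\<iota>B i v) = 0" for i v
    using fun_cong[OF fun_cong[OF o, of i], of v] by simp
  have zero: "is_zero_rep n C"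
    if r: "retract n C ?D \<iota> \<pi>" and C: "linear_rep n C"
      and z: "\<And>j v. v \<in> space_at n ?M j \<Longrightarrow> g j (\<iota> j (\<pi> j (f j v))) = 0" for C :: "'k rep" and \<iota> \<pi>
    unfolding is_zero_rep_iff
  proof
    fix i
    have h: "\<iota> \<in> Hom n C ?D" "\<pi> \<in> Hom n ?D C" using r by (auto simp: retract_def)
    have "v = 0" if v: "v \<in> space_at n C i" for v
    proof -
      let ?w = "g i (\<iota> i v)"
      have "f i (g i (\<iota> i (\<pi> i (f i ?w)))) = \<iota> i v"
        using v Hom_mem[OF h(1) v] by (simp add: fg' retract_apply[OF r])
      then have "\<iota> i v = 0"
        using z[OF Hom_mem[OF g Hom_mem[OF h(1) v]]] Hom_0[OF f] by metis
      then show "v = 0" using retract_apply[OF r v] Hom_0[OF h(2)] by metis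
    qed
    then show "space_at n C i = {0}" using linear_rep_0[OF C] by blast
  qed
  obtain a where a: "\<And>j v. v \<in> space_at n ?M j \<Longrightarrow> g j (\<iota>A j (\<pi>A j (f j v))) = vscale a v"
    using End_ival[OF I comp_Hom[OF comp_Hom[OF comp_Hom[OF f hA(2)] hA(1)] g]] by auto
  obtain b where b: "\<And>j v. v \<in> space_at n ?M j \<Longrightarrow> g j (\<iota>B j (\<pi>B j (f j v))) = vscale b v"
    using End_ival[OF I comp_Hom[OF comp_Hom[OF comp_Hom[OF f hB(2)] hB(1)] g]] by auto
  let ?u = "vscale b (unit_vec :: 'k kvec)"
  have "?u \<in> space_at n ?M x"
    using kvec.subspace_scale[OF linear_rep_subspace[OF linear_rep_ival[OF I]] xs] .
  then have "vscale a ?u = g x (\<iota>A x (\<pi>A x (f x ?u)))" using a by simp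
  also have "\<dots> = g x (\<iota>A x (\<pi>A x (f x (g x (\<iota>B x (\<pi>B x (f x unit_vec)))))))" using b[OF xs] by simp
  also have "\<dots> = 0"
    using fg'[OF Hom_mem[OF hB(1) Hom_mem[OF hB(2) Hom_mem[OF f xs]]]] o' Hom_0[OF hA(1)] Hom_0[OF g] by simp
  finally have "a = 0 \<or> b = 0" by simp
  then show "is_zero_rep n A \<or> is_zero_rep n B"
    using zero[OF rA A] zero[OF rB B] a b by auto
qed

lemma indecomposable_iso:
  assumes "indecomposable n M" "is_rep n N" "iso_rep n N M"
  shows "indecomposable n N"
proof -
  have M: "is_rep n M" using assms(1) by (simp add: indecomposable_def)
  have "\<not> is_zero_rep n N"
  proof
    assume z: "is_zero_rep n N"
    obtain \<iota> \<pi> where r: "retract n M N \<iota> \<pi>"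
      using iso_rep_retract[OF iso_rep_sym[OF assms(3)]] by blast
    then have h: "\<iota> \<in> Hom n M N" "\<pi> \<in> Hom n N M" by (auto simp: retract_def)
    have "v = 0" if "v \<in> space_at n M i" for i v
    proof -
      have "\<iota> i v = 0" using z Hom_mem[OF h(1) that] by (auto simp: is_zero_rep_iff)
      then show ?thesis using retract_apply[OF r that] Hom_0[OF h(2)] by metis
    qed
    then have "is_zero_rep n M"
      using linear_rep_0[OF is_rep_linear[OF M]] unfolding is_zero_rep_iff by blast
    then show False using assms(1) by (simp add: indecomposable_def)
  qed
  then show ?thesis
    using assms iso_rep_trans[OF iso_rep_sym[OF assms(3)]] unfolding indecomposable_def by blast
qed

definition is_ival :: "nat \<Rightarrow> 'k::field rep \<Rightarrow> nat \<Rightarrow> nat \<Rightarrow> bool" where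
  "is_ival n M x y \<longleftrightarrow> interval n x y \<and> is_rep n M \<and> iso_rep n M (ival x y)"

lemma indecomposable_iff: "indecomposable n M \<longleftrightarrow> (\<exists>x y. is_ival n M x y)"
proof
  assume M: "indecomposable n M"
  then have "is_rep n M" by (simp add: indecomposable_def)
  moreover obtain x y where "interval n x y" "iso_rep n M (ival x y)"
    using indecomposable_is_ival[OF M] .
  ultimately show "\<exists>x y. is_ival n M x y"
    unfolding is_ival_def by blast
next
  assume "\<exists>x y. is_ival n M x y"
  then show "indecomposable n M"
    using indecomposable_iso[OF indecomposable_ival] by (auto simp: is_ival_def)
qed

lemma is_ival_ival: "interval n x y \<Longrightarrow> is_ival n (ival x y) x y"
  by (simp add: is_ival_def is_rep_ival iso_rep_refl linear_rep_ival)

lemma proj_rep_iso: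
  fixes k n :: nat
  assumes "k \<in> {1..n}"
  shows "iso_rep n (proj_rep k :: 'k::field rep) (ival k (n + 1))"
proof -
  have I: "interval n k (n + 1)" using assms by (simp add: interval_def)
  note L = linear_rep_ival[OF I, where 'a='k]
  have s: "space_at n (proj_rep k :: 'k rep) j = space_at n (ival k (n + 1)) j" for j
    by (auto simp: space_at_def proj_rep_def ival_def line_def)
  have "arrow_at n (proj_rep k :: 'k rep) j v = arrow_at n (ival k (n + 1)) j v" for j v
    by (auto simp: arrow_at_def proj_rep_def ival_def line_def Let_def)
  then have "id_hom n (ival k (n + 1)) \<in> Hom n (proj_rep k :: 'k rep) (ival k (n + 1))"
    "id_hom n (ival k (n + 1)) \<in> Hom n (ival k (n + 1)) (proj_rep k :: 'k rep)"
    using id_hom_in_Hom[OF L] by (auto simp: Hom_iff vertex_maps_iff s)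
  moreover have "id_hom n (proj_rep k :: 'k rep) = id_hom n (ival k (n + 1))"
    by (simp add: id_hom_eq s)
  moreover have "comp_hom (id_hom n (ival k (n + 1))) (id_hom n (ival k (n + 1) :: 'k rep)) = id_hom n (ival k (n + 1))"
    using id_comp_Hom[OF id_hom_in_Hom[OF L]] .
  ultimately show ?thesis unfolding iso_rep_def by metis
qed

section \<open>Perpendicular categories of interval modules\<close>

definition transport_iso :: "nat \<Rightarrow> 'k::field rep \<Rightarrow> nat \<Rightarrow> nat \<Rightarrow> bool" where
  "transport_iso n Y p q \<longleftrightarrow> bij_betw (transport n Y p q) (space_at n Y p) (space_at n Y q)"

text \<open>Symmetrised in the two vertices so that it becomes an equivalence relation and paths may
  run along edges in either direction.\<close>

definition conn :: "nat \<Rightarrow> 'k::field rep \<Rightarrow> nat \<Rightarrow> nat \<Rightarrow> bool"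
  where "conn n Y p q \<longleftrightarrow> transport_iso n Y (min p q) (max p q)"

lemma transport_iso_iff:
  assumes Y: "linear_rep n Y" and pq: "p \<le> q"
  shows "transport_iso n Y p q \<longleftrightarrow> transport_inj n Y p q \<and> transport_surj n Y p q"
proof
  assume "transport_iso n Y p q"
  then have i: "inj_on (transport n Y p q) (space_at n Y p)"
    and s: "transport n Y p q ` space_at n Y p = space_at n Y q"
    by (auto simp: transport_iso_def bij_betw_def)
  have "u = 0" if "u \<in> space_at n Y p" "transport n Y p q u = 0" for u
    using inj_onD[OF i, of u 0] that transport_0[OF Y pq] linear_rep_0[OF Y] by auto
  moreover have "\<exists>u\<in>space_at n Y p. transport n Y p q u = v" if "v \<in> space_at n Y q" for v
    using that unfolding s[symmetric] by blast
  ultimately show "transport_inj n Y p q \<and> transport_surj n Y p q"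
    unfolding transport_inj_def transport_surj_def by blast
next
  assume ij: "transport_inj n Y p q \<and> transport_surj n Y p q"
  have "inj_on (transport n Y p q) (space_at n Y p)"
  proof (rule inj_onI)
    fix u v assume uv: "u \<in> space_at n Y p" "v \<in> space_at n Y p" "transport n Y p q u = transport n Y p q v"
    then have "transport n Y p q (u - v) = 0" by (simp add: transport_diff[OF Y pq])
    then have "u - v = 0"
      using ij kvec.subspace_diff[OF linear_rep_subspace[OF Y] uv(1,2)] transport_injD by blast
    then show "u = v" by simp
  qed
  moreover have "transport n Y p q ` space_at n Y p = space_at n Y q"
  proof
    show "transport n Y p q ` space_at n Y p \<subseteq> space_at n Y q"
      using transport_mem[OF Y pq] by blast
    show "space_at n Y q \<subseteq> transport n Y p q ` space_at n Y p"
    proof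
      fix v assume "v \<in> space_at n Y q"
      then obtain u where "u \<in> space_at n Y p" "transport n Y p q u = v"
        using ij unfolding transport_surj_def by blast
      then show "v \<in> transport n Y p q ` space_at n Y p" by blast
    qed
  qed
  ultimately show "transport_iso n Y p q" by (simp add: transport_iso_def bij_betw_def)
qed

lemma conn_iff:
  "linear_rep n Y \<Longrightarrow> p \<le> q \<Longrightarrow> conn n Y p q \<longleftrightarrow> transport_inj n Y p q \<and> transport_surj n Y p q"
  by (simp add: conn_def transport_iso_iff)

lemma conn_refl: "conn n Y p p"
proof -
  have "transport n Y p p = id" by (simp add: fun_eq_iff)
  then show ?thesis by (simp add: conn_def transport_iso_def)
qed

lemma conn_sym: "conn n Y p q \<Longrightarrow> conn n Y q p"
  by (simp add: conn_def min.commute max.commute)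

lemma transport_iso_two_of_three:
  assumes Y: "linear_rep n Y" and o: "p \<le> q" "q \<le> r"
  shows "transport_iso n Y p q \<Longrightarrow> transport_iso n Y q r \<longleftrightarrow> transport_iso n Y p r"
    and "transport_iso n Y q r \<Longrightarrow> transport_iso n Y p q \<longleftrightarrow> transport_iso n Y p r"
proof -
  have c: "transport n Y p r = transport n Y q r \<circ> transport n Y p q"
    by (rule ext) (simp add: transport_comp[OF o])
  show "transport_iso n Y p q \<Longrightarrow> transport_iso n Y q r \<longleftrightarrow> transport_iso n Y p r"
    unfolding transport_iso_def c by (rule bij_betw_comp_iff)
  show "transport_iso n Y q r \<Longrightarrow> transport_iso n Y p q \<longleftrightarrow> transport_iso n Y p r"
    unfolding transport_iso_def c
    by (rule bij_betw_comp_iff2) (use transport_mem[OF Y o(1)] in auto)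
qed

text \<open>In every order of the three vertices the transports involved are two maps and their
  composite, and bijectivity of two of them gives that of the third.\<close>

lemma conn_trans:
  assumes Y: "linear_rep n Y" and pq: "conn n Y p q" and qr: "conn n Y q r"
  shows "conn n Y p r"
proof -
  note t = transport_iso_two_of_three[OF Y]
  consider "p \<le> q" "q \<le> r" | "p \<le> r" "r \<le> q" | "q \<le> p" "p \<le> r"
    | "q \<le> r" "r \<le> p" | "r \<le> p" "p \<le> q" | "r \<le> q" "q \<le> p"
    by linarith
  then show ?thesis
  proof cases
    case 1 then show ?thesis using pq qr t(1)[of p q r] by (simp add: conn_def)
  next
    case 2 then show ?thesis using pq qr t(2)[of p r q] by (simp add: conn_def)
  next
    case 3 then show ?thesis using pq qr t(1)[of q p r] by (simp add: conn_def)
  next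
    case 4 then show ?thesis using pq qr t(1)[of q r p] by (simp add: conn_def)
  next
    case 5 then show ?thesis using pq qr t(2)[of r p q] by (simp add: conn_def)
  next
    case 6 then show ?thesis using pq qr t(1)[of r q p] by (simp add: conn_def)
  qed
qed

lemma perp_dsum_list_iff:
  assumes E: "\<And>j. j \<in> set js \<Longrightarrow> is_ival n (E j) (a j) (b j)"
  shows "Y \<in> perp n (dsum_list (map E js)) \<longleftrightarrow> is_rep n Y \<and> (\<forall>j\<in>set js. conn n Y (a j) (b j))"
proof (cases "is_rep n Y")
  case True
  note Y = is_rep_linear[OF True]
  have L: "linear_rep n M" if "M \<in> set (map E js)" for M
    using that E by (auto simp: is_ival_def is_rep_linear)
  have "Ext_vanishes n 0 (E j) Y \<and> Ext_vanishes n 1 (E j) Y \<longleftrightarrow> conn n Y (a j) (b j)"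
    if "j \<in> set js" for j
  proof -
    have I: "interval n (a j) (b j)" and i: "iso_rep n (E j) (ival (a j) (b j))"
      using E[OF that] by (auto simp: is_ival_def)
    have "a j \<le> b j" using I by (simp add: interval_def)
    moreover have "linear_rep n (E j)" using L that by auto
    ultimately show ?thesis
      using Ext_vanishes_iso[OF i _ linear_rep_ival[OF I] Y]
      by (simp add: Hom_ival_vanishes_iff[OF I Y] Ext_ival_vanishes_iff[OF I Y] conn_iff[OF Y])
  qed
  moreover have "Ext_vanishes n k (dsum_list (map E js)) Y \<longleftrightarrow> (\<forall>j\<in>set js. Ext_vanishes n k (E j) Y)"
    if "k \<in> {0, 1}" for k
    using Ext_vanishes_dsum_list[OF Y that L, of "map E js"] by simp
  then have "Ext_vanishes n 0 (dsum_list (map E js)) Y \<longleftrightarrow> (\<forall>j\<in>set js. Ext_vanishes n 0 (E j) Y)"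
    "Ext_vanishes n 1 (dsum_list (map E js)) Y \<longleftrightarrow> (\<forall>j\<in>set js. Ext_vanishes n 1 (E j) Y)"
    by simp_all
  ultimately show ?thesis
    using True unfolding perp_def by blast
qed (simp add: perp_def)

section \<open>Transport, Hom and Ext for interval modules in terms of end points\<close>

lemma transport_retract:
  assumes r: "retract n N M \<iota> \<pi>" and N: "linear_rep n N" and M: "linear_rep n M" and pq: "p \<le> q"
  shows "transport_inj n M p q \<Longrightarrow> transport_inj n N p q"
    and "transport_surj n M p q \<Longrightarrow> transport_surj n N p q"
proof -
  have \<iota>: "\<iota> \<in> Hom n N M" and \<pi>: "\<pi> \<in> Hom n M N" using r by (auto simp: retract_def)
  note t = retract_apply[OF r] Hom_mem[OF \<iota>] Hom_mem[OF \<pi>]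
  assume "transport_inj n M p q"
  then show "transport_inj n N p q"
    unfolding transport_inj_def
    by (metis Hom_transport[OF \<iota> N _ pq] t Hom_0[OF \<iota>] Hom_0[OF \<pi>])
next
  have \<iota>: "\<iota> \<in> Hom n N M" and \<pi>: "\<pi> \<in> Hom n M N" using r by (auto simp: retract_def)
  note t = retract_apply[OF r] Hom_mem[OF \<iota>] Hom_mem[OF \<pi>]
  assume "transport_surj n M p q"
  then show "transport_surj n N p q"
    unfolding transport_surj_def by (metis Hom_transport[OF \<pi> M _ pq] t)
qed

lemma transport_ival_iff:
  fixes z w :: nat
  assumes I: "interval n z w" and pq: "p < q"
  shows "transport_inj n (ival z w :: 'k::field rep) p q \<longleftrightarrow> \<not> (z \<le> p \<and> p < w \<and> w \<le> q)"
    and "transport_surj n (ival z w :: 'k rep) p q \<longleftrightarrow> \<not> (p < z \<and> z \<le> q \<and> q < w)"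
proof -
  note s = space_at_ival[OF I, where 'a='k]
  have t: "transport n (ival z w) p q v = (if q < w then v else 0)"
    if "v \<in> space_at n (ival z w) p" for v :: "'k kvec"
    by (rule transport_ival[OF I that pq])
  show "transport_inj n (ival z w :: 'k rep) p q \<longleftrightarrow> \<not> (z \<le> p \<and> p < w \<and> w \<le> q)"
  proof
    assume i: "transport_inj n (ival z w :: 'k rep) p q"
    show "\<not> (z \<le> p \<and> p < w \<and> w \<le> q)"
    proof
      assume h: "z \<le> p \<and> p < w \<and> w \<le> q"
      then have u: "(unit_vec :: 'k kvec) \<in> space_at n (ival z w) p" by (simp add: s)
      then have "(unit_vec :: 'k kvec) = 0" using transport_injD[OF i u] t[OF u] h by simp
      then show False by simp
    qed
  next
    assume "\<not> (z \<le> p \<and> p < w \<and> w \<le> q)"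
    then show "transport_inj n (ival z w :: 'k rep) p q"
      unfolding transport_inj_def using t by (auto simp: s split: if_splits)
  qed
  show "transport_surj n (ival z w :: 'k rep) p q \<longleftrightarrow> \<not> (p < z \<and> z \<le> q \<and> q < w)"
  proof
    assume i: "transport_surj n (ival z w :: 'k rep) p q"
    show "\<not> (p < z \<and> z \<le> q \<and> q < w)"
    proof
      assume h: "p < z \<and> z \<le> q \<and> q < w"
      then have "(unit_vec :: 'k kvec) \<in> space_at n (ival z w) q" by (simp add: s)
      then obtain u :: "'k kvec" where u: "u \<in> space_at n (ival z w) p" "transport n (ival z w) p q u = unit_vec"
        using i unfolding transport_surj_def by blast
      then have "u = 0" using h by (simp add: s)
      then have "(unit_vec :: 'k kvec) = 0" using u t[OF u(1)] by auto
      then show False by simp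
    qed
  next
    assume h: "\<not> (p < z \<and> z \<le> q \<and> q < w)"
    show "transport_surj n (ival z w :: 'k rep) p q"
      unfolding transport_surj_def
    proof
      fix v :: "'k kvec" assume v: "v \<in> space_at n (ival z w) q"
      show "\<exists>u\<in>space_at n (ival z w) p. transport n (ival z w) p q u = v"
      proof (cases "z \<le> q \<and> q < w")
        case True
        then have "v \<in> space_at n (ival z w) p" using v h pq by (simp add: s)
        then show ?thesis using t True by (intro bexI[of _ v]) auto
      next
        case False
        then have "v = 0" using v by (auto simp: s)
        moreover have "0 \<in> space_at n (ival z w :: 'k rep) p" by (simp add: s)
        ultimately show ?thesis using t by (intro bexI[of _ 0]) auto
      qed
    qed
  qed
qed

lemma transport_is_ival_iff:
  assumes N: "is_ival n N z w" and pq: "p < q"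
  shows "transport_inj n N p q \<longleftrightarrow> \<not> (z \<le> p \<and> p < w \<and> w \<le> q)"
    and "transport_surj n N p q \<longleftrightarrow> \<not> (p < z \<and> z \<le> q \<and> q < w)"
proof -
  have I: "interval n z w" and L: "linear_rep n N" and i: "iso_rep n N (ival z w)"
    using N by (auto simp: is_ival_def is_rep_linear)
  obtain \<iota> \<pi> \<iota>' \<pi>' where r: "retract n N (ival z w) \<iota> \<pi>" "retract n (ival z w) N \<iota>' \<pi>'"
    using iso_rep_retract[OF i] iso_rep_retract[OF iso_rep_sym[OF i]] by blast
  note t = transport_retract[OF r(1) L linear_rep_ival[OF I] less_imp_le[OF pq]]
    transport_retract[OF r(2) linear_rep_ival[OF I] L less_imp_le[OF pq]]
  show "transport_inj n N p q \<longleftrightarrow> \<not> (z \<le> p \<and> p < w \<and> w \<le> q)"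
    using t transport_ival_iff(1)[OF I pq] by blast
  show "transport_surj n N p q \<longleftrightarrow> \<not> (p < z \<and> z \<le> q \<and> q < w)"
    using t transport_ival_iff(2)[OF I pq] by blast
qed

lemma Ext_vanishes_is_ival_iff:
  assumes M: "is_ival n M x y" and Y: "linear_rep n Y"
  shows "Ext_vanishes n 0 M Y \<longleftrightarrow> transport_inj n Y x y"
    and "Ext_vanishes n 1 M Y \<longleftrightarrow> transport_surj n Y x y"
proof -
  have I: "interval n x y" and L: "linear_rep n M" and i: "iso_rep n M (ival x y)"
    using M by (auto simp: is_ival_def is_rep_linear)
  note e = Ext_vanishes_iso[OF i L linear_rep_ival[OF I] Y]
  show "Ext_vanishes n 0 M Y \<longleftrightarrow> transport_inj n Y x y" "Ext_vanishes n 1 M Y \<longleftrightarrow> transport_surj n Y x y"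
    using e by (simp_all add: Hom_ival_vanishes_iff[OF I Y] Ext_ival_vanishes_iff[OF I Y])
qed

text \<open>The two obstructions exclude each other, one demanding \<open>w \<le> y\<close> and the
  other \<open>y < w\<close>. No cancellation can occur in the Euler form, so its vanishing detects
  both.\<close>

lemma Ext_vanishes_ivals_iff:
  assumes M: "is_ival n M x y" and N: "is_ival n N z w"
  shows "Ext_vanishes n 0 M N \<longleftrightarrow> \<not> (z \<le> x \<and> x < w \<and> w \<le> y)"
    and "Ext_vanishes n 1 M N \<longleftrightarrow> \<not> (x < z \<and> z \<le> y \<and> y < w)"
    and "Ext_vanishes n 0 M N \<and> Ext_vanishes n 1 M N \<longleftrightarrow> ind z w x = ind z w y"
proof -
  have xy: "x < y" using M by (simp add: is_ival_def interval_def)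
  have L: "linear_rep n N" using N by (simp add: is_ival_def is_rep_linear)
  show *: "Ext_vanishes n 0 M N \<longleftrightarrow> \<not> (z \<le> x \<and> x < w \<and> w \<le> y)"
    "Ext_vanishes n 1 M N \<longleftrightarrow> \<not> (x < z \<and> z \<le> y \<and> y < w)"
    using Ext_vanishes_is_ival_iff[OF M L] transport_is_ival_iff[OF N xy] by simp_all
  show "Ext_vanishes n 0 M N \<and> Ext_vanishes n 1 M N \<longleftrightarrow> ind z w x = ind z w y"
    using xy by (auto simp: * ind_def)
qed

lemma conn_is_ival_iff:
  assumes N: "is_ival n N z w" and "p < q"
  shows "conn n N p q \<longleftrightarrow> ind z w p = ind z w q"
proof -
  have L: "linear_rep n N" using N by (simp add: is_ival_def is_rep_linear)
  show ?thesis
    using assms(2) by (auto simp: conn_iff[OF L] transport_is_ival_iff[OF N] ind_def)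
qed

section \<open>Relatively projective objects\<close>

text \<open>\<open>\<rho>\<close> projects along \<open>I\<close> onto a complement. Its image is a
  model of the quotient by \<open>I\<close> that is again a subspace of sequences, as the spaces of
  a representation must be.\<close>

lemma complement_projection:
  assumes I: "kvec.subspace I" and Z: "kvec.subspace Z" and IZ: "I \<subseteq> Z"
  obtains \<rho> where "\<rho> \<in> lin_maps Z Z" "\<And>z. z \<in> Z \<Longrightarrow> z - \<rho> z \<in> I" "\<And>z. z \<in> I \<Longrightarrow> \<rho> z = 0"
proof -
  interpret kk: vector_space_pair "vscale :: 'a::field \<Rightarrow> _" "vscale :: 'a \<Rightarrow> _" ..
  obtain B where B: "B \<subseteq> I" "kvec.independent B" "I \<subseteq> kvec.span B"
    using kvec.maximal_independent_subset .
  obtain B' where B': "B \<subseteq> B'" "B' \<subseteq> Z" "kvec.independent B'" "Z \<subseteq> kvec.span B'"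
    using kvec.maximal_independent_subset_extend[OF order_trans[OF B(1) IZ] B(2)] .
  obtain g where g: "Vector_Spaces.linear vscale vscale g" "\<forall>x\<in>B'. g x = (if x \<in> B then 0 else x)"
    using kk.linear_independent_extend[OF B'(3), of "\<lambda>x. if x \<in> B then 0 else x"] by auto
  have gadd: "g (u + v) = g u + g v" and gscale: "g (vscale c v) = vscale c (g v)" for u v c
    using g(1) unfolding Vector_Spaces.linear_iff by auto
  have d: "z - g z \<in> I" if "z \<in> Z" for z
  proof -
    have g0: "g 0 = 0" using gscale[of 0 0] by simp
    have "z \<in> kvec.span B'" using that B' by blast
    then show ?thesis
    proof (induction rule: kvec.span_induct_alt)
      case base
      show ?case using I by (simp add: g0 kvec.subspace_0)
    next
      case (step c x y)
      have "x - g x \<in> I" using step(1) g(2) B(1) I by (cases "x \<in> B") (auto simp: kvec.subspace_0)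
      then have "vscale c (x - g x) + (y - g y) \<in> I"
        using step I by (simp add: kvec.subspace_add kvec.subspace_scale)
      then show ?case by (simp add: gadd gscale kvec.scale_right_diff_distrib algebra_simps)
    qed
  qed
  have z: "g z = 0" if "z \<in> I" for z
  proof (rule kk.linear_eq_0_on_span[OF g(1)])
    show "z \<in> kvec.span B" using that B(3) by blast
    fix x assume "x \<in> B"
    then show "g x = 0" using g(2) B'(1) by (metis subsetD)
  qed
  have gZ: "g z \<in> Z" if "z \<in> Z" for z
  proof -
    have "z - (z - g z) \<in> Z"
      by (rule kvec.subspace_diff[OF Z that]) (use d[OF that] IZ in blast)
    then show ?thesis by (simp only: diff_diff_eq2 add_diff_cancel_left')
  qed
  show thesis
  proof (rule that[of "\<lambda>z. if z \<in> Z then g z else 0"])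
    show "(\<lambda>z. if z \<in> Z then g z else 0) \<in> lin_maps Z Z"
      by (rule lin_mapsI) (auto simp: gZ gadd gscale kvec.subspace_add[OF Z] kvec.subspace_scale[OF Z])
    show "w - (if w \<in> Z then g w else 0) \<in> I" if "w \<in> Z" for w
      unfolding if_P[OF that] by (rule d[OF that])
    show "(if w \<in> Z then g w else 0) = 0" if "w \<in> I" for w
      using z[OF that] by (simp only: if_cancel)
  qed
qed

definition perp_edges :: "nat \<Rightarrow> (nat \<times> nat) set \<Rightarrow> 'k::field rep set" where
  "perp_edges n R = {Y. is_rep n Y \<and> (\<forall>(p, q)\<in>R. conn n Y p q)}"

text \<open>The cokernel of \<open>g\<close>, called \<open>W\<close> in the proof, belongs to \<open>perp_edges n R\<close>, hence is zero.\<close>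

lemma epi_in_surj:
  assumes R: "\<And>p q. (p, q) \<in> R \<Longrightarrow> p \<le> q" and epi: "epi_in n (perp_edges n R) Y Z g"
    and v: "v \<in> space_at n Z i"
  shows "\<exists>u\<in>space_at n Y i. g i u = v"
proof -
  have YC: "Y \<in> perp_edges n R" and ZC: "Z \<in> perp_edges n R" and g: "g \<in> Hom n Y Z"
    and mono: "\<And>W h h'. W \<in> perp_edges n R \<Longrightarrow> h \<in> Hom n Z W \<Longrightarrow> h' \<in> Hom n Z W \<Longrightarrow>
      comp_hom h g = comp_hom h' g \<Longrightarrow> h = h'"
    using epi unfolding epi_in_def by blast+
  have Y: "linear_rep n Y" and Z: "linear_rep n Z" and Zr: "is_rep n Z"
    using YC ZC by (auto simp: perp_edges_def is_rep_linear)
  note YS = linear_rep_subspace[OF Y] and ZS = linear_rep_subspace[OF Z] and arr = linear_rep_arrow[OF Z]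
  let ?I = "\<lambda>i. g i ` space_at n Y i"
  have sub: "kvec.subspace (?I i)" for i
  proof (rule kvec.subspaceI)
    show "0 \<in> ?I i" using Hom_0[OF g] linear_rep_0[OF Y] by (metis imageI)
  next
    fix u v assume "u \<in> ?I i" "v \<in> ?I i"
    then show "u + v \<in> ?I i"
      using Hom_add[OF g] kvec.subspace_add[OF YS] by (smt (verit) imageE imageI)
  next
    fix c v assume "v \<in> ?I i"
    then show "vscale c v \<in> ?I i"
      using Hom_scale[OF g] kvec.subspace_scale[OF YS] by (smt (verit) imageE imageI)
  qed
  have "\<exists>\<rho>. \<rho> \<in> lin_maps (space_at n Z i) (space_at n Z i) \<and>
      (\<forall>z\<in>space_at n Z i. z - \<rho> z \<in> ?I i) \<and> (\<forall>z\<in>?I i. \<rho> z = 0)" for i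
    using complement_projection[OF sub ZS, of i] Hom_mem[OF g] by (metis image_subsetI)
  then obtain \<rho> where \<rho>: "\<And>i. \<rho> i \<in> lin_maps (space_at n Z i) (space_at n Z i)"
    and \<rho>I: "\<And>i z. z \<in> space_at n Z i \<Longrightarrow> z - \<rho> i z \<in> ?I i" and \<rho>0: "\<And>i z. z \<in> ?I i \<Longrightarrow> \<rho> i z = 0"
    by metis
  \<comment> \<open>The complements need not be stable under the arrows of \<open>Z\<close>;
    following each arrow by \<open>\<rho>\<close> gives the arrows of the quotient.\<close>
  define W where "W = \<lparr>vspace = (\<lambda>i. \<rho> i ` space_at n Z i),
    arrow = (\<lambda>i w. if w \<in> \<rho> i ` space_at n Z i then \<rho> (Suc i) (arrow_at n Z i w) else 0)\<rparr>"
  have Ws: "space_at n W i = \<rho> i ` space_at n Z i" for i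
    using lin_maps_0[OF \<rho>, of i] by (auto simp: space_at_def W_def)
  have Wa: "arrow_at n W i w = (if w \<in> space_at n W i then \<rho> (Suc i) (arrow_at n Z i w) else 0)" for i w
    using lin_maps_0[OF \<rho>, of "Suc i"] unfolding Ws by (auto simp: arrow_at_def W_def)
  have WZ: "space_at n W i \<subseteq> space_at n Z i" for i
    using lin_maps_mem[OF \<rho>] by (auto simp: Ws)
  have Wsub: "kvec.subspace (space_at n W i)" for i
  proof (rule kvec.subspaceI)
    show "0 \<in> space_at n W i" using lin_maps_0[OF \<rho>] linear_rep_0[OF Z] unfolding Ws by (metis imageI)
  next
    fix u v assume "u \<in> space_at n W i" "v \<in> space_at n W i"
    then show "u + v \<in> space_at n W i"
      unfolding Ws using lin_maps_add[OF \<rho>] kvec.subspace_add[OF ZS] by (smt (verit) imageE imageI)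
  next
    fix c v assume "v \<in> space_at n W i"
    then show "vscale c v \<in> space_at n W i"
      unfolding Ws using lin_maps_scale[OF \<rho>] kvec.subspace_scale[OF ZS] by (smt (verit) imageE imageI)
  qed
  have "arrow_at n W i \<in> lin_maps (space_at n W i) (space_at n W (Suc i))" for i
  proof (rule lin_mapsI)
    fix w assume w: "w \<in> space_at n W i"
    then have wZ: "w \<in> space_at n Z i" using WZ by blast
    show "arrow_at n W i w \<in> space_at n W (Suc i)"
      using w lin_maps_mem[OF arr wZ] by (simp add: Wa) (simp add: Ws)
    show "arrow_at n W i (vscale c w) = vscale c (arrow_at n W i w)" for c
      using w kvec.subspace_scale[OF Wsub w] lin_maps_scale[OF arr wZ] lin_maps_scale[OF \<rho> lin_maps_mem[OF arr wZ]]
      by (simp add: Wa)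
    fix u assume u: "u \<in> space_at n W i"
    then have uZ: "u \<in> space_at n Z i" using WZ by blast
    show "arrow_at n W i (u + w) = arrow_at n W i u + arrow_at n W i w"
      using u w kvec.subspace_add[OF Wsub u w] lin_maps_add[OF arr uZ wZ]
        lin_maps_add[OF \<rho> lin_maps_mem[OF arr uZ] lin_maps_mem[OF arr wZ]]
      by (simp add: Wa)
  qed (simp add: Wa)
  then have W: "linear_rep n W" using Wsub by (simp add: linear_rep_def)
  have "fin_dim (space_at n W i)" for i
  proof -
    have "fin_dim (space_at n Z i)" using Zr by (simp add: is_rep_iff)
    then show ?thesis using WZ[of i] by (auto simp: fin_dim_def)
  qed
  then have Wr: "is_rep n W" using W by (simp add: is_rep_iff)
  have \<rho>H: "\<rho> \<in> Hom n Z W"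
  proof (rule HomI)
    show "\<rho> i \<in> lin_maps (space_at n Z i) (space_at n W i)" for i
      using \<rho>[of i] unfolding Ws lin_maps_def by blast
    fix i z assume z: "z \<in> space_at n Z i"
    then have m: "\<rho> i z \<in> space_at n Z i" using lin_maps_mem[OF \<rho>] by blast
    obtain y where y: "y \<in> space_at n Y i" "z - \<rho> i z = g i y" using \<rho>I[OF z] by blast
    have "arrow_at n Z i z - arrow_at n Z i (\<rho> i z) = g (Suc i) (arrow_at n Y i y)"
      using lin_maps_diff[OF arr ZS z m] Hom_commute[OF g y(1)] y(2) by simp
    then have "\<rho> (Suc i) (arrow_at n Z i z - arrow_at n Z i (\<rho> i z)) = 0"
      using \<rho>0 lin_maps_mem[OF linear_rep_arrow[OF Y] y(1)] by simp
    then have "\<rho> (Suc i) (arrow_at n Z i z) = \<rho> (Suc i) (arrow_at n Z i (\<rho> i z))"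
      using lin_maps_diff[OF \<rho> ZS lin_maps_mem[OF arr z] lin_maps_mem[OF arr m]] by simp
    then show "\<rho> (Suc i) (arrow_at n Z i z) = arrow_at n W i (\<rho> i z)"
      using z by (simp add: Wa Ws)
  qed
  have "conn n W p q" if pqR: "(p, q) \<in> R" for p q
  proof -
    have pq: "p \<le> q" using R[OF pqR] .
    have cY: "transport_surj n Y p q"
      using YC pqR conn_iff[OF Y pq] unfolding perp_edges_def by blast
    have cZ: "transport_inj n Z p q" "transport_surj n Z p q"
      using ZC pqR conn_iff[OF Z pq] unfolding perp_edges_def by blast+
    have tW: "transport n W p q (\<rho> p z) = \<rho> q (transport n Z p q z)" if "z \<in> space_at n Z p" for z
      using Hom_transport[OF \<rho>H Z that pq] by simp
    have "transport_surj n W p q"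
      unfolding transport_surj_def
    proof
      fix w assume "w \<in> space_at n W q"
      then obtain z where z: "z \<in> space_at n Z q" "w = \<rho> q z" by (auto simp: Ws)
      then obtain z' where "z' \<in> space_at n Z p" "transport n Z p q z' = z"
        using cZ(2) unfolding transport_surj_def by blast
      then show "\<exists>u\<in>space_at n W p. transport n W p q u = w"
        using tW z(2) unfolding Ws by blast
    qed
    \<comment> \<open>Diagram chase: if the class of \<open>z\<close> dies at \<open>q\<close>, its
      transport comes from some \<open>y\<close> in \<open>Y_q\<close>. Surjectivity for
      \<open>Y\<close> lifts \<open>y\<close> to \<open>y'\<close> in \<open>Y_p\<close>, and
      injectivity for \<open>Z\<close> shows that \<open>z\<close> is the image of
      \<open>y'\<close>, hence zero in \<open>W\<close>.\<close>
    moreover have "transport_inj n W p q"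
      unfolding transport_inj_def
    proof (intro ballI impI)
      fix w assume "w \<in> space_at n W p" and w0: "transport n W p q w = 0"
      then obtain z where z: "z \<in> space_at n Z p" "w = \<rho> p z" by (auto simp: Ws)
      let ?t = "transport n Z p q z"
      have t: "?t \<in> space_at n Z q" by (rule transport_mem[OF Z pq z(1)])
      have "\<rho> q ?t = 0" using w0 z tW by simp
      then obtain y where y: "y \<in> space_at n Y q" "?t = g q y" using \<rho>I[OF t] by auto
      obtain y' where y': "y' \<in> space_at n Y p" "transport n Y p q y' = y"
        using cY y(1) unfolding transport_surj_def by blast
      have m: "g p y' \<in> space_at n Z p" by (rule Hom_mem[OF g y'(1)])
      have "transport n Z p q (z - g p y') = 0"
        using transport_diff[OF Z pq z(1) m] Hom_transport[OF g Y y'(1) pq] y y' by simp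
      then have "z - g p y' = 0"
        using transport_injD[OF cZ(1)] kvec.subspace_diff[OF ZS z(1) m] by blast
      then have "z \<in> ?I p" using y'(1) by simp
      then show "w = 0" using z(2) \<rho>0 by simp
    qed
    ultimately show ?thesis by (simp add: conn_iff[OF W pq])
  qed
  then have WC: "W \<in> perp_edges n R" using Wr by (auto simp: perp_edges_def)
  have "comp_hom \<rho> g i u = comp_hom 0 g i u" for i u
  proof (cases "u \<in> space_at n Y i")
    case True
    then show ?thesis using \<rho>0 by simp
  next
    case False
    then show ?thesis using Hom_outside[OF g False] lin_maps_0[OF \<rho>] by simp
  qed
  then have "comp_hom \<rho> g = comp_hom 0 g" by blast
  then have "\<rho> = 0" by (rule mono[OF WC \<rho>H zero_in_Hom[OF W]])
  then show ?thesis using \<rho>I[OF v] by auto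
qed

lemma Hom_ival_eqI:
  fixes f f' :: "'k::field fam"
  assumes I: "interval n x y" and f: "f \<in> Hom n (ival x y) Z" "f' \<in> Hom n (ival x y) Z"
    and e: "f x unit_vec = f' x unit_vec"
  shows "f = f'"
proof (rule Hom_eqI[OF f])
  note L = linear_rep_ival[OF I, where 'a='k]
  have xs: "(unit_vec :: 'k kvec) \<in> space_at n (ival x y) x"
    using I by (simp add: space_at_ival) (simp add: interval_def)
  fix j and v :: "'k kvec" assume v: "v \<in> space_at n (ival x y) j"
  show "f j v = f' j v"
  proof (cases "x \<le> j \<and> j < y")
    case True
    then have vl: "v \<in> line" using v by (simp add: space_at_ival[OF I])
    have "transport n (ival x y) x j unit_vec = (unit_vec :: 'k kvec)"
      using True transport_ival[OF I xs] by (cases "x = j") auto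
    then have "f j unit_vec = f' j unit_vec"
      using Hom_transport[OF f(1) L xs, of j] Hom_transport[OF f(2) L xs, of j] True e by simp
    then have "f j (vscale (v 0) unit_vec) = f' j (vscale (v 0) unit_vec)"
      using Hom_scale[OF f(1), of unit_vec] Hom_scale[OF f(2), of unit_vec] True
      by (simp add: space_at_ival[OF I])
    then show ?thesis by (simp add: line_scale[OF vl])
  next
    case False
    then have "v = 0" using v by (auto simp add: space_at_ival[OF I])
    then show ?thesis by (simp add: Hom_0[OF f(1)] Hom_0[OF f(2)])
  qed
qed

text \<open>Each of the two alternatives makes \<open>Hom(P, -)\<close>, the kernel of the transport from \<open>u\<close> to
  \<open>v\<close>, exact on \<open>perp_edges n R\<close>; here \<open>n + 1\<close> stands for the zero space.\<close>

lemma projective_in_perp_edges: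
  fixes P :: "'k::field rep"
  assumes R: "\<And>p q. (p, q) \<in> R \<Longrightarrow> p \<le> q" and P: "is_ival n P u v" and PC: "P \<in> perp_edges n R"
    and cond: "(\<forall>Y::'k rep \<in> perp_edges n R. conn n Y v (n + 1)) \<or>
      (\<exists>x\<le>u. \<forall>Y::'k rep \<in> perp_edges n R. conn n Y x v)"
  shows "projective_in n (perp_edges n R) P"
  unfolding projective_in_def
proof (intro conjI allI impI ballI)
  fix Y Z :: "'k rep" and g f :: "'k fam"
  assume epi: "epi_in n (perp_edges n R) Y Z g" and f: "f \<in> Hom n P Z"
  have YC: "Y \<in> perp_edges n R" and ZC: "Z \<in> perp_edges n R" and g: "g \<in> Hom n Y Z"
    using epi unfolding epi_in_def by blast+
  have Y: "linear_rep n Y" and Z: "linear_rep n Z"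
    using YC ZC by (auto simp: perp_edges_def is_rep_linear)
  have I: "interval n u v" and L: "linear_rep n P" using P by (auto simp: is_ival_def is_rep_linear)
  then have uv: "u \<le> v" "v \<le> n + 1" by (auto simp: interval_def)
  obtain \<iota> \<pi> where \<iota>: "\<iota> \<in> Hom n (ival u v) P" and \<pi>: "\<pi> \<in> Hom n P (ival u v)"
    and \<iota>\<pi>: "comp_hom \<iota> \<pi> = id_hom n P"
    using P unfolding is_ival_def iso_rep_def by blast
  note LI = linear_rep_ival[OF I, where 'a='k]
  have us: "(unit_vec :: 'k kvec) \<in> space_at n (ival u v) u"
    using I by (simp add: space_at_ival) (simp add: interval_def)
  let ?z = "f u (\<iota> u unit_vec)"
  note f\<iota> = comp_Hom[OF \<iota> f]
  have z: "?z \<in> space_at n Z u" using Hom_mem[OF f\<iota> us] by simp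
  have "transport n (ival u v) u v unit_vec = (0 :: 'k kvec)"
    using transport_ival[OF I us, of v] I by (simp add: interval_def)
  then have zt: "transport n Z u v ?z = 0"
    using Hom_transport[OF f\<iota> LI us uv(1)] Hom_0[OF f\<iota>, of v] by simp
  obtain y where y: "y \<in> space_at n Y u" "g u y = ?z"
    using epi_in_surj[OF R epi z] by blast
  let ?t = "transport n Y u v y"
  have t: "?t \<in> space_at n Y v" by (rule transport_mem[OF Y uv(1) y(1)])
  have gt: "g v ?t = 0" using Hom_transport[OF g Y y(1) uv(1)] y(2) zt by simp
  \<comment> \<open>The lift \<open>y\<close> may violate the relation at \<open>v\<close>. It has
    to be changed by an element of the kernel of \<open>g u\<close> with the same transport
    \<open>?t\<close>, and all that is known of \<open>?t\<close> is that \<open>g v\<close> kills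
    it.\<close>
  have "\<exists>y'\<in>space_at n Y u. g u y' = ?z \<and> transport n Y u v y' = 0"
    using cond
  proof
    assume "\<forall>Y::'k rep \<in> perp_edges n R. conn n Y v (n + 1)"
    \<comment> \<open>Injectivity into the zero space at \<open>n + 1\<close> means
      \<open>Y_v = 0\<close>, so \<open>y\<close> already satisfies the relation.\<close>
    then have "transport_inj n Y v (n + 1)" using YC conn_iff[OF Y uv(2)] by blast
    moreover have "transport n Y v (n + 1) ?t \<in> space_at n Y (n + 1)"
      by (rule transport_mem[OF Y uv(2) t])
    then have "transport n Y v (n + 1) ?t = 0" by (simp add: space_at_def)
    ultimately have "?t = 0" using t transport_injD by blast
    then show ?thesis using y by blast
  next
    assume "\<exists>x\<le>u. \<forall>Y::'k rep \<in> perp_edges n R. conn n Y x v"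
    \<comment> \<open>The bijection from \<open>Y_x\<close> to \<open>Y_v\<close> passes through
      \<open>Y_u\<close> because \<open>x \<le> u\<close>, and so provides a section of
      \<open>Y_u -> Y_v\<close> compatible with \<open>g\<close>. The correction \<open>?b\<close>
      is the value of this section at \<open>?t\<close>.\<close>
    then obtain x where x: "x \<le> u" "\<And>Y::'k rep. Y \<in> perp_edges n R \<Longrightarrow> conn n Y x v" by blast
    have xv: "x \<le> v" using x uv by simp
    have s: "transport_surj n Y x v" and i: "transport_inj n Z x v"
      using x(2)[OF YC] x(2)[OF ZC] conn_iff[OF Y xv] conn_iff[OF Z xv] by blast+
    obtain a where a: "a \<in> space_at n Y x" "transport n Y x v a = ?t"
      using s t unfolding transport_surj_def by blast
    have "transport n Z x v (g x a) = 0"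
      using Hom_transport[OF g Y a(1) xv] a(2) gt by simp
    then have ga: "g x a = 0" using transport_injD[OF i Hom_mem[OF g a(1)]] by blast
    let ?b = "transport n Y x u a"
    have b: "?b \<in> space_at n Y u" by (rule transport_mem[OF Y x(1) a(1)])
    have "g u ?b = 0"
      using Hom_transport[OF g Y a(1) x(1)] ga transport_0[OF Z x(1)] by simp
    then have "g u (y - ?b) = ?z" using Hom_diff[OF g Y y(1) b] y(2) by simp
    moreover have "transport n Y u v (y - ?b) = 0"
      using transport_diff[OF Y uv(1) y(1) b] transport_comp[OF x(1) uv(1), of n Y a] a(2) by simp
    ultimately show ?thesis
      using kvec.subspace_diff[OF linear_rep_subspace[OF Y] y(1) b] by blast
  qed
  then obtain y' where y': "y' \<in> space_at n Y u" "g u y' = ?z" "transport n Y u v y' = 0" by blast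
  obtain h where h: "h \<in> Hom n (ival u v) Y" "h u unit_vec = y'"
    using that[OF Hom_from_ival[OF I Y y'(1,3)]] I by (simp add: interval_def)
  have gh: "comp_hom g h = comp_hom f \<iota>"
    by (rule Hom_ival_eqI[OF I comp_Hom[OF h(1) g] f\<iota>]) (simp add: h(2) y'(2))
  have "comp_hom g (comp_hom h \<pi>) = comp_hom f (comp_hom \<iota> \<pi>)"
    by (simp add: comp_hom_assoc gh)
  also have "\<dots> = f" unfolding \<iota>\<pi> by (rule comp_id_vertex_maps[OF Hom_vertex[OF f]])
  finally show "\<exists>h\<in>Hom n P Y. comp_hom g h = f"
    using comp_Hom[OF \<pi> h(1)] by blast
qed (rule PC)

section \<open>Dimensions and the Euler form\<close>

lemma (in vector_space) independent_family:
  assumes fin: "finite I" and z: "\<And>c. (\<Sum>i\<in>I. scale (c i) (\<beta> i)) = 0 \<Longrightarrow> \<forall>i\<in>I. c i = 0"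
  shows "inj_on \<beta> I" "independent (\<beta> ` I)"
proof -
  show inj: "inj_on \<beta> I"
  proof (rule inj_onI, rule ccontr)
    fix i j assume ij: "i \<in> I" "j \<in> I" "\<beta> i = \<beta> j" "i \<noteq> j"
    define u where "u k = (if k = i then 1 else if k = j then - 1 else 0 :: 'a)" for k
    have "(\<Sum>k\<in>I. scale (u k) (\<beta> k)) = (\<Sum>k\<in>{i, j}. scale (u k) (\<beta> k))"
      using ij fin by (intro sum.mono_neutral_right) (auto simp: u_def)
    also have "\<dots> = 0" using ij by (simp add: u_def)
    finally show False using z[of u] ij by (auto simp: u_def)
  qed
  show "independent (\<beta> ` I)"
  proof (rule independent_if_scalars_zero)
    fix f x assume f: "(\<Sum>x\<in>\<beta> ` I. scale (f x) x) = 0" and x: "x \<in> \<beta> ` I"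
    then have "(\<Sum>i\<in>I. scale (f (\<beta> i)) (\<beta> i)) = 0" by (simp add: sum.reindex[OF inj])
    from z[OF this] show "f x = 0" using x by blast
  qed (use fin in simp)
qed

text \<open>Linearity of \<open>\<phi>\<close> is asked on \<open>V\<close> only, to suit
  \<open>coboundary\<close>, whose arrow maps are linear just on the spaces of the representation. A
  basis of the kernel is extended to one of \<open>V\<close>; the images of the added vectors form a
  basis of the image.\<close>

lemma (in vector_space) rank_nullity:
  assumes V: "subspace V" and F: "finite F" "V \<subseteq> span F"
    and add: "\<And>u v. u \<in> V \<Longrightarrow> v \<in> V \<Longrightarrow> \<phi> (u + v) = \<phi> u + \<phi> v"
    and scale': "\<And>c v. v \<in> V \<Longrightarrow> \<phi> (scale c v) = scale c (\<phi> v)"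
  shows "dim V = dim {v \<in> V. \<phi> v = 0} + dim (\<phi> ` V)"
proof -
  let ?K = "{v \<in> V. \<phi> v = 0}"
  obtain B where B: "B \<subseteq> ?K" "independent B" "?K \<subseteq> span B"
    using maximal_independent_subset .
  have "B \<subseteq> V" using B(1) by blast
  then obtain B' where B': "B \<subseteq> B'" "B' \<subseteq> V" "independent B'" "V \<subseteq> span B'"
    using maximal_independent_subset_extend[OF _ B(2), of V] by blast
  have "B' \<subseteq> span F" using B'(2) F(2) by (rule order_trans)
  then have fin: "finite B'" using independent_span_bound[OF F(1) B'(3)] by blast
  define C where "C = B' - B"
  have finC: "finite C" "finite B" and CV: "C \<subseteq> V"
    using fin B' finite_subset by (auto simp: C_def)
  have \<phi>0: "\<phi> 0 = 0" using scale'[OF subspace_0[OF V], of 0] by simp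
  have \<phi>_sum: "(\<Sum>x\<in>A. scale (u x) x) \<in> V \<and> \<phi> (\<Sum>x\<in>A. scale (u x) x) = (\<Sum>x\<in>A. scale (u x) (\<phi> x))"
    if "finite A" "A \<subseteq> V" for A u
    using that
  proof (induction A rule: finite_induct)
    case empty
    show ?case using \<phi>0 subspace_0[OF V] by simp
  next
    case (insert x A)
    then have x: "scale (u x) x \<in> V" using subspace_scale[OF V] by blast
    have A: "(\<Sum>x\<in>A. scale (u x) x) \<in> V" using insert by simp
    show ?case
      using insert x A add[OF x A] scale' subspace_add[OF V x A] by simp
  qed
  have zero: "u x = 0" if s: "(\<Sum>x\<in>C. scale (u x) (\<phi> x)) = 0" and x: "x \<in> C" for u x
  proof -
    have "(\<Sum>x\<in>C. scale (u x) x) \<in> ?K" using \<phi>_sum[OF finC(1) CV, of u] s by simp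
    then have "(\<Sum>x\<in>C. scale (u x) x) \<in> span B" using B(3) by blast
    then obtain d where d: "(\<Sum>x\<in>C. scale (u x) x) = (\<Sum>x\<in>B. scale (d x) x)"
      using span_finite[OF finC(2)] by auto
    define e where "e x = (if x \<in> C then u x else - d x)" for x
    have "(\<Sum>x\<in>B'. scale (e x) x) = (\<Sum>x\<in>C. scale (e x) x) + (\<Sum>x\<in>B. scale (e x) x)"
      using sum.subset_diff[OF B'(1) fin] by (simp add: C_def)
    also have "(\<Sum>x\<in>C. scale (e x) x) = (\<Sum>x\<in>C. scale (u x) x)"
      by (simp add: e_def)
    also have "(\<Sum>x\<in>B. scale (e x) x) = - (\<Sum>x\<in>B. scale (d x) x)"
      unfolding sum_negf[symmetric] by (rule sum.cong) (auto simp: e_def C_def)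
    finally have e0: "(\<Sum>x\<in>B'. scale (e x) x) = 0" using d by (simp only: add.right_inverse)
    have "x \<in> B'" using x by (simp add: C_def)
    with e0 have "e x = 0" by (rule independentD[OF B'(3) fin subset_refl])
    then show ?thesis using x by (simp add: e_def)
  qed
  have z: "\<forall>x\<in>C. u x = 0" if "(\<Sum>x\<in>C. scale (u x) (\<phi> x)) = 0" for u
    using zero[OF that] by blast
  note inj = independent_family(1)[OF finC(1) z]
  have "independent (\<phi> ` C)" by (rule independent_family(2)[OF finC(1) z])
  moreover have "\<phi> ` V \<subseteq> span (\<phi> ` C)"
  proof
    fix w assume "w \<in> \<phi> ` V"
    then obtain v where v: "v \<in> V" "w = \<phi> v" by blast
    then have "v \<in> span B'" using B'(4) by blast
    then obtain u where u: "v = (\<Sum>x\<in>B'. scale (u x) x)"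
      using span_finite[OF fin] by auto
    have "w = (\<Sum>x\<in>B'. scale (u x) (\<phi> x))"
      using \<phi>_sum[OF fin B'(2), of u] v(2) u by simp
    also have "\<dots> = (\<Sum>x\<in>C. scale (u x) (\<phi> x))"
      using fin B(1) by (intro sum.mono_neutral_right) (auto simp: C_def)
    also have "\<dots> \<in> span (\<phi> ` C)"
      by (intro span_sum span_scale span_base) auto
    finally show "w \<in> span (\<phi> ` C)" .
  qed
  moreover have "\<phi> ` C \<subseteq> \<phi> ` V" using CV by blast
  ultimately have "dim (\<phi> ` V) = card C"
    using dim_unique card_image[OF inj] by metis
  moreover have "dim V = card B'" using dim_unique B' by blast
  moreover have "dim ?K = card B" using dim_unique B by blast
  moreover have "card B' = card B + card C"
    using B'(1) fin card_mono[OF fin B'(1)] by (simp add: C_def card_Diff_subset finite_subset)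
  ultimately show ?thesis by simp
qed

text \<open>The spaces of an interval module are spanned by single vectors, possibly zero. Allowing
  zero generators lets one count cover vertex families and, with \<open>t\<close> shifted by one
  vertex, arrow families.\<close>

lemma lin_families_basis:
  fixes d t :: "nat \<Rightarrow> 'k::field kvec"
  assumes fin: "finite I" and I: "\<And>i. i \<in> I \<longleftrightarrow> d i \<noteq> 0 \<and> t i \<noteq> 0"
  defines "X \<equiv> {f. \<forall>i. f i \<in> lin_maps (kvec.span {d i}) (kvec.span {t i})}"
  shows "\<exists>B. finite B \<and> X \<subseteq> fam.span B" and "fam.dim X = card I"
proof -
  have "\<exists>m. d i m \<noteq> 0" if "i \<in> I" for i
    using I that by (auto simp: fun_eq_iff)
  \<comment> \<open>A coordinate at which \<open>d i\<close> does not vanish: the factor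
    \<open>a\<close> of \<open>v = vscale a (d i)\<close> is recovered as the quotient of the
    entries there.\<close>
  then obtain \<kappa> where \<kappa>: "\<And>i. i \<in> I \<Longrightarrow> d i (\<kappa> i) \<noteq> 0" by metis
  define \<beta> :: "nat \<Rightarrow> 'k fam" where
    "\<beta> = (\<lambda>i j v. if j = i \<and> v \<in> kvec.span {d i} then vscale (v (\<kappa> i) / d i (\<kappa> i)) (t i) else 0)"
  have \<beta>X: "\<beta> i \<in> X" if "i \<in> I" for i
  proof -
    have "\<beta> i j \<in> lin_maps (kvec.span {d j}) (kvec.span {t j})" for j
    proof (cases "j = i")
      case True
      show ?thesis unfolding True
        by (rule lin_mapsI) (auto simp: \<beta>_def kvec.span_add kvec.span_scale kvec.span_base
            kvec.scale_left_distrib add_divide_distrib pointwise vscale_at)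
    next
      case False
      then show ?thesis by (intro lin_mapsI) (auto simp: \<beta>_def kvec.span_zero)
    qed
    then show ?thesis by (simp add: X_def)
  qed
  have sum_apply: "(\<Sum>i\<in>I. fscale (c i) (\<beta> i)) j v
      = (if j \<in> I \<and> v \<in> kvec.span {d j} then vscale (c j * (v (\<kappa> j) / d j (\<kappa> j))) (t j) else 0)" for c j v
  proof -
    have "(\<Sum>i\<in>A. fscale (c i) (\<beta> i)) j v = (\<Sum>i\<in>A. vscale (c i) (\<beta> i j v))" if "finite A" for A
      using that by (induction A rule: finite_induct) (auto simp: fscale_def pointwise)
    then have "(\<Sum>i\<in>I. fscale (c i) (\<beta> i)) j v = (\<Sum>i\<in>I. vscale (c i) (\<beta> i j v))" using fin by blast
    also have "\<dots> = (\<Sum>i\<in>I. if j = i then vscale (c j) (\<beta> j j v) else 0)"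
      by (rule sum.cong) (auto simp: \<beta>_def)
    also have "\<dots> = (if j \<in> I then vscale (c j) (\<beta> j j v) else 0)"
      using fin by (simp add: sum.delta)
    finally show ?thesis by (simp add: \<beta>_def)
  qed
  have c0: "c i = 0" if s: "(\<Sum>i\<in>I. fscale (c i) (\<beta> i)) = 0" and i: "i \<in> I" for c i
  proof -
    have "vscale (c i) (t i) = 0"
      using sum_apply[of c i "d i"] i \<kappa>[OF i] unfolding s by (simp add: kvec.span_base)
    then show ?thesis using I i by simp
  qed
  have c0': "\<forall>i\<in>I. c i = 0" if "(\<Sum>i\<in>I. fscale (c i) (\<beta> i)) = 0" for c
    using c0[OF that] by blast
  note inj = fam.independent_family(1)[of I \<beta>, OF fin c0'] and indep = fam.independent_family(2)[of I \<beta>, OF fin c0']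
  have span: "X \<subseteq> fam.span (\<beta> ` I)"
  proof
    fix f assume f: "f \<in> X"
    then have fl: "f i \<in> lin_maps (kvec.span {d i}) (kvec.span {t i})" for i by (simp add: X_def)
    have "\<exists>a. f i (d i) = vscale a (t i)" for i
      using lin_maps_mem[OF fl kvec.span_base[OF singletonI]] by (auto simp: kvec.span_singleton)
    then obtain c where c: "\<And>i. f i (d i) = vscale (c i) (t i)" by metis
    have "f j v = (\<Sum>i\<in>I. fscale (c i) (\<beta> i)) j v" for j v
    proof (cases "v \<in> kvec.span {d j}")
      case False
      then show ?thesis using lin_maps_outside[OF fl False] by (simp add: sum_apply)
    next
      case True
      then obtain a where a: "v = vscale a (d j)" by (auto simp: kvec.span_singleton)
      have fv: "f j v = vscale (a * c j) (t j)"
        using lin_maps_scale[OF fl, of "d j" j a] c a by (simp add: kvec.span_base)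
      show ?thesis
      proof (cases "j \<in> I")
        case True
        then show ?thesis
          using fv \<kappa>[OF True] \<open>v \<in> kvec.span {d j}\<close> unfolding sum_apply by (simp add: a vscale_at mult.commute)
      next
        case False
        then have "d j = 0 \<or> t j = 0" using I by blast
        then have "f j v = 0"
        proof
          assume "d j = 0"
          then show ?thesis using a lin_maps_0[OF fl] by simp
        qed (simp add: fv)
        then show ?thesis using False by (simp add: sum_apply)
      qed
    qed
    then have "f = (\<Sum>i\<in>I. fscale (c i) (\<beta> i))" by blast
    also have "\<dots> \<in> fam.span (\<beta> ` I)"
      by (intro fam.span_sum fam.span_scale fam.span_base) auto
    finally show "f \<in> fam.span (\<beta> ` I)" .
  qed
  show "\<exists>B. finite B \<and> X \<subseteq> fam.span B" using span fin by blast
  have "\<beta> ` I \<subseteq> X" using \<beta>X by blast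
  then show "fam.dim X = card I"
    using fam.dim_unique[OF _ span indep] card_image[OF inj] by blast
qed

lemma is_ival_spaces:
  fixes M :: "'k::field rep"
  assumes M: "is_ival n M x y"
  obtains m where "\<And>i. space_at n M i = kvec.span {m i}" "\<And>i. m i \<noteq> 0 \<longleftrightarrow> x \<le> i \<and> i < y"
proof -
  have I: "interval n x y" using M by (simp add: is_ival_def)
  obtain f g where f: "f \<in> Hom n M (ival x y)" and g: "g \<in> Hom n (ival x y) M"
    and gf: "comp_hom g f = id_hom n M" and fg: "comp_hom f g = id_hom n (ival x y)"
    using M unfolding is_ival_def iso_rep_def by blast
  have gf': "g i (f i v) = v" if "v \<in> space_at n M i" for i v
    using retract_apply[of n M "ival x y" f g] f g gf that by (simp add: retract_def)
  have fg': "f i (g i v) = v" if "v \<in> space_at n (ival x y) i" for i v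
    using retract_apply[of n "ival x y" M g f] f g fg that by (simp add: retract_def)
  define m where "m i = g i unit_vec" for i
  have s: "space_at n (ival x y :: 'k rep) i = (if x \<le> i \<and> i < y then line else {0})" for i
    by (rule space_at_ival[OF I])
  have mi: "m i = 0" if "\<not> (x \<le> i \<and> i < y)" for i
    unfolding m_def by (rule Hom_outside[OF g]) (use that s in \<open>metis singletonD unit_vec_nonzero\<close>)
  have mn: "m i \<noteq> 0" if "x \<le> i \<and> i < y" for i
  proof
    assume "m i = 0"
    then have "f i (g i unit_vec) = 0" by (simp add: m_def Hom_0[OF f])
    moreover have "(unit_vec :: 'k kvec) \<in> space_at n (ival x y) i" using that by (simp add: s)
    ultimately show False using fg' unit_vec_nonzero by metis
  qed
  have "space_at n M i = kvec.span {m i}" for i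
  proof (cases "x \<le> i \<and> i < y")
    case True
    then have u: "(unit_vec :: 'k kvec) \<in> space_at n (ival x y) i" by (simp add: s)
    have "v \<in> kvec.span {m i}" if v: "v \<in> space_at n M i" for v
    proof -
      have "f i v \<in> line" using Hom_mem[OF f v] True by (simp add: s)
      then have "f i v = vscale (f i v 0) unit_vec" using line_scale by metis
      then have "v = g i (vscale (f i v 0) unit_vec)" using gf'[OF v] by metis
      also have "\<dots> = vscale (f i v 0) (m i)" using Hom_scale[OF g u] by (simp add: m_def)
      finally show ?thesis by (auto simp: kvec.span_singleton)
    qed
    moreover have "kvec.span {m i} \<subseteq> space_at n M i"
      using Hom_mem[OF g u] M
      by (intro kvec.span_minimal linear_rep_subspace) (auto simp: m_def is_ival_def is_rep_linear)
    ultimately show ?thesis by blast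
  next
    case False
    have "v = 0" if v: "v \<in> space_at n M i" for v
    proof -
      have "f i v = 0" using Hom_mem[OF f v] False s by (metis singletonD)
      then show ?thesis using gf'[OF v] Hom_0[OF g] by metis
    qed
    moreover have "0 \<in> space_at n M i" using M by (auto simp: is_ival_def is_rep_linear linear_rep_0)
    ultimately have "space_at n M i = {0}" by blast
    then show ?thesis by (simp add: mi[OF False] kvec.span_singleton)
  qed
  then show thesis using that mi mn by blast
qed

lemma dim_is_ival:
  assumes M: "is_ival n M x y"
  shows "int (kvec.dim (space_at n M i)) = ind x y i"
proof -
  obtain m where "space_at n M i = kvec.span {m i}" "m i \<noteq> 0 \<longleftrightarrow> x \<le> i \<and> i < y"
    using is_ival_spaces[OF M] by metis
  moreover have "kvec.dim {m i} = (if m i = 0 then 0 else 1)"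
  proof (cases "m i = 0")
    case True
    then show ?thesis using kvec.dim_unique[of "{}" "{0}" 0] kvec.independent_empty by simp
  next
    case False
    then show ?thesis using kvec.dim_eq_card_independent[of "{m i}"] by simp
  qed
  ultimately show ?thesis by (auto simp: ind_def)
qed

lemma is_ival_unique:
  assumes "is_ival n M x y" "is_ival n M z w"
  shows "x = z \<and> y = w"
proof -
  have *: "ind x y i = ind z w i" for i
    using dim_is_ival[OF assms(1)] dim_is_ival[OF assms(2)] by simp
  have h: "x < y" "z < w" using assms by (auto simp: is_ival_def interval_def)
  have "x = z" using *[of x] *[of z] h by (auto simp: ind_def split: if_splits)
  moreover have "y = w" using *[of "y - 1"] *[of "w - 1"] h by (auto simp: ind_def split: if_splits)
  ultimately show ?thesis ..
qed

text \<open>The rank of the coboundary map cancels, leaving vertex families minus arrow families.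
  The first dimension counts the \<open>p\<close> in both intervals, the second those with
  \<open>p\<close> in the first and \<open>Suc p\<close> in the second; \<open>ind_pairing\<close>
  evaluates the difference.\<close>

lemma euler_form_ival:
  fixes M N :: "'k::field rep"
  assumes M: "is_ival n M x y" and N: "is_ival n N z w"
  shows "euler_form n M N = ind z w x - ind z w y"
proof -
  obtain m where m: "\<And>i. space_at n M i = kvec.span {m i}" "\<And>i. m i \<noteq> 0 \<longleftrightarrow> x \<le> i \<and> i < y"
    using is_ival_spaces[OF M] by metis
  obtain m' where m': "\<And>i. space_at n N i = kvec.span {m' i}" "\<And>i. m' i \<noteq> 0 \<longleftrightarrow> z \<le> i \<and> i < w"
    using is_ival_spaces[OF N] by metis
  have I: "interval n x y" and I': "interval n z w" using M N by (auto simp: is_ival_def)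
  have LM: "linear_rep n M" and LN: "linear_rep n N"
    using M N by (auto simp: is_ival_def is_rep_linear)
  let ?V = "vertex_maps n M N" and ?\<phi> = "coboundary n M N"
  let ?I = "{i. m i \<noteq> 0 \<and> m' i \<noteq> 0}" and ?J = "{i. m i \<noteq> 0 \<and> m' (Suc i) \<noteq> 0}"
  have fin: "finite ?I" "finite ?J"
    by (rule finite_subset[of _ "{x..<y}"]; auto simp: m m')+
  have V: "?V = {f. \<forall>i. f i \<in> lin_maps (kvec.span {m i}) (kvec.span {m' i})}"
    by (auto simp: vertex_maps_iff m m')
  have A: "arrow_maps n M N = {f. \<forall>i. f i \<in> lin_maps (kvec.span {m i}) (kvec.span {m' (Suc i)})}"
    by (auto simp: arrow_maps_iff[OF LN] m m')
  note bV = lin_families_basis[of ?I m m', folded V, OF fin(1)]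
  note bA = lin_families_basis[of ?J m "\<lambda>i. m' (Suc i)", folded A, OF fin(2)]
  have addV: "f + g \<in> ?V" if "f \<in> ?V" "g \<in> ?V" for f g
    using that lin_maps_sum[OF _ _ linear_rep_subspace[OF LN]] unfolding vertex_maps_iff plus_fun_def[of f g]
    by (auto simp: plus_fun_def[of "f _" "g _"])
  have sub: "fam.subspace ?V"
  proof (rule fam.subspaceI)
    show "0 \<in> ?V" by (rule Hom_vertex[OF zero_in_Hom[OF LN]])
    fix f c assume f: "f \<in> ?V"
    note fl = vertex_maps_lin[OF f]
    show "fscale c f \<in> ?V"
      unfolding vertex_maps_iff fscale_def
      by (intro allI lin_mapsI) (simp_all add: kvec.subspace_scale[OF linear_rep_subspace[OF LN]]
          lin_maps_mem[OF fl] lin_maps_add[OF fl] lin_maps_scale[OF fl] kvec.scale_right_distrib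
          mult.commute lin_maps_outside[OF fl])
  qed (rule addV)
  have mem: "g i v \<in> space_at n N i" if "g \<in> ?V" for g i v
    using lin_maps_mem[OF vertex_maps_lin[OF that], of v i] lin_maps_outside[OF vertex_maps_lin[OF that], of v i]
      linear_rep_0[OF LN, of i] by (cases "v \<in> space_at n M i") auto
  obtain B where B: "finite B" "?V \<subseteq> fam.span B" using bV(1) by auto
  have "fam.dim ?V = fam.dim {g \<in> ?V. ?\<phi> g = 0} + fam.dim (?\<phi> ` ?V)"
  proof (rule fam.rank_nullity[OF sub B])
    fix f g assume fg: "f \<in> ?V" "g \<in> ?V"
    have plus: "(f' + g') i v = f' i v + g' i v" for f' g' :: "'k fam" and i v
      by (simp only: plus_fun_apply)
    have "?\<phi> (f + g) i v = (?\<phi> f + ?\<phi> g) i v" for i v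
    proof -
      have "?\<phi> (f + g) i v = arrow_at n N i (f i v + g i v)
          - (f (Suc i) (arrow_at n M i v) + g (Suc i) (arrow_at n M i v))"
        using coboundary_eq[OF addV[OF fg], of i v] by (simp only: plus)
      also have "\<dots> = ?\<phi> f i v + ?\<phi> g i v"
        using coboundary_eq[OF fg(1), of i v] coboundary_eq[OF fg(2), of i v]
          lin_maps_add[OF linear_rep_arrow[OF LN] mem[OF fg(1)] mem[OF fg(2)], of i v v]
        by (simp only: add_diff_add)
      finally show ?thesis by (simp only: plus)
    qed
    then show "?\<phi> (f + g) = ?\<phi> f + ?\<phi> g" by blast
  next
    fix c g assume g: "g \<in> ?V"
    have "?\<phi> (fscale c g) i v = fscale c (?\<phi> g) i v" for i v
      using coboundary_eq[OF fam.subspace_scale[OF sub g], of c i v] coboundary_eq[OF g, of i v]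
        lin_maps_scale[OF linear_rep_arrow[OF LN] mem[OF g], of i c v]
      by (simp add: fscale_def kvec.scale_right_diff_distrib)
    then show "?\<phi> (fscale c g) = fscale c (?\<phi> g)" by blast
  qed
  moreover have "{g \<in> ?V. ?\<phi> g = 0} = Hom n M N"
  proof (intro set_eqI iffI)
    fix g assume "g \<in> {g \<in> ?V. ?\<phi> g = 0}"
    then have g: "g \<in> ?V" and "?\<phi> g i v = 0" for i v by auto
    then have "g (Suc i) (arrow_at n M i v) = arrow_at n N i (g i v)" for i v
      using coboundary_eq[OF g, of i v] by (metis eq_iff_diff_eq_0)
    then show "g \<in> Hom n M N" using g by (simp add: Hom_iff)
  next
    fix g assume g: "g \<in> Hom n M N"
    have "?\<phi> g i v = 0" for i v
    proof (cases "v \<in> space_at n M i")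
      case True
      then show ?thesis using Hom_commute[OF g True] by (simp add: coboundary_eq[OF Hom_vertex[OF g]])
    next
      case False
      then have "g i v = 0" "arrow_at n M i v = 0"
        using Hom_outside[OF g] lin_maps_outside[OF linear_rep_arrow[OF LM]] by auto
      then show ?thesis
        using Hom_0[OF g] lin_maps_0[OF linear_rep_arrow[OF LN]]
        by (simp add: coboundary_eq[OF Hom_vertex[OF g]])
    qed
    then have "?\<phi> g = 0" by (intro ext) simp
    then show "g \<in> {g \<in> ?V. ?\<phi> g = 0}" using Hom_vertex[OF g] by simp
  qed
  ultimately have "euler_form n M N = int (card ?I) - int (card ?J)"
    using bV(2) bA(2) by (simp add: euler_form_def dim_Hom_def dim_Ext_def)
  also have "int (card ?I) = (\<Sum>p\<in>{1..n}. ind x y p * ind z w p)"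
  proof -
    have "(\<Sum>p\<in>{1..n}. ind x y p * ind z w p) = (\<Sum>p\<in>?I. 1)"
      using I by (intro sum.mono_neutral_cong_right) (auto simp: m m' ind_def interval_def)
    then show ?thesis by simp
  qed
  also have "int (card ?J) = (\<Sum>p\<in>{1..n}. ind x y p * ind z w (Suc p))"
  proof -
    have "(\<Sum>p\<in>{1..n}. ind x y p * ind z w (Suc p)) = (\<Sum>p\<in>?J. 1)"
      using I by (intro sum.mono_neutral_cong_right) (auto simp: m m' ind_def interval_def)
    then show ?thesis by simp
  qed
  also have "(\<Sum>p\<in>{1..n}. ind x y p * ind z w p) - (\<Sum>p\<in>{1..n}. ind x y p * ind z w (Suc p))
      = (\<Sum>p\<in>{1..n}. ind x y p * (ind z w p - ind z w (Suc p)))"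
    by (simp add: right_diff_distrib sum_subtractf)
  also have "\<dots> = ind z w x - ind z w y" by (rule ind_pairing[OF I])
  finally show ?thesis .
qed

section \<open>Exceptional sequences of modules\<close>

lemma complete_exceptional_iff_exc_seq:
  assumes "\<And>i. i \<in> {1..n} \<Longrightarrow> is_ival n (E i) (a i) (b i)"
  shows "complete_exceptional n E \<longleftrightarrow> exc_seq n a b"
proof -
  have r: "rigid n (E i)" if "i \<in> {1..n}" for i
    using Ext_vanishes_ivals_iff(2)[OF assms[OF that] assms[OF that]] by (simp add: rigid_def)
  have o: "Ext_vanishes n 0 (E j) (E i) \<and> Ext_vanishes n 1 (E j) (E i) \<longleftrightarrow>
      ind (a i) (b i) (a j) = ind (a i) (b i) (b j)" if "i \<in> {1..n}" "j \<in> {1..n}" for i j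
    using Ext_vanishes_ivals_iff(3)[OF assms[OF that(2)] assms[OF that(1)]] .
  have "indecomposable n (E i)" if "i \<in> {1..n}" for i
    using assms[OF that] unfolding indecomposable_iff by blast
  moreover have "interval n (a i) (b i)" if "i \<in> {1..n}" for i
    using assms[OF that] by (simp add: is_ival_def)
  ultimately show ?thesis
    unfolding complete_exceptional_def exc_seq_def using r o by blast
qed

lemma complete_exceptional_cong:
  assumes "\<And>i. i \<in> {1..n} \<Longrightarrow> E i = F i"
  shows "complete_exceptional n E \<longleftrightarrow> complete_exceptional n F"
  using assms by (simp add: complete_exceptional_def)

lemma complete_exceptional_ivals:
  assumes "complete_exceptional n E"
  obtains a b where "exc_seq n a b" "\<And>i. i \<in> {1..n} \<Longrightarrow> is_ival n (E i) (a i) (b i)"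
proof -
  have "\<exists>x y. is_ival n (E i) x y" if "i \<in> {1..n}" for i
    using assms that unfolding complete_exceptional_def indecomposable_iff by blast
  then obtain a b where "\<And>i. i \<in> {1..n} \<Longrightarrow> is_ival n (E i) (a i) (b i)" by metis
  then show thesis using that complete_exceptional_iff_exc_seq assms by blast
qed

text \<open>Mutation of intervals supplies a witness for the choice inside \<open>braid\<close>, so
  the chosen module, whichever it is, completes an exceptional sequence.\<close>

lemma complete_exceptional_braid:
  fixes E :: "nat \<Rightarrow> 'k::field rep"
  assumes E: "complete_exceptional n E" and i: "i \<in> {1..<n}"
  shows "complete_exceptional n (braid n i E)"
proof -
  obtain a b where ab: "exc_seq n a b" "\<And>j. j \<in> {1..n} \<Longrightarrow> is_ival n (E j) (a j) (b j)"
    using complete_exceptional_ivals[OF E] by metis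
  obtain x y where xy: "exc_seq n (a(i := x, i + 1 := a i)) (b(i := y, i + 1 := b i))"
    using exc_seq_mutation[OF ab(1) i] by blast
  have I: "interval n x y" using exc_seq_interval[OF xy, of i] i by simp
  have "is_ival n ((E(i := ival x y, i + 1 := E i)) j) ((a(i := x, i + 1 := a i)) j) ((b(i := y, i + 1 := b i)) j)"
    if "j \<in> {1..n}" for j
    using ab(2)[OF that] ab(2)[of i] i is_ival_ival[OF I, where 'a = 'k] by simp
  then have "complete_exceptional n (E(i := ival x y, i + 1 := E i))"
    using complete_exceptional_iff_exc_seq[of n "E(i := ival x y, i + 1 := E i)"
        "a(i := x, i + 1 := a i)" "b(i := y, i + 1 := b i)"] xy by blast
  then show ?thesis
    unfolding braid_def Let_def by (rule someI)
qed

lemma braid_eqs: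
  "braid n i E (i + 1) = E i" "j \<noteq> i \<Longrightarrow> j \<noteq> i + 1 \<Longrightarrow> braid n i E j = E j"
  by (simp_all add: braid_def Let_def)

text \<open>The product \<open>\<sigma>_m ... \<sigma>_k\<close> acts from the right, so the
  induction runs downwards from the empty product at \<open>m = k + 1\<close>. Each factor moves one
  more old object a place to the right and leaves a new object in front of the block.\<close>

lemma foldr_braid:
  assumes E: "complete_exceptional n E" and k: "k < n" and m: "1 \<le> m" "m \<le> k + 1"
  shows "complete_exceptional n (foldr (braid n) [m..<k + 1] E) \<and>
    (\<forall>i\<in>{m..k}. foldr (braid n) [m..<k + 1] E (i + 1) = E i) \<and>
    (\<forall>i. i < m \<or> k + 1 < i \<longrightarrow> foldr (braid n) [m..<k + 1] E i = E i)"
  using m(2,1)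
proof (induction m rule: inc_induct)
  case base
  then show ?case using E by simp
next
  case (step m)
  let ?F = "foldr (braid n) [Suc m..<k + 1] E"
  have F: "complete_exceptional n ?F" "\<And>i. i \<in> {Suc m..k} \<Longrightarrow> ?F (i + 1) = E i"
    "\<And>i. i < Suc m \<or> k + 1 < i \<Longrightarrow> ?F i = E i"
    using step.IH by auto
  have u: "foldr (braid n) [m..<k + 1] E = braid n m ?F"
    using step.hyps upt_conv_Cons[of m "k + 1"] by (simp only: foldr.simps comp_apply)
  have m: "m \<in> {1..<n}" using step k by auto
  have "braid n m ?F (i + 1) = E i" if "i \<in> {m..k}" for i
  proof (cases "i = m")
    case True
    then show ?thesis using braid_eqs(1)[of n m ?F] F(3)[of m] by simp
  next
    case False
    then show ?thesis using that braid_eqs(2)[of "i + 1" m n ?F] F(2)[of i] by simp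
  qed
  moreover have "braid n m ?F i = E i" if "i < m \<or> k + 1 < i" for i
  proof -
    have "i \<noteq> m" "i \<noteq> m + 1" using that step.hyps by auto
    then show ?thesis using that braid_eqs(2)[of i m n ?F] F(3)[of i] by auto
  qed
  ultimately show ?case
    unfolding u using complete_exceptional_braid[OF F(1) m] by blast
qed

lemma braid_delta_facts:
  assumes E: "complete_exceptional n E" and k: "k < n"
  shows "complete_exceptional n (braid_delta n k E)"
    and "i \<in> {1..k} \<Longrightarrow> braid_delta n k E (i + 1) = E i"
    and "k + 1 < i \<Longrightarrow> braid_delta n k E i = E i"
  using foldr_braid[OF E k, of 1] by (auto simp: braid_delta_def)

text \<open>The factors up to \<open>\<delta>_(m - 1)\<close> leave the places after
  \<open>m\<close> alone. Every later \<open>\<delta>_k\<close> moves the first \<open>k\<close>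
  places one step right, so the \<open>m\<close> objects produced so far reappear unchanged as the
  last \<open>m\<close> objects of the Garside image.\<close>

lemma garside_interpolation:
  assumes E: "complete_exceptional n E" and m: "m \<le> n"
  shows "complete_exceptional n (\<lambda>i. if i \<le> m then garside n E (n - m + i) else E i)"
proof (cases "m = 0")
  case True
  then show ?thesis
    using complete_exceptional_cong[of n "\<lambda>i. if i \<le> m then garside n E (n - m + i) else E i" E] E
    by simp
next
  case m0: False
  define G where "G k = foldr (braid_delta n) (rev [1..<k]) E" for k
  have GS: "G (Suc k) = braid_delta n k (G k)" if "1 \<le> k" for k
    using that by (simp add: G_def)
  have G: "complete_exceptional n (G k) \<and> (\<forall>i>k. G k i = E i)" if "1 \<le> k" "k \<le> n" for k
    using that
  proof (induction k rule: dec_induct)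
    case base
    then show ?case using E by (simp add: G_def)
  next
    case (step k)
    then have k: "k < n" and C: "complete_exceptional n (G k)" and r: "\<And>i. k < i \<Longrightarrow> G k i = E i" by auto
    show ?case
      using braid_delta_facts(1,3)[OF C k] r by (simp add: GS[OF step(1)])
  qed
  have shift: "G k (k - m + i) = G m i" if "m \<le> k" "k \<le> n" "i \<in> {1..m}" for k i
    using that(1,2)
  proof (induction k rule: dec_induct)
    case (step k)
    then have C: "complete_exceptional n (G k)" and k: "k < n" "1 \<le> k" using G m0 by auto
    have "G (Suc k) (k - m + i + 1) = G k (k - m + i)"
      unfolding GS[OF k(2)] by (rule braid_delta_facts(2)[OF C k(1)]) (use that step in auto)
    then show ?case using step by (simp add: Suc_diff_le)
  qed simp
  have "complete_exceptional n (G m)" and r: "\<And>i. m < i \<Longrightarrow> G m i = E i"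
    using G[of m] m m0 by auto
  moreover have "garside n E = G n" by (simp add: garside_def G_def)
  ultimately show ?thesis
    using shift[OF m order_refl] r
      complete_exceptional_cong[of n "\<lambda>i. if i \<le> m then garside n E (n - m + i) else E i" "G m"]
    by auto
qed

section \<open>Relative projectivity from paths of edges\<close>

lemma conn_rtrancl:
  assumes Y: "Y \<in> perp_edges n R" and pq: "(p, q) \<in> (R \<union> R\<inverse>)\<^sup>*"
  shows "conn n Y p q"
  using pq
proof (induction rule: rtrancl_induct)
  case base
  show ?case by (rule conn_refl)
next
  case (step q r)
  have "(q, r) \<in> R \<or> (r, q) \<in> R" using step(2) by blast
  then have "conn n Y q r" using Y conn_sym unfolding perp_edges_def by blast
  then show ?case using step(3) conn_trans Y is_rep_linear unfolding perp_edges_def by blast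
qed

text \<open>Paths carry bijective transports for every \<open>Y\<close> in the perpendicular
  category. Reaching \<open>n + 1\<close>, or a vertex not after \<open>a i\<close>, thus yields one
  of the two alternatives in \<open>projective_in_perp_edges\<close>.\<close>

lemma relatively_projectiveI:
  fixes X :: "nat \<Rightarrow> 'k::field rep"
  assumes X: "\<And>j. j \<in> {1..n} \<Longrightarrow> is_ival n (X j) (a j) (b j)" and E: "exc_seq n a b" and i: "i \<in> {1..n}"
    and R: "R = {(a j, b j) |j. j \<in> {i + 1..n}}"
    and c: "(b i, n + 1) \<in> (R \<union> R\<inverse>)\<^sup>* \<or> (\<exists>x\<le>a i. (b i, x) \<in> (R \<union> R\<inverse>)\<^sup>*)"
  shows "relatively_projective n X i"
proof -
  have js: "set [i + 1..<n + 1] = {i + 1..n}" by auto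
  have "Y \<in> perp n (dsum_list (map X [i + 1..<n + 1])) \<longleftrightarrow> Y \<in> perp_edges n R" for Y :: "'k rep"
  proof -
    have "is_ival n (X j) (a j) (b j)" if "j \<in> set [i + 1..<n + 1]" for j
      using X that by auto
    from perp_dsum_list_iff[of "[i + 1..<n + 1]" n X a b Y, OF this] show ?thesis
      unfolding js perp_edges_def R by blast
  qed
  then have p: "perp n (dsum_list (map X [i + 1..<n + 1])) = perp_edges n R" by blast
  have "projective_in n (perp_edges n R) (X i)"
  proof (rule projective_in_perp_edges[OF _ X[OF i]])
    show "x \<le> y" if xy: "(x, y) \<in> R" for x y
    proof -
      obtain j where j: "j \<in> {i + 1..n}" "x = a j" "y = b j" using xy unfolding R by blast
      then have "interval n (a j) (b j)" by (intro exc_seq_interval[OF E]) auto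
      then show ?thesis using j by (simp add: interval_def)
    qed
    have "conn n (X i) (a j) (b j)" if "j \<in> {i + 1..n}" for j
    proof -
      have j: "j \<in> {1..n}" "i < j" using that by auto
      have "a j < b j" using exc_seq_interval[OF E j(1)] by (simp add: interval_def)
      then show ?thesis using conn_is_ival_iff[OF X[OF i]] exc_seq_orth[OF E i j] by blast
    qed
    then show "X i \<in> perp_edges n R"
      using X[OF i] unfolding perp_edges_def R is_ival_def by blast
    show "(\<forall>Y::'k rep \<in> perp_edges n R. conn n Y (b i) (n + 1)) \<or>
        (\<exists>x\<le>a i. \<forall>Y::'k rep \<in> perp_edges n R. conn n Y x (b i))"
      using c conn_rtrancl conn_sym by metis
  qed
  then show ?thesis unfolding relatively_projective_def p .
qed

section \<open>Support tilting sets\<close>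

lemma support_tilting_ival:
  assumes S: "support_tilting n S" and T: "T \<in> S"
  shows "\<exists>x y. is_ival n (snd T) x y \<and> (fst T = - 1 \<longrightarrow> y = n + 1) \<and> fst T \<in> {1, - 1}"
proof -
  obtain e M where eM: "T = (e, M)" by (cases T)
  have "\<forall>(e, M)\<in>S. (e = 1 \<and> indecomposable n M) \<or>
      (e = - 1 \<and> is_rep n M \<and> (\<exists>k\<in>{1..n}. iso_rep n M (proj_rep k)))"
    using S unfolding support_tilting_def by (elim conjE)
  from bspec[OF this T] have "(e = 1 \<and> indecomposable n M) \<or>
      (e = - 1 \<and> is_rep n M \<and> (\<exists>k\<in>{1..n}. iso_rep n M (proj_rep k)))"
    by (simp only: eM prod.case)
  then show ?thesis
  proof
    assume "e = 1 \<and> indecomposable n M"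
    then show ?thesis using eM by (auto simp: indecomposable_iff)
  next
    assume e: "e = - 1 \<and> is_rep n M \<and> (\<exists>k\<in>{1..n}. iso_rep n M (proj_rep k))"
    then obtain k where k: "k \<in> {1..n}" "iso_rep n M (proj_rep k)" by blast
    have "iso_rep n M (ival k (n + 1))" by (rule iso_rep_trans[OF k(2) proj_rep_iso[OF k(1)]])
    then have "is_ival n M k (n + 1)" using e k(1) by (simp add: is_ival_def interval_def)
    then show ?thesis using eM e by auto
  qed
qed

text \<open>Modules come before shifted projectives, and within both groups \<open>x + y\<close> decreases; a nonzero
  homomorphism from the interval module \<open>(x, y)\<close> to \<open>(z, w)\<close> requires \<open>z \<le> x\<close> and \<open>w \<le> y\<close>.\<close>

lemma support_tilting_arrangement:
  fixes S :: "'k::field obj set"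
  assumes S: "support_tilting n S"
  shows "\<exists>E \<epsilon>. signed_exceptional n (\<lambda>i. (\<epsilon> i, E i)) \<and> (\<lambda>i. (\<epsilon> i, E i)) ` {1..n} = S"
proof -
  have fin: "finite S" "card S = n" using S by (auto simp: support_tilting_def)
  obtain x y where xy: "\<And>T. T \<in> S \<Longrightarrow> is_ival n (snd T) (x T) (y T)"
    and neg: "\<And>T. T \<in> S \<Longrightarrow> fst T = - 1 \<Longrightarrow> y T = n + 1" and sgn: "\<And>T. T \<in> S \<Longrightarrow> fst T \<in> {1, - 1}"
    using support_tilting_ival[OF S] by metis
  \<comment> \<open>As \<open>x + y\<close> lies between 3 and \<open>2 * n + 1\<close>, keys of
    modules are negative and the offset makes those of shifted projectives positive; within a group,
    ascending keys mean descending \<open>x + y\<close>.\<close>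
  define \<kappa> where "\<kappa> T = (if fst T = 1 then 0 else 2 * int n + 3) - int (x T) - int (y T)" for T :: "'k obj"
  obtain xs0 where xs0: "set xs0 = S" "distinct xs0" using finite_distinct_list[OF fin(1)] by blast
  define xs where "xs = sort_key \<kappa> xs0"
  have xs: "set xs = S" "distinct xs" "sorted (map \<kappa> xs)" using xs0 by (simp_all add: xs_def)
  have len: "length xs = n" using distinct_card[OF xs(2)] xs(1) fin(2) by simp
  define U where "U i = xs ! (i - 1)" for i
  have US: "U i \<in> S" if "i \<in> {1..n}" for i
    using that len xs(1) nth_mem[of "i - 1" xs] unfolding U_def by auto
  have Uimg: "U ` {1..n} = S"
  proof
    show "U ` {1..n} \<subseteq> S" using US by blast
    show "S \<subseteq> U ` {1..n}"
    proof
      fix T assume "T \<in> S"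
      then obtain i where "i < n" "xs ! i = T" using xs(1) len by (metis in_set_conv_nth)
      then show "T \<in> U ` {1..n}" by (intro image_eqI[of _ _ "i + 1"]) (auto simp: U_def)
    qed
  qed
  have I: "is_ival n (snd (U i)) (x (U i)) (y (U i))" if "i \<in> {1..n}" for i
    using xy US that by blast
  have exc: "exc_seq n (\<lambda>i. x (U i)) (\<lambda>i. y (U i))"
    unfolding exc_seq_def
  proof (intro conjI ballI impI)
    show "interval n (x (U i)) (y (U i))" if "i \<in> {1..n}" for i
      using I[OF that] by (simp add: is_ival_def)
    fix i j assume i: "i \<in> {1..n}" and j: "j \<in> {1..n}" and ij: "i < j"
    let ?T = "U i" and ?V = "U j"
    note IT = I[OF i] and IV = I[OF j]
    have h: "x ?T < y ?T" "y ?T \<le> n + 1" "x ?V < y ?V" "y ?V \<le> n + 1"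
      using IT IV by (auto simp: is_ival_def interval_def)
    have "i - 1 \<noteq> j - 1" using i j ij by auto
    then have ne: "?T \<noteq> ?V"
    proof -
      have "i - 1 < length xs" "j - 1 < length xs" using i j len by auto
      then show ?thesis
        unfolding U_def using nth_eq_iff_index_eq[OF xs(2)] \<open>i - 1 \<noteq> j - 1\<close> by blast
    qed
    have "map \<kappa> xs ! (i - 1) \<le> map \<kappa> xs ! (j - 1)"
      by (rule sorted_nth_mono[OF xs(3)]) (use i j ij len in auto)
    then have k: "\<kappa> ?T \<le> \<kappa> ?V" using i j len by (auto simp: U_def)
    have dv: "derived_Hom_vanishes n ?V ?T 1" and "\<not> iso_obj n ?T ?V"
      using S US[OF i] US[OF j] ne unfolding support_tilting_def by blast+
    then have niso: "fst ?T = fst ?V \<Longrightarrow> \<not> iso_rep n (snd ?T) (snd ?V)"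
      by (simp add: iso_obj_def)
    \<comment> \<open>A nonzero map from the later to the earlier object needs both ends of the
      earlier interval to be at most those of the later one, whereas the keys order the sums of the
      ends the other way. The ends would coincide, against nonisomorphy.\<close>
    have nHom: "\<not> (x ?T \<le> x ?V \<and> x ?V < y ?T \<and> y ?T \<le> y ?V)" if f: "fst ?T = fst ?V"
    proof
      assume c: "x ?T \<le> x ?V \<and> x ?V < y ?T \<and> y ?T \<le> y ?V"
      have "x ?V + y ?V \<le> x ?T + y ?T" using k f by (simp add: \<kappa>_def split: if_splits)
      then have "x ?T = x ?V" "y ?T = y ?V" using c by auto
      then have "iso_rep n (snd ?T) (snd ?V)"
        using IT IV iso_rep_trans iso_rep_sym unfolding is_ival_def by metis
      then show False using niso[OF f] by simp
    qed
    have "Ext_vanishes n 0 (snd ?V) (snd ?T) \<and> Ext_vanishes n 1 (snd ?V) (snd ?T)"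
    proof (cases "fst ?V = - 1")
      case V: True
      then have yV: "y ?V = n + 1" using neg US[OF j] by blast
      then have "Ext_vanishes n 1 (snd ?V) (snd ?T)"
        using Ext_vanishes_ivals_iff(2)[OF IV IT] h by simp
      moreover have "Ext_vanishes n 0 (snd ?V) (snd ?T)"
      proof (cases "fst ?T = - 1")
        case True
        then show ?thesis using Ext_vanishes_ivals_iff(1)[OF IV IT] nHom V by simp
      next
        case False
        then have "fst ?T = 1" using sgn[OF US[OF i]] by simp
        \<comment> \<open>Between a shifted projective and a module the degree is
          \<open>0 + 1 - 1 = 0\<close>, so the tilting condition speaks of Hom.\<close>
        then show ?thesis using dv V by (simp add: derived_Hom_vanishes_def shift_of_def)
      qed
      ultimately show ?thesis by simp
    next
      case False
      then have V: "fst ?V = 1" using sgn[OF US[OF j]] by simp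
      have T: "fst ?T = 1"
      proof (rule ccontr)
        assume "fst ?T \<noteq> 1"
        then show False using k V h by (simp add: \<kappa>_def)
      qed
      then have "Ext_vanishes n 1 (snd ?V) (snd ?T)"
        using dv V by (simp add: derived_Hom_vanishes_def shift_of_def)
      then show ?thesis using Ext_vanishes_ivals_iff(1)[OF IV IT] nHom T V by simp
    qed
    then show "ind (x ?T) (y ?T) (x ?V) = ind (x ?T) (y ?T) (y ?V)"
      using Ext_vanishes_ivals_iff(3)[OF IV IT] by blast
  qed
  have CE: "complete_exceptional n (\<lambda>i. snd (U i))"
    using complete_exceptional_iff_exc_seq[of n "\<lambda>i. snd (U i)" "\<lambda>i. x (U i)" "\<lambda>i. y (U i)"] I exc by blast
  have "relatively_projective n (\<lambda>i. snd (U i)) i" if i: "i \<in> {1..n}" and "fst (U i) = - 1" for i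
  \<comment> \<open>A projective interval already ends at \<open>n + 1\<close>, so the empty path
    suffices.\<close>
  proof (rule relatively_projectiveI[OF I exc i refl])
    show "(y (U i), n + 1) \<in> ({(x (U j), y (U j)) |j. j \<in> {i + 1..n}} \<union> {(x (U j), y (U j)) |j. j \<in> {i + 1..n}}\<inverse>)\<^sup>* \<or>
      (\<exists>z\<le>x (U i). (y (U i), z) \<in> ({(x (U j), y (U j)) |j. j \<in> {i + 1..n}} \<union> {(x (U j), y (U j)) |j. j \<in> {i + 1..n}}\<inverse>)\<^sup>*)"
      using neg[OF US[OF i] that(2)] by simp
  qed
  then have "signed_exceptional n (\<lambda>i. (fst (U i), snd (U i)))"
    unfolding signed_exceptional_def using CE sgn[OF US] by simp
  moreover have "(\<lambda>i. (fst (U i), snd (U i))) ` {1..n} = S" using Uimg by simp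
  ultimately show ?thesis
    by (intro exI[of _ "\<lambda>i. snd (U i)"] exI[of _ "\<lambda>i. fst (U i)"] conjI)
qed

lemma sum_reverse_above:
  fixes f :: "nat \<Rightarrow> int"
  assumes "i \<in> {1..n}"
  shows "(\<Sum>j\<in>{i + 1..n}. f (n + 1 - j)) = (\<Sum>l\<in>{1..n + 1 - i - 1}. f l)"
  by (rule sum.reindex_bij_witness[of _ "\<lambda>l. n + 1 - l" "\<lambda>j. n + 1 - j"]) (use assms in auto)

text \<open>The duality is asserted for every arrangement of \<open>S\<close>, not only for the one
  constructed. Since \<open>E'_k\<close> is counted from the right, the sequence itself is
  \<open>i \<mapsto> E' (n + 1 - i)\<close>.\<close>

theorem proposition4p16:
  fixes S :: "'k::field obj set" and n :: nat
  assumes n: "n \<ge> 1" and S: "support_tilting n S"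
  shows "(\<exists>E \<epsilon>. signed_exceptional n (\<lambda>i. (\<epsilon> i, E i)) \<and>
            (\<lambda>i. (\<epsilon> i, E i)) ` {1..n} = S) \<and>
         (\<forall>E \<epsilon>. signed_exceptional n (\<lambda>i. (\<epsilon> i, E i)) \<and>
            (\<lambda>i. (\<epsilon> i, E i)) ` {1..n} = S \<longrightarrow>
            (\<forall>E'. (\<forall>k\<in>{1..n}. E' k = garside n E (n + 1 - k)) \<longrightarrow>
              (\<exists>\<epsilon>'. signed_exceptional n (\<lambda>i. (\<epsilon>' (n + 1 - i), E' (n + 1 - i))) \<and>
                (\<forall>k\<in>{1..n}. \<forall>j\<in>{1..n}.
                   \<epsilon> k * \<epsilon>' j * euler_form n (E k) (E' j) = (if k = j then 1 else 0)) \<and>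
                igusa_todorov n (\<lambda>i. (\<epsilon> (n + 1 - i), E (n + 1 - i)))
                  (\<lambda>i. (\<epsilon>' (n + 1 - i), E' (n + 1 - i))))))"
proof (intro conjI allI impI)
  show "\<exists>E \<epsilon>. signed_exceptional n (\<lambda>i. (\<epsilon> i, E i)) \<and> (\<lambda>i. (\<epsilon> i, E i)) ` {1..n} = S"
    by (rule support_tilting_arrangement[OF S])
next
  fix E :: "nat \<Rightarrow> 'k rep" and \<epsilon> :: "nat \<Rightarrow> int" and E' :: "nat \<Rightarrow> 'k rep"
  assume ES: "signed_exceptional n (\<lambda>i. (\<epsilon> i, E i)) \<and> (\<lambda>i. (\<epsilon> i, E i)) ` {1..n} = S"
    and E': "\<forall>k\<in>{1..n}. E' k = garside n E (n + 1 - k)"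
  have CE: "complete_exceptional n E" and sgn: "\<And>k. k \<in> {1..n} \<Longrightarrow> \<epsilon> k \<in> {1, - 1}"
    and img: "(\<lambda>i. (\<epsilon> i, E i)) ` {1..n} = S"
    using ES by (auto simp: signed_exceptional_def)
  obtain a b where ab: "\<And>k. k \<in> {1..n} \<Longrightarrow> is_ival n (E k) (a k) (b k)"
    using complete_exceptional_ivals[OF CE] by metis
  \<comment> \<open>Place \<open>n - m + i\<close> of the Garside image, counted from the right, is
    place \<open>m + 1 - i\<close>; this turns the interpolating sequences into the form of
    \<open>dual_seq\<close>.\<close>
  have CEm: "complete_exceptional n (\<lambda>i. if i \<le> m then E' (m + 1 - i) else E i)" if m: "m \<le> n" for m
  proof -
    have "(if i \<le> m then garside n E (n - m + i) else E i) = (if i \<le> m then E' (m + 1 - i) else E i)"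
      if "i \<in> {1..n}" for i
    proof (cases "i \<le> m")
      case True
      then have "m + 1 - i \<in> {1..n}" "n + 1 - (m + 1 - i) = n - m + i" using m that by auto
      then show ?thesis using E' True by simp
    qed simp
    then show ?thesis
      using garside_interpolation[OF CE m] complete_exceptional_cong[of n
        "\<lambda>i. if i \<le> m then garside n E (n - m + i) else E i" "\<lambda>i. if i \<le> m then E' (m + 1 - i) else E i"]
      by blast
  qed
  have "complete_exceptional n (\<lambda>i. if i \<le> n then E' (n + 1 - i) else E i)" by (rule CEm) simp
  then have CX: "complete_exceptional n (\<lambda>i. E' (n + 1 - i))"
    using complete_exceptional_cong[of n "\<lambda>i. E' (n + 1 - i)" "\<lambda>i. if i \<le> n then E' (n + 1 - i) else E i"]
    by simp
  have "\<exists>x y. is_ival n (E' k) x y" if "k \<in> {1..n}" for k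
  proof -
    have "n + 1 - k \<in> {1..n}" "n + 1 - (n + 1 - k) = k" using that by auto
    then show ?thesis using CX unfolding complete_exceptional_def indecomposable_iff by metis
  qed
  then obtain a' b' where ab': "\<And>k. k \<in> {1..n} \<Longrightarrow> is_ival n (E' k) (a' k) (b' k)" by metis
  have D: "dual_seq n a b a' b'"
    unfolding dual_seq_def
  proof (intro allI impI)
    fix m assume m: "m \<le> n"
    have "is_ival n (if i \<le> m then E' (m + 1 - i) else E i)
        (if i \<le> m then a' (m + 1 - i) else a i) (if i \<le> m then b' (m + 1 - i) else b i)"
      if "i \<in> {1..n}" for i
    proof (cases "i \<le> m")
      case True
      then have "m + 1 - i \<in> {1..n}" using m that by auto
      then show ?thesis using ab' True by simp
    qed (use ab[OF that] in simp)
    then show "exc_seq n (\<lambda>i. if i \<le> m then a' (m + 1 - i) else a i) (\<lambda>i. if i \<le> m then b' (m + 1 - i) else b i)"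
      using CEm[OF m] complete_exceptional_iff_exc_seq[of n "\<lambda>i. if i \<le> m then E' (m + 1 - i) else E i"
        "\<lambda>i. if i \<le> m then a' (m + 1 - i) else a i" "\<lambda>i. if i \<le> m then b' (m + 1 - i) else b i"]
      by blast
  qed
  define \<chi> where "\<chi> k = ind (a' k) (b' k) (a k) - ind (a' k) (b' k) (b k)" for k
  define \<epsilon>' where "\<epsilon>' k = \<epsilon> k * \<chi> k" for k
  have \<chi>: "\<chi> k \<in> {1, - 1}" if "k \<in> {1..n}" for k
    unfolding \<chi>_def by (rule dual_seq_diagonal[OF D that])
  \<comment> \<open>Membership in \<open>S\<close> is stronger here than relative projectivity: a
    term with sign \<open>- 1\<close> is a shifted \<open>P_k\<close>, whose interval ends at
    \<open>n + 1\<close>.\<close>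
  have bn: "b k = n + 1" if k: "k \<in> {1..n}" and e: "\<epsilon> k = - 1" for k
  proof -
    have "(\<epsilon> k, E k) \<in> S" using img k by blast
    from support_tilting_ival[OF S this] obtain x where "is_ival n (E k) x (n + 1)"
      using e by auto
    then show ?thesis using is_ival_unique ab[OF k] by blast
  qed
  have rev: "n + 1 - i \<in> {1..n}" "n + 1 - (n + 1 - i) = i" if "i \<in> {1..n}" for i
    using that by auto
  have edges: "{(a' (n + 1 - j), b' (n + 1 - j)) |j. j \<in> {i + 1..n}} = {(a' l, b' l) |l. l \<in> {1..n + 1 - i - 1}}"
    if "i \<in> {1..n}" for i
  proof (intro set_eqI iffI)
    fix p assume "p \<in> {(a' (n + 1 - j), b' (n + 1 - j)) |j. j \<in> {i + 1..n}}"
    then obtain j where j: "j \<in> {i + 1..n}" "p = (a' (n + 1 - j), b' (n + 1 - j))" by blast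
    have "n + 1 - j \<in> {1..n + 1 - i - 1}" using j(1) by auto
    then show "p \<in> {(a' l, b' l) |l. l \<in> {1..n + 1 - i - 1}}" using j(2) by blast
  next
    fix p assume "p \<in> {(a' l, b' l) |l. l \<in> {1..n + 1 - i - 1}}"
    then obtain l where l: "l \<in> {1..n + 1 - i - 1}" "p = (a' l, b' l)" by blast
    have "n + 1 - l \<in> {i + 1..n}" "n + 1 - (n + 1 - l) = l" using l(1) that by auto
    then show "p \<in> {(a' (n + 1 - j), b' (n + 1 - j)) |j. j \<in> {i + 1..n}}" using l(2) by (metis (mono_tags, lifting) mem_Collect_eq)
  qed
  have RP: "relatively_projective n (\<lambda>i. E' (n + 1 - i)) i"
    if i: "i \<in> {1..n}" and e: "\<epsilon>' (n + 1 - i) = - 1" for i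
  proof -
    let ?k = "n + 1 - i"
    let ?R = "{(a' l, b' l) |l. l \<in> {1..?k - 1}}"
    note k = rev(1)[OF i]
    \<comment> \<open>A negative product has exactly one negative factor. In the first case the path
      from \<open>b' ?k\<close> leads to \<open>b ?k\<close>, which is \<open>n + 1\<close>; in the
      second it leads to \<open>a ?k\<close>, to the left of \<open>a' ?k\<close>.\<close>
    consider "\<epsilon> ?k = - 1" "\<chi> ?k = 1" | "\<chi> ?k = - 1"
      using e \<chi>[OF k] sgn[OF k] by (auto simp: \<epsilon>'_def)
    then have c: "(b' ?k, n + 1) \<in> (?R \<union> ?R\<inverse>)\<^sup>* \<or> (\<exists>x\<le>a' ?k. (b' ?k, x) \<in> (?R \<union> ?R\<inverse>)\<^sup>*)"
    proof cases
      case 1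
      show ?thesis
        using dual_seq_component(1)[OF D k 1(2)[unfolded \<chi>_def]] unfolding bn[OF k 1(1)] by (rule disjI1)
    next
      case 2
      have "(b' ?k, a ?k) \<in> (?R \<union> ?R\<inverse>)\<^sup>*" "a ?k \<le> a' ?k"
        using dual_seq_component(2)[OF D k 2[unfolded \<chi>_def]] by simp_all
      then show ?thesis by (intro disjI2 exI[of _ "a ?k"] conjI)
    qed
    have X: "is_ival n (E' (n + 1 - j)) (a' (n + 1 - j)) (b' (n + 1 - j))" if "j \<in> {1..n}" for j
      by (rule ab'[OF rev(1)[OF that]])
    show ?thesis
      by (rule relatively_projectiveI[of n "\<lambda>i. E' (n + 1 - i)" "\<lambda>i. a' (n + 1 - i)" "\<lambda>i. b' (n + 1 - i)",
            OF X dual_seq_reverse[OF D] i edges[OF i, symmetric] c])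
  qed
  have "\<epsilon>' k \<in> {1, - 1}" if "k \<in> {1..n}" for k
    using \<chi>[OF that] sgn[OF that] by (auto simp: \<epsilon>'_def)
  then have SX: "signed_exceptional n (\<lambda>i. (\<epsilon>' (n + 1 - i), E' (n + 1 - i)))"
    unfolding signed_exceptional_def using CX RP rev(1) by simp
  have dual: "\<epsilon> k * \<epsilon>' j * euler_form n (E k) (E' j) = (if k = j then 1 else 0)"
    if k: "k \<in> {1..n}" and j: "j \<in> {1..n}" for k j
  proof -
    have e: "euler_form n (E k) (E' j) = ind (a' j) (b' j) (a k) - ind (a' j) (b' j) (b k)"
      by (rule euler_form_ival[OF ab[OF k] ab'[OF j]])
    consider "k = j" | "k < j" | "j < k" by linarith
    then show ?thesis
    proof cases
      case 1
      then have "euler_form n (E k) (E' j) = \<chi> k" unfolding e \<chi>_def by simp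
      then show ?thesis using 1 \<chi>[OF k] sgn[OF k] by (auto simp: \<epsilon>'_def)
    next
      case 2
      then show ?thesis using dual_seq_earlier[OF D j k] by (simp add: e)
    next
      case 3
      then show ?thesis using dual_seq_later[OF D j k] by (simp add: e)
    qed
  qed
  let ?T = "\<lambda>i. (\<epsilon> (n + 1 - i), E (n + 1 - i))"
  have "?T ` {1..n} = S"
  proof -
    have "(\<lambda>i. n + 1 - i) ` {1..n} = {1..n}"
    proof
      show "{1..n} \<subseteq> (\<lambda>i. n + 1 - i) ` {1..n}"
        using rev by (metis imageI subsetI)
    qed auto
    then have "?T ` {1..n} = (\<lambda>i. (\<epsilon> i, E i)) ` {1..n}"
      by (metis (no_types, lifting) image_cong image_image)
    then show ?thesis using img by simp
  qed
  moreover have "card S = n" using S by (simp add: support_tilting_def)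
  ultimately have OT: "ordered_support_tilting n ?T"
    using S unfolding ordered_support_tilting_def by (simp add: eq_card_imp_inj_on)
  have dimE: "int (kvec.dim (vspace (E k) v)) = ind (a k) (b k) v"
    "int (kvec.dim (vspace (E' k) v)) = ind (a' k) (b' k) v" if "k \<in> {1..n}" "v \<in> {1..n}" for k v
    using dim_is_ival[OF ab[OF that(1)], of v] dim_is_ival[OF ab'[OF that(1)], of v] that(2)
    by (simp_all add: space_at_def)
  \<comment> \<open>In the reversed order the terms after place \<open>i\<close> are the
    \<open>E_l\<close> with \<open>l < n + 1 - i\<close>, which is the case treated by
    \<open>dual_seq_earlier\<close>.\<close>
  have perp: "E' (n + 1 - i) \<in> perp n (dsum_list (map (\<lambda>j. E (n + 1 - j)) [i + 1..<n + 1]))"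
    if i: "i \<in> {1..n}" for i
  proof -
    let ?k = "n + 1 - i"
    note k = rev(1)[OF i]
    have j: "n + 1 - j \<in> {1..n} \<and> n + 1 - j < ?k" if "j \<in> set [i + 1..<n + 1]" for j
      using that i by auto
    have I: "is_ival n (E (n + 1 - j)) (a (n + 1 - j)) (b (n + 1 - j))" if "j \<in> set [i + 1..<n + 1]" for j
      using ab j[OF that] by blast
    have "conn n (E' ?k) (a (n + 1 - j)) (b (n + 1 - j))" if "j \<in> set [i + 1..<n + 1]" for j
    proof -
      have "a (n + 1 - j) < b (n + 1 - j)" using I[OF that] by (simp add: is_ival_def interval_def)
      then show ?thesis
        using conn_is_ival_iff[OF ab'[OF k]] dual_seq_earlier[OF D k] j[OF that] by blast
    qed
    moreover have "is_rep n (E' ?k)" using ab'[OF k] by (simp add: is_ival_def)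
    ultimately show ?thesis
      using perp_dsum_list_iff[of "[i + 1..<n + 1]" n "\<lambda>j. E (n + 1 - j)" "\<lambda>j. a (n + 1 - j)"
          "\<lambda>j. b (n + 1 - j)" "E' ?k", OF I] by blast
  qed
  have span: "\<exists>c. \<forall>v\<in>{1..n}. dim_vec (\<epsilon>' (n + 1 - i), E' (n + 1 - i)) v - dim_vec (?T i) v
      = (\<Sum>j\<in>{i + 1..n}. c j * dim_vec (?T j) v)" if i: "i \<in> {1..n}" for i
  proof -
    let ?k = "n + 1 - i"
    note k = rev(1)[OF i]
    \<comment> \<open>Here the expansion runs along the original sequence, since the congruence is
      modulo the elements of the support tilting set.\<close>
    obtain c where c: "\<And>v. v \<in> {1..n} \<Longrightarrow> ind (a' ?k) (b' ?k) v - \<chi> ?k * ind (a ?k) (b ?k) v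
        = (\<Sum>l\<in>{1..?k - 1}. c l * ind (a l) (b l) v)"
      using dual_seq_expand[OF D k dual_seq_base[OF D]] unfolding \<chi>_def by blast
    have s2: "\<epsilon> l * \<epsilon> l = 1" if "l \<in> {1..n}" for l using sgn[OF that] by auto
    have \<epsilon>\<chi>: "\<epsilon>' ?k * \<chi> ?k = \<epsilon> ?k" using \<chi>[OF k] by (auto simp: \<epsilon>'_def)
    \<comment> \<open>Multiplying the relation by \<open>\<epsilon>' ?k\<close> turns its left side
      into the difference of signed dimension vectors, as
      \<open>\<epsilon>' ?k * \<chi> ?k = \<epsilon> ?k\<close>. The factor
      \<open>\<epsilon> l\<close> offsets the sign in the dimension vector of the
      \<open>l\<close>-th term, its square being 1.\<close>
    define d where "d l = \<epsilon>' ?k * c l * \<epsilon> l" for l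
    have "dim_vec (\<epsilon>' ?k, E' ?k) v - dim_vec (?T i) v = (\<Sum>j\<in>{i + 1..n}. d (n + 1 - j) * dim_vec (?T j) v)"
      if v: "v \<in> {1..n}" for v
    proof -
      have "(\<Sum>j\<in>{i + 1..n}. d (n + 1 - j) * dim_vec (?T j) v)
          = (\<Sum>l\<in>{1..?k - 1}. d l * (\<epsilon> l * int (kvec.dim (vspace (E l) v))))"
        unfolding dim_vec_def fst_conv snd_conv
        by (rule sum_reverse_above[OF i, of "\<lambda>l. d l * (\<epsilon> l * int (kvec.dim (vspace (E l) v)))"])
      also have "\<dots> = (\<Sum>l\<in>{1..?k - 1}. \<epsilon>' ?k * (c l * ind (a l) (b l) v))"
      proof (rule sum.cong[OF refl])
        fix l assume "l \<in> {1..?k - 1}"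
        then have l: "l \<in> {1..n}" using i by auto
        have "d l * (\<epsilon> l * int (kvec.dim (vspace (E l) v))) = \<epsilon>' ?k * c l * (\<epsilon> l * \<epsilon> l) * ind (a l) (b l) v"
          using dimE(1)[OF l v] by (simp add: d_def mult.assoc)
        then show "d l * (\<epsilon> l * int (kvec.dim (vspace (E l) v))) = \<epsilon>' ?k * (c l * ind (a l) (b l) v)"
          by (simp only: s2[OF l] mult_1_right mult.assoc)
      qed
      also have "\<dots> = \<epsilon>' ?k * (ind (a' ?k) (b' ?k) v - \<chi> ?k * ind (a ?k) (b ?k) v)"
        unfolding c[OF v] by (rule sum_distrib_left[symmetric])
      also have "\<dots> = \<epsilon>' ?k * ind (a' ?k) (b' ?k) v - (\<epsilon>' ?k * \<chi> ?k) * ind (a ?k) (b ?k) v"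
        by (simp only: right_diff_distrib mult.assoc)
      also have "\<dots> = dim_vec (\<epsilon>' ?k, E' ?k) v - dim_vec (?T i) v"
        unfolding \<epsilon>\<chi> dim_vec_def fst_conv snd_conv dimE[OF k v] ..
      finally show ?thesis by (rule sym)
    qed
    then show ?thesis by (intro exI[of _ "\<lambda>j. d (n + 1 - j)"]) blast
  qed
  have "igusa_todorov n ?T (\<lambda>i. (\<epsilon>' (n + 1 - i), E' (n + 1 - i)))"
    unfolding igusa_todorov_def snd_conv using OT SX perp span by blast
  then show "\<exists>\<epsilon>'. signed_exceptional n (\<lambda>i. (\<epsilon>' (n + 1 - i), E' (n + 1 - i))) \<and>
      (\<forall>k\<in>{1..n}. \<forall>j\<in>{1..n}. \<epsilon> k * \<epsilon>' j * euler_form n (E k) (E' j) = (if k = j then 1 else 0)) \<and>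
      igusa_todorov n ?T (\<lambda>i. (\<epsilon>' (n + 1 - i), E' (n + 1 - i)))"
    using SX dual by blast
qed

end
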